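(* There exists a periodic orbit corresponding to the octahedral six-body Hamiltonian, that is, a periodic solution of the regularized octahedral Hamiltonian system with Hamiltonian $\Gamma$, for some fixed energy $E<0$.
   Context: Octahedral six-body setting: six unit point masses are located at $(\pm q_1,0,0)$, $(0,\pm q_2,0)$, $(0,0,\pm q_3)$, with Hamiltonian $H=K-U$, where $K=p_1^2+p_2^2+p_3^2$ and $U=\sum_{1\le i<j\le 3}\frac{4}{\sqrt{q_i^2+q_j^2}}+\sum_{i=1}^3\frac1{2q_i}$. Binary collisions at the origin ($q_i=0$ with the other two coordinates nonzero) are regularized by the canonical change of coordinates $q_i=Q_i^2$, $p_i=P_i/(2Q_i)$ and the change of time $dt/ds=Q_1^2Q_2^2Q_3^2$. For fixed energy $E$ of the system this gives the regularized Hamiltonian $\Gamma=\frac{dt}{ds}(H-E)$, written in the new coordinates as $$\Gamma=\tfrac14\left(P_1^2Q_2^2Q_3^2+Q_1^2P_2^2Q_3^2+Q_1^2Q_2^2P_3^2\right)-\sum_{1\le i<j\le 3}\frac{4Q_1^2Q_2^2Q_3^2}{\sqrt{Q_i^4+Q_j^4}}-\tfrac12\left(Q_2^2Q_3^2+Q_1^2Q_3^2+Q_1^2Q_2^2\right)-E\,Q_1^2Q_2^2Q_3^2.$$ The equations of motion are $\dot Q_i=\partial\Gamma/\partial P_i$, $\dot P_i=-\partial\Gamma/\partial Q_i$, where the dot denotes $d/ds$, and solutions of energy $E$ satisfy $\Gamma=0$. *)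

theory Defs
  imports "HOL-Analysis.Analysis"
begin

definition kinetic :: "real ^ 3 \<Rightarrow> real" where
  "kinetic p = (p$1)\<^sup>2 + (p$2)\<^sup>2 + (p$3)\<^sup>2"

definition potential :: "real ^ 3 \<Rightarrow> real" where
  "potential q =
     4 / sqrt ((q$1)\<^sup>2 + (q$2)\<^sup>2) + 4 / sqrt ((q$1)\<^sup>2 + (q$3)\<^sup>2) + 4 / sqrt ((q$2)\<^sup>2 + (q$3)\<^sup>2)
     + 1 / (2 * q$1) + 1 / (2 * q$2) + 1 / (2 * q$3)"

definition octahedral_H :: "real ^ 3 \<Rightarrow> real ^ 3 \<Rightarrow> real" where
  "octahedral_H q p = kinetic p - potential q"

definition Gam :: "real \<Rightarrow> real ^ 3 \<Rightarrow> real ^ 3 \<Rightarrow> real" where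
  "Gam E Q P =
     1/4 * ((P$1)\<^sup>2 * (Q$2)\<^sup>2 * (Q$3)\<^sup>2 + (Q$1)\<^sup>2 * (P$2)\<^sup>2 * (Q$3)\<^sup>2 + (Q$1)\<^sup>2 * (Q$2)\<^sup>2 * (P$3)\<^sup>2)
     - (4 * (Q$1)\<^sup>2 * (Q$2)\<^sup>2 * (Q$3)\<^sup>2 / sqrt ((Q$1)^4 + (Q$2)^4)
        + 4 * (Q$1)\<^sup>2 * (Q$2)\<^sup>2 * (Q$3)\<^sup>2 / sqrt ((Q$1)^4 + (Q$3)^4)
        + 4 * (Q$1)\<^sup>2 * (Q$2)\<^sup>2 * (Q$3)\<^sup>2 / sqrt ((Q$2)^4 + (Q$3)^4))
     - 1/2 * ((Q$2)\<^sup>2 * (Q$3)\<^sup>2 + (Q$1)\<^sup>2 * (Q$3)\<^sup>2 + (Q$1)\<^sup>2 * (Q$2)\<^sup>2)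
     - E * (Q$1)\<^sup>2 * (Q$2)\<^sup>2 * (Q$3)\<^sup>2"

text \<open>
  Away from collisions, the regularized Hamiltonian is \<open>dt/ds (H - E)\<close> under
  \<open>q\<^sub>i = Q\<^sub>i\<^sup>2\<close>, \<open>p\<^sub>i = P\<^sub>i / (2 Q\<^sub>i)\<close>, \<open>dt/ds = Q\<^sub>1\<^sup>2 Q\<^sub>2\<^sup>2 Q\<^sub>3\<^sup>2\<close>.
\<close>
lemma Gam_eq_octahedral_H:
  assumes "\<And>i. Q$i \<noteq> 0"
  shows "Gam E Q P =
    (Q$1)\<^sup>2 * (Q$2)\<^sup>2 * (Q$3)\<^sup>2 *
      (octahedral_H (\<chi> i. (Q$i)\<^sup>2) (\<chi> i. P$i / (2 * Q$i)) - E)"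
proof -
  have nz: "Q$1 \<noteq> 0" "Q$2 \<noteq> 0" "Q$3 \<noteq> 0"
    using assms by auto
  have k: "(Q$1)\<^sup>2 * (Q$2)\<^sup>2 * (Q$3)\<^sup>2 * kinetic (\<chi> i. P$i / (2 * Q$i)) =
     1/4 * ((P$1)\<^sup>2 * (Q$2)\<^sup>2 * (Q$3)\<^sup>2 + (Q$1)\<^sup>2 * (P$2)\<^sup>2 * (Q$3)\<^sup>2 + (Q$1)\<^sup>2 * (Q$2)\<^sup>2 * (P$3)\<^sup>2)"
    using nz by (simp add: kinetic_def field_simps power2_eq_square)
  have b: "(Q$1)\<^sup>2 * (Q$2)\<^sup>2 * (Q$3)\<^sup>2 * (1 / (2 * (Q$1)\<^sup>2) + 1 / (2 * (Q$2)\<^sup>2) + 1 / (2 * (Q$3)\<^sup>2)) =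
     1/2 * ((Q$2)\<^sup>2 * (Q$3)\<^sup>2 + (Q$1)\<^sup>2 * (Q$3)\<^sup>2 + (Q$1)\<^sup>2 * (Q$2)\<^sup>2)"
    using nz by (simp add: field_simps)
  have u: "(Q$1)\<^sup>2 * (Q$2)\<^sup>2 * (Q$3)\<^sup>2 * potential (\<chi> i. (Q$i)\<^sup>2) =
      (4 * (Q$1)\<^sup>2 * (Q$2)\<^sup>2 * (Q$3)\<^sup>2 / sqrt ((Q$1)^4 + (Q$2)^4)
        + 4 * (Q$1)\<^sup>2 * (Q$2)\<^sup>2 * (Q$3)\<^sup>2 / sqrt ((Q$1)^4 + (Q$3)^4)
        + 4 * (Q$1)\<^sup>2 * (Q$2)\<^sup>2 * (Q$3)\<^sup>2 / sqrt ((Q$2)^4 + (Q$3)^4))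
     + 1/2 * ((Q$2)\<^sup>2 * (Q$3)\<^sup>2 + (Q$1)\<^sup>2 * (Q$3)\<^sup>2 + (Q$1)\<^sup>2 * (Q$2)\<^sup>2)"
    unfolding b[symmetric] by (simp add: potential_def algebra_simps)
  show ?thesis
    unfolding octahedral_H_def right_diff_distrib k u by (simp add: Gam_def algebra_simps)
qed

text \<open>
  Only binary collisions at the origin are regularized: at most one \<open>Q\<^sub>i\<close> may vanish.
  Where two coordinates vanish, \<^const>\<open>Gam\<close> contains a quotient by zero and the value
  is only the conventional one.
\<close>
definition regularized_domain :: "(real ^ 3) set" where
  "regularized_domain = {Q. \<forall>i j. i \<noteq> j \<longrightarrow> Q$i \<noteq> 0 \<or> Q$j \<noteq> 0}"

text \<open>
  Hamilton's equations \<open>Q' = \<partial>\<Gamma>/\<partial>P\<close>, \<open>P' = -\<partial>\<Gamma>/\<partial>Q\<close> for all times, on the level set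
  \<open>\<Gamma> = 0\<close>; the partial derivatives are required to exist.
\<close>
definition regularized_solution :: "real \<Rightarrow> (real \<Rightarrow> real ^ 3) \<Rightarrow> (real \<Rightarrow> real ^ 3) \<Rightarrow> bool" where
  "regularized_solution E Q P \<longleftrightarrow>
     (\<forall>s. Q s \<in> regularized_domain \<and> Gam E (Q s) (P s) = 0 \<and>
        (\<exists>Q' P'. (Q has_vector_derivative Q') (at s) \<and> (P has_vector_derivative P') (at s) \<and>
           GDERIV (\<lambda>p. Gam E (Q s) p) (P s) :> Q' \<and>
           GDERIV (\<lambda>q. Gam E q (P s)) (Q s) :> - P'))"

definition periodic_orbit :: "(real \<Rightarrow> 'a) \<Rightarrow> bool" where
  "periodic_orbit x \<longleftrightarrow> (\<exists>T>0. \<forall>s. x (s + T) = x s) \<and> (\<exists>s. x s \<noteq> x 0)"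

end

theory Submission
  imports Defs "HOL-Complex_Analysis.Great_Picard"
begin

text \<open>
  The orbit is built from a fundamental arc of a choreography in which the three pairs collide
  cyclically: \<open>q\<^sub>1\<close> collides at time 0 with \<open>q\<^sub>2 = q\<^sub>3\<close>, and \<open>q\<^sub>1 = q\<^sub>2\<close> at time 1. Among all arcs
  with these endpoint conditions one takes a minimiser of the action \<open>\<integral> K + U\<close>; it exists by Arzela-Ascoli.
  Raising a coordinate from below to a level \<open>h\<close> decreases both \<open>K\<close> and \<open>U\<close>, because all forces point to
  the origin; since such clippings respect the endpoint conditions, the minimiser has no collisions
  other than \<open>q\<^sub>1(0) = 0\<close>. Hence it satisfies the Newtonian equations, together with the natural
  boundary conditions which say that the arc is perpendicular to the reflections at both ends. The
  energy is negative by the virial identity \<open>d/dt (q \<bullet> q') = 4E + 2U\<close>. In regularized time the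
  arc solves the Hamiltonian system up to its endpoints, and reflecting it repeatedly closes it up
  after twelve copies. No flow or uniqueness theory for differential equations is needed.
\<close>

section \<open>The action functional and its minimiser\<close>

text \<open>The kinetic part of the Hamiltonian is \<open>p \<bullet> p\<close>, so velocities are
  \<open>q' = 2 p\<close>; hence the action density \<open>|q'|^2 / 4 + U\<close>, the equations
  \<open>q'' = 2 * grad U\<close>, and the factors 1/4 and 2 below. The endpoint conditions are the
  position parts of the fixed-point sets of two time-reversing symmetries of \<open>Gam\<close>; the
  momentum parts emerge as natural boundary conditions. The same conditions make the action
  coercive: from \<open>q 0 $ 1 = 0\<close> a chain of equalities at the two ends reaches all
  coordinates, so arcs of bounded action cannot escape to infinity. The delicate point is the
  prescribed collision. At time 0 the coordinate \<open>q$1\<close> cannot be varied and its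
  velocity is infinite, so the variational argument says nothing about \<open>P$1\<close> there.
  Conservation of energy fills the gap: it forces \<open>q$1 * (q$1')^2\<close> to tend to 2, so
  \<open>P$1\<close> tends to \<open>sqrt 2\<close> and the regularized time to the collision is
  finite. The duration of the arc is fixed at 1, so the energy is not prescribed but an outcome of
  the minimization.\<close>

lemma sum_lessThan_double:
  fixes f :: "nat \<Rightarrow> 'a::comm_monoid_add"
  shows "(\<Sum>k<2 * N. f k) = (\<Sum>k<N. f (2 * k) + f (Suc (2 * k)))"
  by (induction N) (simp_all add: add.assoc)

text \<open>
  The integral of \<open>\<parallel>q'\<parallel>\<^sup>2\<close> for the piecewise linear interpolation of \<open>q\<close> at level \<open>n\<close>. It increases with
  \<open>n\<close>, so boundedness in \<open>n\<close> replaces membership in a Sobolev space, and no weak derivatives occur.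
\<close>
definition dyadic_energy :: "nat \<Rightarrow> (real \<Rightarrow> 'a::real_inner) \<Rightarrow> real" where
  "dyadic_energy n q = 2 ^ n * (\<Sum>k<2 ^ n. (norm (q (real (Suc k) / 2 ^ n) - q (real k / 2 ^ n)))\<^sup>2)"

lemma dyadic_energy_nonneg: "dyadic_energy n q \<ge> 0"
  by (simp add: dyadic_energy_def sum_nonneg)

lemma norm_add_power2_le:
  fixes a b :: "'a::real_inner"
  shows "(norm (a + b))\<^sup>2 \<le> 2 * (norm a)\<^sup>2 + 2 * (norm b)\<^sup>2"
proof -
  have "0 \<le> (norm (a - b))\<^sup>2" by simp
  then show ?thesis
    by (simp add: power2_norm_eq_inner inner_simps inner_commute)
qed

lemma dyadic_even: "real (2 * k) / 2 ^ Suc n = real k / 2 ^ n"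
  by simp

text \<open>By the parallelogram law \<open>|a + b|^2 \<le> 2 * |a|^2 + 2 * |b|^2\<close>, splitting
  a chord at its midpoint cannot lower the energy; the factor 2 is the ratio of the weights at the
  two levels.\<close>

lemma dyadic_energy_mono_Suc: "dyadic_energy n q \<le> dyadic_energy (Suc n) q"
proof -
  let ?d = "\<lambda>n k. q (real (Suc k) / 2 ^ n) - q (real k / 2 ^ n)"
  have "(norm (?d n k))\<^sup>2
      \<le> 2 * ((norm (?d (Suc n) (2 * k)))\<^sup>2 + (norm (?d (Suc n) (Suc (2 * k))))\<^sup>2)" for k
  proof -
    have "?d n k = ?d (Suc n) (2 * k) + ?d (Suc n) (Suc (2 * k))"
      using dyadic_even[of "Suc k" n] dyadic_even[of k n] by simp
    then show ?thesis
      using norm_add_power2_le[of "?d (Suc n) (2 * k)" "?d (Suc n) (Suc (2 * k))"]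
      by (simp add: add.commute)
  qed
  then have "(\<Sum>k<2^n. (norm (?d n k))\<^sup>2)
      \<le> 2 * (\<Sum>k<2^n. (norm (?d (Suc n) (2 * k)))\<^sup>2 + (norm (?d (Suc n) (Suc (2 * k))))\<^sup>2)"
    unfolding sum_distrib_left by (intro sum_mono)
  also have "\<dots> = 2 * (\<Sum>k<2^Suc n. (norm (?d (Suc n) k))\<^sup>2)"
    unfolding power_Suc[of 2 n] sum_lessThan_double by (simp add: power_Suc)
  finally show ?thesis
    by (simp add: dyadic_energy_def)
qed

lemma dyadic_energy_mono: "m \<le> n \<Longrightarrow> dyadic_energy m q \<le> dyadic_energy n q"
  using dyadic_energy_mono_Suc lift_Suc_mono_le[of "\<lambda>n. dyadic_energy n q"] by blast

text \<open>Cauchy-Schwarz on the \<open>l - j\<close> increments between the two grid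
  points.\<close>

lemma dyadic_energy_dyadic_hoelder:
  assumes "j \<le> l" "l \<le> 2 ^ n"
  shows "(norm (q (real l / 2 ^ n) - q (real j / 2 ^ n)))\<^sup>2 \<le> (real l - real j) / 2 ^ n * dyadic_energy n q"
proof -
  let ?f = "\<lambda>k. q (real k / 2 ^ n)"
  let ?d = "\<lambda>k. ?f (Suc k) - ?f k"
  have "norm (?f l - ?f j) = norm (\<Sum>k=j..<l. ?d k)"
    using assms(1) by (subst sum_Suc_diff') auto
  also have "\<dots> \<le> (\<Sum>k=j..<l. norm (?d k))"
    by (rule norm_sum)
  finally have "(norm (?f l - ?f j))\<^sup>2 \<le> (\<Sum>k=j..<l. norm (?d k))\<^sup>2"
    by (rule power_mono) simp
  also have "\<dots> \<le> (\<Sum>k=j..<l. (norm (?d k))\<^sup>2) * real (card {j..<l})"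
    by (rule sum_squared_le_sum_of_squares)
  also have "(\<Sum>k=j..<l. (norm (?d k))\<^sup>2) * real (card {j..<l})
      \<le> (\<Sum>k<2^n. (norm (?d k))\<^sup>2) * real (card {j..<l})"
    by (rule mult_right_mono, rule sum_mono2) (use assms in auto)
  also have "\<dots> = (real l - real j) / 2 ^ n * dyadic_energy n q"
    using assms by (simp add: dyadic_energy_def of_nat_diff)
  finally show ?thesis .
qed

definition dyfloor :: "nat \<Rightarrow> real \<Rightarrow> nat" where
  "dyfloor n s = nat \<lfloor>2 ^ n * s\<rfloor>"

lemma dyfloor_bounds:
  assumes "s \<ge> 0"
  shows "real (dyfloor n s) / 2 ^ n \<le> s" "s < real (Suc (dyfloor n s)) / 2 ^ n"
proof -
  have "real (dyfloor n s) = of_int \<lfloor>2 ^ n * s\<rfloor>"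
    using assms by (simp add: dyfloor_def)
  then have "real (dyfloor n s) \<le> 2 ^ n * s" "2 ^ n * s < real (dyfloor n s) + 1"
    by linarith+
  then show "real (dyfloor n s) / 2 ^ n \<le> s" "s < real (Suc (dyfloor n s)) / 2 ^ n"
    by (simp_all add: field_simps)
qed

lemma dyfloor_tendsto:
  assumes "s \<ge> 0"
  shows "(\<lambda>n. real (dyfloor n s) / 2 ^ n) \<longlonglongrightarrow> s"
proof (rule tendsto_sandwich)
  show "\<forall>\<^sub>F n in sequentially. s - (1/2) ^ n \<le> real (dyfloor n s) / 2 ^ n"
    using dyfloor_bounds(2)[OF assms]
    by (intro always_eventually allI)
       (simp add: power_divide add_divide_distrib, smt (verit) )
  show "\<forall>\<^sub>F n in sequentially. real (dyfloor n s) / 2 ^ n \<le> s"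
    using dyfloor_bounds(1)[OF assms] by simp
  have "(\<lambda>n. s - (1/2::real) ^ n) \<longlonglongrightarrow> s - 0"
    by (intro tendsto_intros LIMSEQ_realpow_zero) auto
  then show "(\<lambda>n. s - (1/2::real) ^ n) \<longlonglongrightarrow> s" by simp
qed simp

lemma dyfloor_le:
  assumes "0 \<le> s" "s \<le> 1"
  shows "dyfloor n s \<le> 2 ^ n" "real (dyfloor n s) / 2 ^ n \<in> {0..1}"
proof -
  have "real (dyfloor n s) / 2 ^ n \<le> 1"
    using dyfloor_bounds(1)[OF assms(1), of n] assms(2) by linarith
  then show "real (dyfloor n s) / 2 ^ n \<in> {0..1}" by simp
  have "real (dyfloor n s) \<le> real (2 ^ n)"
    using \<open>real (dyfloor n s) / 2 ^ n \<le> 1\<close> by (simp add: field_simps)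
  then show "dyfloor n s \<le> 2 ^ n"
    by (simp only: of_nat_le_iff)
qed

lemma dyfloor_mono: "s \<le> t \<Longrightarrow> dyfloor n s \<le> dyfloor n t"
  unfolding dyfloor_def by (intro nat_mono floor_mono mult_left_mono) auto

text \<open>The embedding of \<open>H^1\<close> into the Hoelder functions of exponent 1/2 in
  discrete form: dyadic points suffice because \<open>q\<close> is continuous. Equicontinuity and
  all a priori bounds rest on it.\<close>

lemma dyadic_energy_hoelder:
  assumes "continuous_on {0..1} q" and C: "\<And>n. dyadic_energy n q \<le> C"
    and "s \<in> {0..1}" "t \<in> {0..1}"
  shows "(norm (q t - q s))\<^sup>2 \<le> C * \<bar>t - s\<bar>"
proof -
  have main: "(norm (q t - q s))\<^sup>2 \<le> C * (t - s)" if st: "0 \<le> s" "s \<le> t" "t \<le> 1" for s t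
  proof (rule LIMSEQ_le)
    let ?t = "\<lambda>n. real (dyfloor n t) / 2 ^ n" and ?s = "\<lambda>n. real (dyfloor n s) / 2 ^ n"
    have lim: "?t \<longlonglongrightarrow> t" "?s \<longlonglongrightarrow> s"
      using st by (auto intro: dyfloor_tendsto)
    have "(\<lambda>n. q (?t n)) \<longlonglongrightarrow> q t" "(\<lambda>n. q (?s n)) \<longlonglongrightarrow> q s"
      using st lim dyfloor_le
      by (auto intro!: continuous_on_tendsto_compose[OF assms(1)] always_eventually)
    then show "(\<lambda>n. (norm (q (?t n) - q (?s n)))\<^sup>2) \<longlonglongrightarrow> (norm (q t - q s))\<^sup>2"
      by (intro tendsto_intros)
    show "(\<lambda>n. C * (?t n - ?s n)) \<longlonglongrightarrow> C * (t - s)"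
      by (intro tendsto_intros lim)
    show "\<exists>N. \<forall>n\<ge>N. (norm (q (?t n) - q (?s n)))\<^sup>2 \<le> C * (?t n - ?s n)"
    proof (intro exI allI impI)
      fix n
      have "(norm (q (?t n) - q (?s n)))\<^sup>2 \<le> (real (dyfloor n t) - real (dyfloor n s)) / 2 ^ n * dyadic_energy n q"
        using st by (intro dyadic_energy_dyadic_hoelder dyfloor_mono dyfloor_le) auto
      also have "\<dots> \<le> (real (dyfloor n t) - real (dyfloor n s)) / 2 ^ n * C"
        using dyfloor_mono[OF st(2), of n] by (intro mult_left_mono C) auto
      finally show "(norm (q (?t n) - q (?s n)))\<^sup>2 \<le> C * (?t n - ?s n)"
        by (simp add: diff_divide_distrib mult.commute)
    qed
  qed
  show ?thesis
  proof (cases "s \<le> t")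
    case True
    then show ?thesis using main[of s t] assms(3,4) by auto
  next
    case False
    then show ?thesis using main[of t s] assms(3,4) by (auto simp: norm_minus_commute)
  qed
qed

text \<open>
  Truncation turns the singular potential into an increasing sequence of continuous functions and
  avoids the value \<open>1/0 = 0\<close>, which would make collisions attractive for the minimisation.
\<close>
definition trunc_inverse :: "nat \<Rightarrow> real \<Rightarrow> real" where
  "trunc_inverse n r = 1 / max r (1 / 2 ^ n)"

lemma max_dyadic_pos: "max r (1 / 2 ^ n) > (0::real)"
  by (simp add: less_max_iff_disj)

lemma trunc_inverse_pos: "trunc_inverse n r > 0"
  using max_dyadic_pos[of r n] by (simp add: trunc_inverse_def)

lemma trunc_inverse_le: "trunc_inverse n r \<le> 2 ^ n"
proof -
  have "trunc_inverse n r \<le> 1 / (1 / 2 ^ n)"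
    unfolding trunc_inverse_def by (intro divide_left_mono mult_pos_pos max_dyadic_pos) auto
  then show ?thesis by simp
qed

lemma trunc_inverse_antimono: "r \<le> s \<Longrightarrow> trunc_inverse n s \<le> trunc_inverse n r"
  unfolding trunc_inverse_def by (intro divide_left_mono mult_pos_pos max_dyadic_pos) auto

lemma trunc_inverse_mono: "m \<le> n \<Longrightarrow> trunc_inverse m r \<le> trunc_inverse n r"
  unfolding trunc_inverse_def
  by (intro divide_left_mono mult_pos_pos max_dyadic_pos max.mono order.refl) (auto simp: field_simps)

lemma trunc_inverse_eq: "1 / 2 ^ n \<le> r \<Longrightarrow> trunc_inverse n r = 1 / r"
  by (simp add: trunc_inverse_def max_absorb1)

lemma trunc_inverse_le_inverse: "r > 0 \<Longrightarrow> trunc_inverse n r \<le> 1 / r"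
  unfolding trunc_inverse_def by (intro divide_left_mono mult_pos_pos max_dyadic_pos) auto

lemma continuous_on_trunc_inverse [continuous_intros]:
  "continuous_on S f \<Longrightarrow> continuous_on S (\<lambda>x. trunc_inverse n (f x))"
  unfolding trunc_inverse_def
  by (intro continuous_intros) (use max_dyadic_pos in \<open>auto simp: less_le\<close>)

section \<open>The truncated potential and the action\<close>

definition trunc_potential :: "nat \<Rightarrow> real ^ 3 \<Rightarrow> real" where
  "trunc_potential n x = 4 * trunc_inverse n (sqrt ((x$1)\<^sup>2 + (x$2)\<^sup>2)) + 4 * trunc_inverse n (sqrt ((x$1)\<^sup>2 + (x$3)\<^sup>2))
     + 4 * trunc_inverse n (sqrt ((x$2)\<^sup>2 + (x$3)\<^sup>2))
     + trunc_inverse n (x$1) / 2 + trunc_inverse n (x$2) / 2 + trunc_inverse n (x$3) / 2"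

lemma trunc_potential_pos: "trunc_potential n x > 0"
  unfolding trunc_potential_def by (intro add_pos_pos mult_pos_pos divide_pos_pos trunc_inverse_pos) auto

lemma trunc_potential_le: "trunc_potential n x \<le> 14 * 2 ^ n"
  unfolding trunc_potential_def
  using trunc_inverse_le[of n "x$1"] trunc_inverse_le[of n "x$2"] trunc_inverse_le[of n "x$3"]
    trunc_inverse_le[of n "sqrt ((x$1)\<^sup>2 + (x$2)\<^sup>2)"] trunc_inverse_le[of n "sqrt ((x$1)\<^sup>2 + (x$3)\<^sup>2)"]
    trunc_inverse_le[of n "sqrt ((x$2)\<^sup>2 + (x$3)\<^sup>2)"] zero_le_power[of "2::real" n] by linarith

lemma trunc_potential_mono: "m \<le> n \<Longrightarrow> trunc_potential m x \<le> trunc_potential n x"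
  unfolding trunc_potential_def by (intro add_mono mult_left_mono divide_right_mono trunc_inverse_mono) auto

lemma continuous_on_trunc_potential [continuous_intros]:
  "continuous_on S f \<Longrightarrow> continuous_on S (\<lambda>x. trunc_potential n (f x))"
  unfolding trunc_potential_def by (intro continuous_intros) auto

definition dyadic_action :: "nat \<Rightarrow> (real \<Rightarrow> real ^ 3) \<Rightarrow> real" where
  "dyadic_action n q = dyadic_energy n q / 4 + integral {0..1} (\<lambda>t. trunc_potential n (q t))"

lemma trunc_potential_integrable:
  "continuous_on {a..b} q \<Longrightarrow> (\<lambda>t. trunc_potential n (q t)) integrable_on {a..b::real}"
  by (intro integrable_continuous_real continuous_intros)

lemma dyadic_action_mono:
  assumes "continuous_on {0..1} q" "m \<le> n"
  shows "dyadic_action m q \<le> dyadic_action n q"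
  unfolding dyadic_action_def
  using dyadic_energy_mono[OF assms(2), of q]
    integral_le[OF trunc_potential_integrable[OF assms(1), of m] trunc_potential_integrable[OF assms(1), of n]]
    trunc_potential_mono[OF assms(2)]
  by fastforce

lemma dyadic_energy_le_dyadic_action:
  assumes "continuous_on {0..1} q"
  shows "dyadic_energy n q \<le> 4 * dyadic_action n q"
  using integral_nonneg[OF trunc_potential_integrable[OF assms, of n]] trunc_potential_pos[of n]
  unfolding dyadic_action_def by (fastforce simp: less_imp_le)

lemma trunc_potential_integral_le_dyadic_action: "integral {0..1} (\<lambda>t. trunc_potential n (q t)) \<le> dyadic_action n q"
  using dyadic_energy_nonneg[of n q] by (simp add: dyadic_action_def)

text \<open>At a fixed level the energy involves only finitely many values of the arc, and the
  truncated potential is continuous and bounded. Continuity at each level makes the supremum over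
  the levels lower semicontinuous.\<close>

lemma dyadic_action_tendsto:
  assumes qk: "\<And>k::nat. continuous_on {0..1} (Q k)" "continuous_on {0..1} q"
    and lim: "\<And>t. t \<in> {0..1} \<Longrightarrow> (\<lambda>k. Q k t) \<longlonglongrightarrow> q t"
  shows "(\<lambda>k. dyadic_action n (Q k)) \<longlonglongrightarrow> dyadic_action n q"
proof -
  have "(\<lambda>k. dyadic_energy n (Q k)) \<longlonglongrightarrow> dyadic_energy n q"
    unfolding dyadic_energy_def
  proof (intro tendsto_intros lim)
    fix k assume "k \<in> {..<(2::nat) ^ n}"
    then have "real (Suc k) \<le> real (2 ^ n)" by (intro of_nat_mono) auto
    then have "real (Suc k) \<le> 2 ^ n" "real k \<le> 2 ^ n"
      unfolding of_nat_power of_nat_numeral of_nat_Suc by linarith+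
    then show "real (Suc k) / 2 ^ n \<in> {0..1}" "real k / 2 ^ n \<in> {0..1}"
      by (auto simp: field_simps)
  qed
  moreover have "(\<lambda>k. integral {0..1} (\<lambda>t. trunc_potential n (Q k t))) \<longlonglongrightarrow> integral {0..1} (\<lambda>t. trunc_potential n (q t))"
  proof (rule dominated_convergence(2))
    show "(\<lambda>t. trunc_potential n (Q k t)) integrable_on {0..1}" for k
      by (rule trunc_potential_integrable[OF qk(1)])
    show "(\<lambda>t::real. 14 * 2 ^ n :: real) integrable_on {0..1}"
      by (intro integrable_continuous_real continuous_intros)
    show "norm (trunc_potential n (Q k t)) \<le> 14 * 2 ^ n" for k t
      using trunc_potential_pos[of n "Q k t"] trunc_potential_le[of n "Q k t"] by simp
    show "(\<lambda>k. trunc_potential n (Q k t)) \<longlonglongrightarrow> trunc_potential n (q t)" if "t \<in> {0..1}" for t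
    proof -
      have "continuous_on UNIV (\<lambda>x. trunc_potential n x)" by (intro continuous_intros)
      then show ?thesis
        using lim[OF that] by (auto intro: continuous_on_tendsto_compose)
    qed
  qed
  ultimately show ?thesis
    unfolding dyadic_action_def by (intro tendsto_intros) auto
qed

text \<open>All conditions are closed under pointwise limits, which is why coordinates are only
  required to be nonnegative. Positivity is recovered afterwards from minimality.\<close>

definition admissible :: "(real \<Rightarrow> real ^ 3) \<Rightarrow> bool" where
  "admissible q \<longleftrightarrow> continuous_on {0..1} q \<and> (\<forall>t\<in>{0..1}. \<forall>i. 0 \<le> q t $ i) \<and>
     q 0 $ 1 = 0 \<and> q 0 $ 2 = q 0 $ 3 \<and> q 1 $ 1 = q 1 $ 2"

text \<open>Coercivity: a coordinate moves by at most \<open>sqrt (4 * C)\<close>. Starting from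
  \<open>q 0 $ 1 = 0\<close>, this bounds the first coordinate, the second through
  \<open>q 1 $ 1 = q 1 $ 2\<close>, and the third through \<open>q 0 $ 2 = q 0 $ 3\<close>. The
  factor 9 is generous.\<close>

lemma admissible_norm_bound:
  assumes "admissible q" and C: "\<And>n. dyadic_action n q \<le> C" and t: "t \<in> {0..1}"
  shows "norm (q t) \<le> 9 * sqrt (4 * C)"
proof -
  let ?R = "sqrt (4 * C)"
  have cont: "continuous_on {0..1} q" using assms(1) by (simp add: admissible_def)
  have k: "dyadic_energy n q \<le> 4 * C" for n
    using dyadic_energy_le_dyadic_action[OF cont, of n] C[of n] by linarith
  then have C0: "0 \<le> C" using dyadic_energy_nonneg[of 0 q] k[of 0] by linarith
  have d: "\<bar>q t $ i - q s $ i\<bar> \<le> ?R" if "s \<in> {0..1}" "t \<in> {0..1}" for s t i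
  proof -
    have "(norm (q t - q s))\<^sup>2 \<le> 4 * C * \<bar>t - s\<bar>"
      by (rule dyadic_energy_hoelder[OF cont k]) (use that in auto)
    also have "\<dots> \<le> 4 * C * 1"
      by (rule mult_left_mono) (use that C0 in auto)
    finally have "norm (q t - q s) \<le> ?R"
      by (simp add: real_le_rsqrt)
    then show ?thesis
      using component_le_norm_cart[of "q t - q s" i] by simp
  qed
  have "norm (q t) \<le> (\<Sum>i\<in>UNIV. \<bar>q t $ i\<bar>)"
    by (rule norm_le_l1_cart)
  also have "\<dots> = \<bar>q t $ 1\<bar> + \<bar>q t $ 2\<bar> + \<bar>q t $ 3\<bar>"
    by (simp add: sum_3)
  finally show ?thesis
    using assms(1) d[of 0 1 1] d[of 0 1 2] d[of 0 t 1] d[of 0 t 2] d[of 0 t 3] t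
      d[of 1 t 2]
    unfolding admissible_def by auto
qed

lemma admissible_limit:
  assumes qk: "\<And>k::nat. admissible (Q k)" "continuous_on {0..1} q"
    and lim: "\<And>t. t \<in> {0..1} \<Longrightarrow> (\<lambda>k. Q k t) \<longlonglongrightarrow> q t"
  shows "admissible q"
proof -
  have c: "(\<lambda>k. Q k t $ i) \<longlonglongrightarrow> q t $ i" if "t \<in> {0..1}" for t i
    by (intro tendsto_intros lim that)
  have "0 \<le> q t $ i" if "t \<in> {0..1}" for t i
    by (rule LIMSEQ_le_const[OF c[OF that]]) (use qk(1) that in \<open>auto simp: admissible_def\<close>)
  moreover have "q 0 $ 1 = 0"
    using LIMSEQ_unique[OF c[of 0 1], of 0] qk(1) by (simp add: admissible_def)
  moreover have "q 0 $ 2 = q 0 $ 3"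
    using LIMSEQ_unique[OF c[of 0 2]] c[of 0 3] qk(1) by (simp add: admissible_def)
  moreover have "q 1 $ 1 = q 1 $ 2"
    using LIMSEQ_unique[OF c[of 1 1]] c[of 1 2] qk(1) by (simp add: admissible_def)
  ultimately show ?thesis using qk(2) by (simp add: admissible_def)
qed

lemma admissible_subsequence:
  assumes Q: "\<And>k::nat. admissible (Q k)" and C: "\<And>n k. dyadic_action n (Q k) \<le> C"
  obtains q \<phi> where "admissible q" "strict_mono \<phi>" "\<And>n. (\<lambda>k. dyadic_action n (Q (\<phi> k))) \<longlonglongrightarrow> dyadic_action n q"
proof -
  have cont: "continuous_on {0..1} (Q k)" for k using Q by (simp add: admissible_def)
  have k: "dyadic_energy n (Q k) \<le> 4 * C" for n k
    using dyadic_energy_le_dyadic_action[OF cont, of n] C[of n k] by (meson mult_left_mono order.trans zero_le_numeral)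
  then have C0: "0 \<le> C" using dyadic_energy_nonneg[of 0 "Q 0"] k[of 0 0] by linarith
  have ec: "\<exists>d>0. \<forall>n y. y \<in> {0..1} \<and> norm (x - y) < d \<longrightarrow> norm (Q n x - Q n y) < e"
    if x: "x \<in> {0..1}" and e: "0 < e" for x e :: real
  proof (intro exI conjI allI impI)
    \<comment> \<open>The added 1 keeps the denominator positive when \<open>C = 0\<close>.\<close>
    let ?d = "e\<^sup>2 / (4 * C + 1)"
    show "?d > 0" using C0 e by simp
    fix n y assume y: "y \<in> {0..1} \<and> norm (x - y) < ?d"
    have "(norm (Q n x - Q n y))\<^sup>2 \<le> 4 * C * \<bar>x - y\<bar>"
      by (rule dyadic_energy_hoelder[OF cont k]) (use x y in auto)
    also have "\<dots> \<le> (4 * C + 1) * \<bar>x - y\<bar>" by (simp add: algebra_simps)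
    also have "\<dots> < (4 * C + 1) * ?d"
      by (rule mult_strict_left_mono) (use y C0 in auto)
    also have "\<dots> = e\<^sup>2" using C0 by simp
    finally show "norm (Q n x - Q n y) < e"
      using e by (simp add: power2_less_imp_less)
  qed
  have "\<exists>q \<phi>. continuous_on {0..1} q \<and> strict_mono (\<phi> :: nat \<Rightarrow> nat) \<and>
    (\<forall>e>0. \<exists>N. \<forall>n x. n \<ge> N \<and> x \<in> {0..1} \<longrightarrow> norm (Q (\<phi> n) x - q x) < e)"
  proof (rule Arzela_Ascoli[of "{0..1::real}" Q "9 * sqrt (4 * C)"])
    show "norm (Q n x) \<le> 9 * sqrt (4 * C)" if "x \<in> {0..1}" for n x
      by (rule admissible_norm_bound[OF Q C that])
  next
    fix g k
    assume "continuous_on {0..1} g" "strict_mono (k :: nat \<Rightarrow> nat)"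
      "\<And>e. 0 < e \<Longrightarrow> \<exists>N. \<forall>n x. n \<ge> N \<and> x \<in> {0..1} \<longrightarrow> norm (Q (k n) x - g x) < e"
    then show "\<exists>q \<phi>. continuous_on {0..1} q \<and> strict_mono (\<phi> :: nat \<Rightarrow> nat) \<and>
      (\<forall>e>0. \<exists>N. \<forall>n x. n \<ge> N \<and> x \<in> {0..1} \<longrightarrow> norm (Q (\<phi> n) x - q x) < e)"
      by blast
  qed (use ec in blast)+
  then obtain q \<phi> where q: "continuous_on {0..1} q" "strict_mono (\<phi> :: nat \<Rightarrow> nat)"
    "\<And>e. 0 < e \<Longrightarrow> \<exists>N. \<forall>n x. n \<ge> N \<and> x \<in> {0..1} \<longrightarrow> norm (Q (\<phi> n) x - q x) < e"
    by blast
  have lim: "(\<lambda>k. Q (\<phi> k) t) \<longlonglongrightarrow> q t" if "t \<in> {0..1}" for t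
    using q(3) that by (fastforce simp: LIMSEQ_iff)
  show thesis
    by (rule that[OF admissible_limit[OF Q q(1) lim] q(2) dyadic_action_tendsto[OF cont q(1) lim]])
qed

text \<open>Cauchy-Schwarz for the motion \<open>t powr (2/3)\<close>, whose squared velocity
  \<open>4/9 * t powr (-2/3)\<close> has the antiderivative \<open>4/3 * t powr (1/3)\<close>. With
  \<open>x\<close> and \<open>y\<close> the cube roots of \<open>t\<close> and \<open>s\<close> it
  reduces to \<open>(x - y)^2 \<ge> 0\<close>.\<close>

lemma cbrt_increment:
  fixes s t :: real
  assumes "0 \<le> s" "s < t"
  shows "((t powr (2/3)) - (s powr (2/3)))\<^sup>2 / (t - s) \<le> 4/3 * (t powr (1/3) - s powr (1/3))"
proof -
  define x y where "x = t powr (1/3)" and "y = s powr (1/3)"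
  have xy: "0 \<le> y" "y < x"
    using assms by (auto simp: x_def y_def intro!: powr_less_mono2)
  have p: "t = x ^ 3" "s = y ^ 3" "t powr (2/3) = x\<^sup>2" "s powr (2/3) = y\<^sup>2"
  proof -
    have "u = (u powr (1/3)) ^ 3 \<and> u powr (2/3) = (u powr (1/3))\<^sup>2" if "0 \<le> u" for u :: real
      using that by (cases "u = 0") (auto simp: powr_power)
    then show "t = x ^ 3" "s = y ^ 3" "t powr (2/3) = x\<^sup>2" "s powr (2/3) = y\<^sup>2"
      using assms by (auto simp: x_def y_def)
  qed
  define D where "D = x\<^sup>2 + x * y + y\<^sup>2"
  have D: "D > 0"
    unfolding D_def using xy by (intro add_pos_nonneg) auto
  have e1: "x ^ 3 - y ^ 3 = (x - y) * D"
    by (simp add: D_def power2_eq_square power3_eq_cube algebra_simps)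
  have e2: "(x\<^sup>2 - y\<^sup>2)\<^sup>2 = (x - y) * ((x - y) * (x + y)\<^sup>2)"
    by (simp add: power2_eq_square algebra_simps)
  have "(x + y)\<^sup>2 \<le> 4/3 * D"
  proof -
    have "4/3 * D - (x + y)\<^sup>2 = (x - y)\<^sup>2 / 3"
      by (simp add: D_def power2_eq_square field_simps)
    moreover have "0 \<le> (x - y)\<^sup>2 / 3" by simp
    ultimately show ?thesis by linarith
  qed
  then have "(x - y) * (x + y)\<^sup>2 \<le> (x - y) * (4/3 * D)"
    using xy by (intro mult_left_mono) auto
  then have "(x - y) * (x + y)\<^sup>2 / D \<le> 4/3 * (x - y)"
    using D by (simp add: divide_le_eq mult_ac)
  then have "(x\<^sup>2 - y\<^sup>2)\<^sup>2 / (x ^ 3 - y ^ 3) \<le> 4/3 * (x - y)"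
    unfolding e1 e2 using xy by simp
  then show ?thesis
    using p x_def y_def by metis
qed

text \<open>The competitor leaves the collision at the Kepler rate \<open>t powr (2/3)\<close> and
  keeps the other two coordinates at 1. A quarter of its energy is at most 1/3; in the potential, 13
  bounds the three pair terms and the two constant ones, and 3/2 is the integral of
  \<open>1/2 * t powr (-2/3)\<close>. The total is rounded up to 17.\<close>

lemma finite_action_path:
  obtains q where "admissible q" "\<And>n. dyadic_action n q \<le> 17"
proof
  define q :: "real \<Rightarrow> real ^ 3" where "q = (\<lambda>t. \<chi> i. if i = 1 then t powr (2/3) else 1)"
  have q: "q t $ 1 = t powr (2/3)" "q t $ 2 = 1" "q t $ 3 = 1" for t
    by (simp_all add: q_def)
  have "continuous_on {0..1} (\<lambda>t::real. if i = 1 then t powr (2/3) else 1)" for i :: 3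
  proof (cases "i = 1")
    case True
    have "continuous_on {0..1} (\<lambda>t::real. t powr (2/3))"
      by (rule continuous_on_powr') (auto intro: continuous_intros)
    then show ?thesis using True by simp
  qed auto
  then have cont: "continuous_on {0..1} q"
    unfolding q_def by (intro continuous_on_vec_lambda)
  show "admissible q"
    using cont by (auto simp: admissible_def q forall_3)
  fix n
  have "dyadic_energy n q \<le> 4/3"
  proof -
    let ?x = "\<lambda>k. real k / 2 ^ n"
    have "(norm (q (?x (Suc k)) - q (?x k)))\<^sup>2 \<le> 1/2^n * (4/3 * (?x (Suc k) powr (1/3) - ?x k powr (1/3)))" for k
    proof -
      have "(norm (q (?x (Suc k)) - q (?x k)))\<^sup>2 = (?x (Suc k) powr (2/3) - ?x k powr (2/3))\<^sup>2"
        by (simp add: norm_vec_def L2_set_def sum_3 q)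
      moreover have d: "?x (Suc k) - ?x k = 1 / 2 ^ n"
        by (simp add: field_simps)
      moreover have "?x k < ?x (Suc k)"
        by (simp add: divide_strict_right_mono)
      ultimately show ?thesis
        using cbrt_increment[of "?x k" "?x (Suc k)"] unfolding d
        by (simp add: field_simps del: of_nat_Suc)
    qed
    then have "dyadic_energy n q \<le> 2 ^ n * (\<Sum>k<2^n. 1/2^n * (4/3 * (?x (Suc k) powr (1/3) - ?x k powr (1/3))))"
      unfolding dyadic_energy_def by (intro mult_left_mono sum_mono) auto
    also have "\<dots> = 4/3 * (\<Sum>k<2^n. ?x (Suc k) powr (1/3) - ?x k powr (1/3))"
      unfolding sum_distrib_left[symmetric] by simp
    also have "(\<Sum>k<2^n. ?x (Suc k) powr (1/3) - ?x k powr (1/3)) = ?x (2^n) powr (1/3) - ?x 0 powr (1/3)"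
      by (rule sum_lessThan_telescope)
    finally show ?thesis by simp
  qed
  moreover have "integral {0..1} (\<lambda>t. trunc_potential n (q t)) \<le> 13 + 3/2"
  proof -
    \<comment> \<open>By convention \<open>0 powr (-2/3)\<close> is 0, so the majorant needs a
      separate value at the collision; a single point does not affect the integral.\<close>
    define h :: "real \<Rightarrow> real" where "h = (\<lambda>t. if t = 0 then 14 * 2 ^ n else 13 + 1/2 * t powr (-2/3))"
    have "((\<lambda>t::real. 13 + 1/2 * t powr (-2/3)) has_integral (13 * (1 - 0) + 1/2 * (1 powr (-2/3+1) / (-2/3+1)))) {0..1}"
      using has_integral_const_real[of "13::real" 0 1]
      by (intro has_integral_add has_integral_mult_right has_integral_powr_from_0) auto
    then have "(h has_integral (13 * (1 - 0) + 1/2 * (1 powr (-2/3+1) / (-2/3+1)))) {0..1}"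
      by (rule has_integral_spike_finite[rotated -1, of _ _ _ "{0}"]) (auto simp: h_def)
    then have h: "(h has_integral (13 + 3/2)) {0..1}" by simp
    have "trunc_potential n (q t) \<le> h t" if t: "t \<in> {0..1}" for t
    proof (cases "t = 0")
      case True
      then show ?thesis using trunc_potential_le by (simp add: h_def)
    next
      case False
      have le1: "trunc_inverse n r \<le> 1" if "1 \<le> r" for r
        using trunc_inverse_le_inverse[of r n] that by (smt (verit) divide_le_eq_1)
      have "trunc_inverse n (t powr (2/3)) \<le> 1 / t powr (2/3)"
        using False by (intro trunc_inverse_le_inverse) auto
      then have "trunc_inverse n (t powr (2/3)) \<le> t powr (-2/3)"
        by (simp add: powr_minus inverse_eq_divide)
      moreover have "trunc_inverse n (sqrt ((t powr (2/3))\<^sup>2 + 1\<^sup>2)) \<le> 1" "trunc_inverse n (sqrt (1\<^sup>2 + 1\<^sup>2)) \<le> 1" "trunc_inverse n 1 \<le> 1"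
        by (auto intro: le1)
      ultimately show ?thesis
        using False by (simp only: trunc_potential_def q h_def if_False)
    qed
    then show ?thesis
      using has_integral_le[OF integrable_integral[OF trunc_potential_integrable[OF cont]] h] by blast
  qed
  ultimately show "dyadic_action n q \<le> 17"
    unfolding dyadic_action_def by linarith
qed

text \<open>
  The action of \<open>q\<close> is the supremum of \<open>dyadic_action n q\<close> over \<open>n\<close>, possibly infinite; only its upper bounds are used.
\<close>
lemma minimizer_exists:
  obtains q m where "admissible q" "\<And>n. dyadic_action n q \<le> m"
    "\<And>r c. admissible r \<Longrightarrow> (\<And>n. dyadic_action n r \<le> c) \<Longrightarrow> m \<le> c"
proof -
  define B where "B = {c. \<exists>q. admissible q \<and> (\<forall>n. dyadic_action n q \<le> c)}"
  obtain q0 where "admissible q0" "\<And>n. dyadic_action n q0 \<le> 17" using finite_action_path by blast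
  then have "17 \<in> B" by (auto simp: B_def)
  have bdd: "bdd_below B"
  proof (rule bdd_belowI)
    fix c assume "c \<in> B"
    then obtain q where q: "admissible q" "\<And>n. dyadic_action n q \<le> c" by (auto simp: B_def)
    then have "0 \<le> 4 * dyadic_action 0 q"
      using dyadic_energy_le_dyadic_action[of q 0] dyadic_energy_nonneg[of 0 q] by (force simp: admissible_def)
    then show "0 \<le> c" using q(2)[of 0] by linarith
  qed
  define m where "m = Inf B"
  have "\<exists>q. admissible q \<and> (\<forall>n. dyadic_action n q \<le> m + 1 / real (Suc k))" for k
  proof -
    have "Inf B < m + 1 / real (Suc k)" by (simp add: m_def)
    then obtain c where "c \<in> B" "c < m + 1 / real (Suc k)"
      using cInf_less_iff[OF _ bdd] \<open>17 \<in> B\<close> by blast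
    then obtain q where "admissible q" "\<And>n. dyadic_action n q \<le> c" by (auto simp: B_def)
    then show ?thesis using \<open>c < m + 1 / real (Suc k)\<close> by (meson less_imp_le order.trans)
  qed
  then obtain Q where Q: "\<And>k. admissible (Q k)" "\<And>k n. dyadic_action n (Q k) \<le> m + 1 / real (Suc k)"
    by metis
  have "dyadic_action n (Q k) \<le> m + 1" for n k
  proof -
    have "1 / real (Suc k) \<le> 1" by simp
    then show ?thesis using Q(2)[of n k] by linarith
  qed
  then obtain q \<phi> where q: "admissible q" "strict_mono \<phi>" "\<And>n. (\<lambda>k. dyadic_action n (Q (\<phi> k))) \<longlonglongrightarrow> dyadic_action n q"
    using admissible_subsequence[of Q "m + 1"] Q(1) by metis
  \<comment> \<open>Lower semicontinuity: the bounds pass to the limit one level \<open>n\<close> at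
    a time.\<close>
  have "dyadic_action n q \<le> m" for n
  proof (rule LIMSEQ_le[OF q(3)])
    have "(\<lambda>k. m + 1 / real (Suc k)) \<longlonglongrightarrow> m + 0"
      using LIMSEQ_inverse_real_of_nat by (intro tendsto_intros) (simp add: inverse_eq_divide)
    then show "(\<lambda>k. m + 1 / real (Suc (\<phi> k))) \<longlonglongrightarrow> m"
      using LIMSEQ_subseq_LIMSEQ[OF _ q(2)] by (fastforce simp: o_def)
  qed (use Q(2) in auto)
  moreover have "m \<le> c" if "admissible r" "\<And>n. dyadic_action n r \<le> c" for r c
    unfolding m_def by (rule cInf_lower[OF _ bdd]) (use that in \<open>auto simp: B_def\<close>)
  ultimately show thesis using that q(1) by blast
qed

section \<open>Positivity of minimisers\<close>

lemma trunc_inverse_0: "trunc_inverse n 0 = 2 ^ n"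
  by (simp add: trunc_inverse_def)

text \<open>All six terms decrease in each coordinate. Keeping the gain of the single term that
  depends on \<open>x $ i\<close> alone yields a drop that can be bounded below uniformly in
  \<open>n\<close>.\<close>

lemma trunc_potential_antimono_strict:
  assumes "\<And>j. 0 \<le> x $ j" "\<And>j. x $ j \<le> y $ j"
  shows "trunc_potential n y + (trunc_inverse n (x $ i) / 2 - trunc_inverse n (y $ i) / 2) \<le> trunc_potential n x"
proof -
  have p: "trunc_inverse n (sqrt ((y$j)\<^sup>2 + (y$k)\<^sup>2)) \<le> trunc_inverse n (sqrt ((x$j)\<^sup>2 + (x$k)\<^sup>2))" for j k
    using assms by (intro trunc_inverse_antimono real_sqrt_le_mono add_mono power_mono) auto
  have s: "trunc_inverse n (y$j) \<le> trunc_inverse n (x$j)" for j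
    using assms by (intro trunc_inverse_antimono)
  consider "i = 1" | "i = 2" | "i = 3" using exhaust_3[of i] by auto
  then show ?thesis
    unfolding trunc_potential_def
    using p[of 1 2] p[of 1 3] p[of 2 3] s[of 1] s[of 2] s[of 3] by cases auto
qed

lemma integral_indicator_Icc:
  assumes "0 \<le> c" "c \<le> d" "d \<le> (1::real)"
  shows "(\<lambda>t. if t \<in> {c..d} then \<kappa> else 0) integrable_on {0..1}"
    "integral {0..1} (\<lambda>t. if t \<in> {c..d} then \<kappa> else (0::real)) = (d - c) * \<kappa>"
proof -
  have e: "{c..d} \<inter> {0..1} = {c..d}" using assms by auto
  show "(\<lambda>t. if t \<in> {c..d} then \<kappa> else 0) integrable_on {0..1}"
    unfolding integrable_restrict_Int e by (rule integrable_const_ivl)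
  show "integral {0..1} (\<lambda>t. if t \<in> {c..d} then \<kappa> else (0::real)) = (d - c) * \<kappa>"
    unfolding Henstock_Kurzweil_Integration.integral_restrict_Int e using assms by simp
qed

lemma Icc_neighbourhood:
  fixes t0 d :: real
  assumes "t0 \<in> {0..1}" "d > 0"
  obtains c e where "0 \<le> c" "c < e" "e \<le> 1" "\<And>t. t \<in> {c..e} \<Longrightarrow> \<bar>t - t0\<bar> < d"
proof
  show "0 \<le> max 0 (t0 - d/2)" "max 0 (t0 - d/2) < min 1 (t0 + d/2)" "min 1 (t0 + d/2) \<le> 1"
    using assms by auto
  show "\<bar>t - t0\<bar> < d" if "t \<in> {max 0 (t0 - d/2)..min 1 (t0 + d/2)}" for t
    using that assms by auto
qed

section \<open>Clipping coordinates from below\<close>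

definition clip :: "3 set \<Rightarrow> real \<Rightarrow> real \<Rightarrow> real \<Rightarrow> (real \<Rightarrow> real ^ 3) \<Rightarrow> real \<Rightarrow> real ^ 3" where
  "clip I h a b q t = (\<chi> i. if i \<in> I \<and> t \<in> {a..b} then max (q t $ i) h else q t $ i)"

lemma clip_nth:
  "clip I h a b q t $ i = (if i \<in> I \<and> t \<in> {a..b} then max (q t $ i) h else q t $ i)"
  by (simp add: clip_def)

lemma continuous_on_clip:
  assumes q: "continuous_on {0..1} q" and ab: "0 \<le> a" "a < b" "b \<le> 1"
    and a: "a = 0 \<or> (\<forall>i\<in>I. h \<le> q a $ i)" and b: "b = 1 \<or> (\<forall>i\<in>I. h \<le> q b $ i)"
  shows "continuous_on {0..1} (clip I h a b q)"
  unfolding clip_def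
proof (intro continuous_on_vec_lambda)
  fix i
  let ?r = "\<lambda>t. if i \<in> I \<and> t \<in> {a..b} then max (q t $ i) h else q t $ i"
  have qi: "continuous_on S (\<lambda>t. q t $ i)" if "S \<subseteq> {0..1}" for S
    by (intro continuous_intros continuous_on_subset[OF q that])
  show "continuous_on {0..1} ?r"
  proof (cases "i \<in> I")
    case True
    have "continuous_on {0..a} ?r"
    proof (cases "a = 0")
      case False
      show ?thesis
        by (rule continuous_on_eq[OF qi]) (use False a ab True in \<open>auto simp: max_def\<close>)
    qed simp
    moreover have "continuous_on {b..1} ?r"
    proof (cases "b = 1")
      case False
      show ?thesis
        by (rule continuous_on_eq[OF qi]) (use False b ab True in \<open>auto simp: max_def\<close>)
    qed simp
    moreover have "continuous_on {a..b} ?r"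
      by (rule continuous_on_eq[OF continuous_on_max[OF qi continuous_on_const]])
         (use ab True in auto)
    ultimately have "continuous_on (({0..a} \<union> {a..b}) \<union> {b..1}) ?r"
      by (intro continuous_on_closed_Un) auto
    moreover have "({0..a} \<union> {a..b}) \<union> {b..1} = {0..1}"
      using ab by auto
    ultimately show ?thesis by simp
  qed (use qi in auto)
qed

text \<open>Since \<open>a\<close> and \<open>b\<close> are grid points at level \<open>M\<close>,
  no cell of level \<open>n\<close> straddles them. On each cell every component is either unchanged
  or composed with the 1-Lipschitz map \<open>max _ h\<close>, so no increment grows.\<close>

lemma dyadic_energy_clip:
  assumes ja: "a = real ja / 2 ^ M" and jb: "b = real jb / 2 ^ M" and n: "M \<le> n"
    and a: "a = 0 \<or> (\<forall>i\<in>I. h \<le> q a $ i)" and b: "b = 1 \<or> (\<forall>i\<in>I. h \<le> q b $ i)"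
  shows "dyadic_energy n (clip I h a b q) \<le> dyadic_energy n q"
  unfolding dyadic_energy_def
proof (intro mult_left_mono sum_mono power_mono norm_le_componentwise_cart)
  fix k i assume k: "k \<in> {..<(2::nat) ^ n}"
  let ?s = "real k / 2 ^ n" and ?t = "real (Suc k) / 2 ^ n"
  have sc: "(2::real) ^ n = 2 ^ M * 2 ^ (n - M)"
    using n by (simp flip: power_add)
  have a': "a = real (ja * 2 ^ (n - M)) / 2 ^ n" and b': "b = real (jb * 2 ^ (n - M)) / 2 ^ n"
    unfolding ja jb sc by simp_all
  consider "k < ja * 2 ^ (n - M)" | "jb * 2 ^ (n - M) \<le> k" | "ja * 2 ^ (n - M) \<le> k" "k < jb * 2 ^ (n - M)"
    by linarith
  then have c: "?t \<le> a \<or> b \<le> ?s \<or> (a \<le> ?s \<and> ?t \<le> b)"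
    unfolding a' b' by cases (auto simp: divide_le_cancel simp flip: of_nat_Suc of_nat_mult of_nat_power simp del: of_nat_Suc of_nat_mult of_nat_power)
  have st: "0 \<le> ?s" "?s < ?t" "?t \<le> 1"
  proof -
    have "real (Suc k) \<le> real (2 ^ n)" using k by (intro of_nat_mono) auto
    then show "?t \<le> 1" by (simp add: field_simps)
  qed (simp_all add: divide_strict_right_mono)
  show "norm ((clip I h a b q ?t - clip I h a b q ?s) $ i) \<le> norm ((q ?t - q ?s) $ i)"
  proof (cases "i \<in> I")
    case True
    from c consider "?t \<le> a" | "b \<le> ?s" | "a \<le> ?s" "?t \<le> b" by blast
    then show ?thesis
    proof cases
      case 1
      then have "clip I h a b q ?t $ i = q ?t $ i" "clip I h a b q ?s $ i = q ?s $ i"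
        using st a True by (auto simp: clip_nth max_def dest: order.antisym)
      then show ?thesis by simp
    next
      case 2
      then have "clip I h a b q ?t $ i = q ?t $ i" "clip I h a b q ?s $ i = q ?s $ i"
        using st b True by (auto simp: clip_nth max_def dest: order.antisym)
      then show ?thesis by simp
    next
      case 3
      then show ?thesis
        using st True by (auto simp: clip_nth)
    qed
  qed (simp add: clip_nth)
qed auto

locale minimizer =
  fixes q :: "real \<Rightarrow> real ^ 3" and \<mu> :: real
  assumes admissible_q: "admissible q" and dyadic_action_le: "dyadic_action n q \<le> \<mu>"
    and minimal: "admissible r \<Longrightarrow> (\<And>n. dyadic_action n r \<le> c) \<Longrightarrow> \<mu> \<le> c"
begin

lemma cont_q: "continuous_on {0..1} q"
  and q_nonneg: "t \<in> {0..1} \<Longrightarrow> 0 \<le> q t $ i"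
  and q_bc: "q 0 $ 1 = 0" "q 0 $ 2 = q 0 $ 3" "q 1 $ 1 = q 1 $ 2"
  using admissible_q by (auto simp: admissible_def)

lemma cont_q_nth: "S \<subseteq> {0..1} \<Longrightarrow> continuous_on S (\<lambda>t. q t $ i)"
  by (intro continuous_intros continuous_on_subset[OF cont_q])

text \<open>A gain at all fine levels suffices: actions increase with the level, so the coarse ones
  are bounded by the fine ones.\<close>

lemma no_improvement:
  assumes r: "admissible r" and "\<delta> > 0" and le: "\<And>n. n \<ge> K \<Longrightarrow> dyadic_action n r \<le> dyadic_action n q - \<delta>"
  shows False
proof -
  have "dyadic_action n r \<le> \<mu> - \<delta>" for n
  proof -
    have "dyadic_action n r \<le> dyadic_action (max n K) r"
      using r by (intro dyadic_action_mono) (auto simp: admissible_def)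
    also have "\<dots> \<le> \<mu> - \<delta>"
      using le[of "max n K"] dyadic_action_le[of "max n K"] by simp
    finally show ?thesis .
  qed
  from minimal[OF r this] show False using \<open>\<delta> > 0\<close> by simp
qed

text \<open>If \<open>r\<close> exceeded \<open>q\<close> somewhere, continuity would give an
  interval on which the potential drops by an amount independent of \<open>n\<close>, while the
  energy does not rise.\<close>

lemma no_raise:
  assumes r: "admissible r" and ge: "\<And>t i. t \<in> {0..1} \<Longrightarrow> q t $ i \<le> r t $ i"
    and dyadic_energy: "\<And>n. n \<ge> K \<Longrightarrow> dyadic_energy n r \<le> dyadic_energy n q"
    and t0: "t0 \<in> {0..1}"
  shows "r t0 $ i = q t0 $ i"
proof (rule ccontr)
  assume "r t0 $ i \<noteq> q t0 $ i"
  then have lt: "q t0 $ i < r t0 $ i" using ge[OF t0, of i] by simp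
  have cr: "continuous_on {0..1} r" using r by (simp add: admissible_def)
  \<comment> \<open>The values at one and two thirds of the gap. Here \<open>\<alpha> > 0\<close>
    even if \<open>q t0 $ i = 0\<close>, so truncation is inactive at \<open>\<alpha>\<close> for
    large \<open>n\<close> and the gain \<open>\<kappa>\<close> is the same at all those
    levels.\<close>
  define \<alpha> \<beta> where "\<alpha> = (2 * q t0 $ i + r t0 $ i) / 3" and "\<beta> = (q t0 $ i + 2 * r t0 $ i) / 3"
  have ab: "q t0 $ i < \<alpha>" "0 < \<alpha>" "\<alpha> < \<beta>" "\<beta> < r t0 $ i"
    using lt q_nonneg[OF t0, of i] by (auto simp: \<alpha>_def \<beta>_def)
  have "((\<lambda>t. q t $ i) \<longlongrightarrow> q t0 $ i) (at t0 within {0..1})" "((\<lambda>t. r t $ i) \<longlongrightarrow> r t0 $ i) (at t0 within {0..1})"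
    using cont_q cr t0 by (auto intro!: tendsto_vec_nth simp: continuous_on_def)
  then have "\<forall>\<^sub>F t in at t0 within {0..1}. q t $ i < \<alpha> \<and> \<beta> < r t $ i"
    using ab by (intro eventually_conj order_tendstoD) auto
  then obtain d where d: "d > 0" "\<And>t. t \<in> {0..1} \<Longrightarrow> \<bar>t - t0\<bar> < d \<Longrightarrow> q t $ i < \<alpha> \<and> \<beta> < r t $ i"
    using ab unfolding eventually_at dist_real_def by (metis)
  obtain c e where ce: "0 \<le> c" "c < e" "e \<le> 1" "\<And>t. t \<in> {c..e} \<Longrightarrow> \<bar>t - t0\<bar> < d"
    using Icc_neighbourhood[OF t0 d(1)] by blast
  define \<kappa> where "\<kappa> = (1 / \<alpha> - 1 / \<beta>) / 2"
  have \<kappa>: "\<kappa> > 0" using ab by (simp add: \<kappa>_def field_simps)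
  obtain N where N: "1 / 2 ^ N < \<alpha>"
    using ab real_arch_pow_inv[of \<alpha> "1/2"] by (auto simp: power_divide)
  show False
  proof (rule no_improvement[OF r, of "(e - c) * \<kappa>" "max N K"])
    show "(e - c) * \<kappa> > 0" using ce \<kappa> by simp
    fix n assume n: "max N K \<le> n"
    have "1 / 2 ^ n \<le> (1 / 2 ^ N :: real)"
      using n by (intro divide_left_mono power_increasing) auto
    then have an: "1 / 2 ^ n \<le> \<alpha>" using N by simp
    let ?f = "\<lambda>t. trunc_potential n (r t) + (if t \<in> {c..e} then \<kappa> else 0)"
    have f: "?f integrable_on {0..1}"
      "integral {0..1} ?f = integral {0..1} (\<lambda>t. trunc_potential n (r t)) + (e - c) * \<kappa>"
      using integral_indicator_Icc[of c e \<kappa>] ce trunc_potential_integrable[OF cr, of n]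
      by (auto intro!: integrable_add simp: integral_add)
    have "?f t \<le> trunc_potential n (q t)" if t: "t \<in> {0..1}" for t
    proof (cases "t \<in> {c..e}")
      case True
      then have qr: "q t $ i < \<alpha>" "\<beta> < r t $ i" using d(2)[OF t] ce(4) by auto
      have "1 / \<alpha> \<le> trunc_inverse n (q t $ i)"
        using trunc_inverse_antimono[of "q t $ i" \<alpha> n] qr trunc_inverse_eq[OF an] by simp
      moreover have "trunc_inverse n (r t $ i) \<le> 1 / \<beta>"
        using trunc_inverse_antimono[of \<beta> "r t $ i" n] qr trunc_inverse_eq[of n \<beta>] an ab by simp
      ultimately show ?thesis
        using trunc_potential_antimono_strict[of "q t" "r t" n i] ge[OF t] q_nonneg[OF t] True
        by (simp add: \<kappa>_def field_simps)
    next
      case False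
      show ?thesis
        using trunc_potential_antimono_strict[of "q t" "r t" n i] ge[OF t] q_nonneg[OF t] False
          trunc_inverse_antimono[OF ge[OF t], of n i] by (simp del: atLeastAtMost_iff)
    qed
    then have "integral {0..1} ?f \<le> integral {0..1} (\<lambda>t. trunc_potential n (q t))"
      by (intro integral_le f trunc_potential_integrable[OF cont_q])
    then show "dyadic_action n r \<le> dyadic_action n q - (e - c) * \<kappa>"
      using dyadic_energy[of n] n f(2) unfolding dyadic_action_def by simp
  qed
qed

text \<open>A minimum principle as for concave functions, obtained by clipping before any equation
  of motion is available. The conditions on \<open>I\<close> keep the clipped arc admissible:
  \<open>q 0 $ 1 = 0\<close> forbids raising the first coordinate at time 0, and the equalities at
  the ends force coordinates 2 and 3, respectively 1 and 2, to be raised together.\<close>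

lemma min_principle:
  assumes ja: "a = real ja / 2 ^ M" and jb: "b = real jb / 2 ^ M" and ab: "a < b" "b \<le> 1"
    and a: "a = 0 \<and> 1 \<notin> I \<and> (2 \<in> I \<longleftrightarrow> 3 \<in> I) \<or> 0 < a \<and> (\<forall>i\<in>I. h \<le> q a $ i)"
    and b: "b = 1 \<and> (1 \<in> I \<longleftrightarrow> 2 \<in> I) \<or> b < 1 \<and> (\<forall>i\<in>I. h \<le> q b $ i)"
    and i: "i \<in> I" and t: "t \<in> {a..b}"
  shows "h \<le> q t $ i"
proof -
  have a0: "0 \<le> a" using ja by simp
  have a1: "a = 0 \<or> (\<forall>i\<in>I. h \<le> q a $ i)" and b1: "b = 1 \<or> (\<forall>i\<in>I. h \<le> q b $ i)"
    using a b by auto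
  let ?r = "clip I h a b q"
  have "admissible ?r"
    unfolding admissible_def
  proof (intro conjI ballI allI)
    show "continuous_on {0..1} ?r" by (rule continuous_on_clip[OF cont_q a0 ab a1 b1])
    show "0 \<le> ?r t $ i" if "t \<in> {0..1}" for t i
      using q_nonneg[OF that, of i] by (auto simp: clip_nth)
    show "?r 0 $ 1 = 0" "?r 0 $ 2 = ?r 0 $ 3" using a q_bc by (auto simp: clip_nth)
    show "?r 1 $ 1 = ?r 1 $ 2" using b q_bc by (auto simp: clip_nth)
  qed
  then have "?r t $ i = q t $ i"
    by (rule no_raise[where K = M]) (use dyadic_energy_clip[OF ja jb _ a1 b1] ab a0 t in \<open>auto simp: clip_nth\<close>)
  then show ?thesis using i t by (auto simp: clip_nth)
qed

text \<open>While a coordinate vanishes, the truncated potential is at least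
  \<open>2 ^ n / 2\<close>; on an interval this would make the actions unbounded in
  \<open>n\<close>.\<close>

lemma pos_somewhere:
  assumes cd: "0 \<le> c" "c < d" "d \<le> 1"
  shows "\<exists>t\<in>{c..d}. 0 < q t $ i"
proof (rule ccontr)
  assume "\<not> ?thesis"
  then have z: "q t $ i = 0" if "t \<in> {c..d}" for t
    using q_nonneg[of t i] cd that by (force simp: not_less)
  have bound: "(d - c) * (2 ^ n / 2) \<le> \<mu>" for n
  proof -
    have "(if t \<in> {c..d} then 2 ^ n / 2 else 0) \<le> trunc_potential n (q t)" if "t \<in> {0..1}" for t
    proof (cases "t \<in> {c..d}")
      case True
      have tp: "trunc_inverse n r \<ge> 0" for r using trunc_inverse_pos[of n r] by simp
      consider "i = 1" | "i = 2" | "i = 3" using exhaust_3[of i] by auto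
      then have "trunc_inverse n (q t $ i) / 2 \<le> trunc_potential n (q t)"
        by cases (auto simp: trunc_potential_def tp intro!: add_nonneg_nonneg)
      then show ?thesis using True z[OF True] by (simp add: trunc_inverse_0)
    qed (use trunc_potential_pos[of n "q t"] in auto)
    then have "integral {0..1} (\<lambda>t. if t \<in> {c..d} then 2 ^ n / 2 else 0) \<le> integral {0..1} (\<lambda>t. trunc_potential n (q t))"
      using cd by (intro integral_le integral_indicator_Icc trunc_potential_integrable[OF cont_q]) auto
    then show ?thesis
      using integral_indicator_Icc(2)[of c d "2 ^ n / 2"] cd trunc_potential_integral_le_dyadic_action[of n q] dyadic_action_le[of n] by simp
  qed
  obtain n where "2 * \<mu> / (d - c) < 2 ^ n"
    using real_arch_pow[of 2] by auto
  then show False using cd bound[of n] by (simp add: field_simps)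
qed

text \<open>The conclusion holds at every fine level so that points on both sides of a given time
  can be taken from one common grid, as \<open>min_principle\<close> demands.\<close>

lemma pos_dyadic:
  assumes cd: "0 \<le> c" "c < d" "d \<le> 1"
  obtains M where "\<And>n. M \<le> n \<Longrightarrow> \<exists>j. c < real j / 2 ^ n \<and> real j / 2 ^ n < d \<and> 0 < q (real j / 2 ^ n) $ i"
proof -
  define c' d' where "c' = (2 * c + d) / 3" and "d' = (c + 2 * d) / 3"
  have cd': "0 \<le> c'" "c' < d'" "d' \<le> 1" "c < c'" "d' < d" using cd by (auto simp: c'_def d'_def)
  obtain t where t: "t \<in> {c'..d'}" "0 < q t $ i" using pos_somewhere[OF cd'(1-3)] by blast
  have t01: "0 \<le> t" "t \<le> 1" "c < t" "t < d" using t cd cd' by auto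
  have lim: "(\<lambda>n. real (dyfloor n t) / 2 ^ n) \<longlonglongrightarrow> t" by (rule dyfloor_tendsto[OF t01(1)])
  have "(\<lambda>n. q (real (dyfloor n t) / 2 ^ n)) \<longlonglongrightarrow> q t"
    using t01 lim dyfloor_le[of t]
    by (auto intro!: continuous_on_tendsto_compose[OF cont_q] always_eventually)
  then have "(\<lambda>n. q (real (dyfloor n t) / 2 ^ n) $ i) \<longlonglongrightarrow> q t $ i" by (rule tendsto_vec_nth)
  then have "\<forall>\<^sub>F n in sequentially. 0 < q (real (dyfloor n t) / 2 ^ n) $ i \<and> c < real (dyfloor n t) / 2 ^ n
      \<and> real (dyfloor n t) / 2 ^ n < d"
    using lim t t01 by (intro eventually_conj order_tendstoD) auto
  then show thesis
    using that unfolding eventually_sequentially by metis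
qed

lemma q_pos_interior:
  assumes t: "0 < t" "t < 1"
  shows "0 < q t $ i"
proof -
  obtain M1 where M1: "\<And>n. M1 \<le> n \<Longrightarrow> \<exists>j. 0 < real j / 2 ^ n \<and> real j / 2 ^ n < t \<and> 0 < q (real j / 2 ^ n) $ i"
    using pos_dyadic[of 0 t i] t by auto
  obtain M2 where M2: "\<And>n. M2 \<le> n \<Longrightarrow> \<exists>j. t < real j / 2 ^ n \<and> real j / 2 ^ n < 1 \<and> 0 < q (real j / 2 ^ n) $ i"
    using pos_dyadic[of t 1 i] t by auto
  let ?M = "max M1 M2"
  obtain j where j: "0 < real j / 2 ^ ?M" "real j / 2 ^ ?M < t" "0 < q (real j / 2 ^ ?M) $ i"
    using M1[of ?M] by auto
  obtain l where l: "t < real l / 2 ^ ?M" "real l / 2 ^ ?M < 1" "0 < q (real l / 2 ^ ?M) $ i"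
    using M2[of ?M] by auto
  have "min (q (real j / 2 ^ ?M) $ i) (q (real l / 2 ^ ?M) $ i) \<le> q t $ i"
    by (rule min_principle[of "real j / 2 ^ ?M" j ?M "real l / 2 ^ ?M" l, where I = "{i}"])
       (use j l t in auto)
  then show ?thesis using j l by linarith
qed

text \<open>At time 1 the third coordinate is free and is clipped alone. The first two are tied
  together, so both are clipped at the smaller of their values at time 1/2.\<close>

lemma q_pos_right: "0 < q 1 $ i"
proof -
  have h: "q (1/2) $ j > 0" for j by (rule q_pos_interior) auto
  have "q (1/2) $ 3 \<le> q 1 $ 3"
    by (rule min_principle[of "1/2" 1 1 1 2, where I = "{3}"]) auto
  moreover have "min (q (1/2) $ 1) (q (1/2) $ 2) \<le> q 1 $ j" if "j \<in> {1,2}" for j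
    by (rule min_principle[of "1/2" 1 1 1 2, where I = "{1,2}"]) (use that in auto)
  ultimately show ?thesis
    using h[of 1] h[of 2] h[of 3] exhaust_3[of i] by (force simp: min_def split: if_splits)
qed

lemma q_pos_left:
  assumes "i \<noteq> 1"
  shows "0 < q 0 $ i"
proof -
  have h: "q (1/2) $ j > 0" for j by (rule q_pos_interior) auto
  have "min (q (1/2) $ 2) (q (1/2) $ 3) \<le> q 0 $ j" if "j \<in> {2,3}" for j
    by (rule min_principle[of 0 0 1 "1/2" 1, where I = "{2,3}"]) (use that in auto)
  then show ?thesis
    using h[of 2] h[of 3] exhaust_3[of i] assms by (force simp: min_def split: if_splits)
qed

lemma q_pos:
  assumes "t \<in> {0..1}" "i \<noteq> 1 \<or> t \<noteq> 0"
  shows "0 < q t $ i"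
  using q_pos_interior[of t i] q_pos_right[of i] q_pos_left[of i] assms
  by (cases "t = 0"; cases "t = 1") auto

end

section \<open>First variation\<close>

text \<open>The bilinear form belonging to \<open>dyadic_energy\<close>, a discrete version of the
  integral of \<open>x' * \<phi>'\<close>.\<close>

definition cross :: "nat \<Rightarrow> (real \<Rightarrow> real) \<Rightarrow> (real \<Rightarrow> real) \<Rightarrow> real" where
  "cross n x \<phi> = 2 ^ n * (\<Sum>k<2 ^ n. (x (real (Suc k) / 2 ^ n) - x (real k / 2 ^ n)) *
     (\<phi> (real (Suc k) / 2 ^ n) - \<phi> (real k / 2 ^ n)))"

lemma dyadic_energy_variation:
  "dyadic_energy n (\<lambda>t. q t + (\<epsilon> * \<phi> t) *\<^sub>R v)
    = dyadic_energy n q + 2 * \<epsilon> * cross n (\<lambda>t. q t \<bullet> v) \<phi> + \<epsilon>\<^sup>2 * ((norm v)\<^sup>2 * cross n \<phi> \<phi>)"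
proof -
  let ?s = "\<lambda>k. real k / 2 ^ n"
  have e: "(norm ((q (?s (Suc k)) + (\<epsilon> * \<phi> (?s (Suc k))) *\<^sub>R v) - (q (?s k) + (\<epsilon> * \<phi> (?s k)) *\<^sub>R v)))\<^sup>2
      = (norm (q (?s (Suc k)) - q (?s k)))\<^sup>2
        + 2 * \<epsilon> * ((q (?s (Suc k)) \<bullet> v - q (?s k) \<bullet> v) * (\<phi> (?s (Suc k)) - \<phi> (?s k)))
        + \<epsilon>\<^sup>2 * ((norm v)\<^sup>2 * ((\<phi> (?s (Suc k)) - \<phi> (?s k)) * (\<phi> (?s (Suc k)) - \<phi> (?s k))))" for k
  proof -
    define a b where "a = q (?s (Suc k)) - q (?s k)" and "b = \<phi> (?s (Suc k)) - \<phi> (?s k)"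
    have "(q (?s (Suc k)) + (\<epsilon> * \<phi> (?s (Suc k))) *\<^sub>R v) - (q (?s k) + (\<epsilon> * \<phi> (?s k)) *\<^sub>R v) = a + (\<epsilon> * b) *\<^sub>R v"
      by (simp add: a_def b_def algebra_simps)
    moreover have "q (?s (Suc k)) \<bullet> v - q (?s k) \<bullet> v = a \<bullet> v"
      by (simp add: a_def inner_diff_left)
    moreover have "(norm (a + (\<epsilon> * b) *\<^sub>R v))\<^sup>2 = (norm a)\<^sup>2 + 2 * \<epsilon> * ((a \<bullet> v) * b) + \<epsilon>\<^sup>2 * ((norm v)\<^sup>2 * (b * b))"
      unfolding power2_norm_eq_inner by (simp add: inner_simps inner_commute power2_eq_square algebra_simps)
    ultimately show ?thesis by (simp only: a_def b_def)
  qed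
  show ?thesis
    unfolding dyadic_energy_def cross_def e sum.distrib sum_distrib_left[symmetric]
    by (simp only: distrib_left mult_ac)
qed

text \<open>When the midpoint value of \<open>\<phi>\<close> is the mean, its two half increments
  are equal, and the increments of \<open>x\<close> add up; the resulting 1/2 cancels against the
  doubled weight. Hence the first variation of the energy against a hat is the same at all fine
  levels, whatever the regularity of \<open>x\<close>.\<close>

lemma cross_Suc:
  assumes "\<And>k. k < 2 ^ n \<Longrightarrow> \<phi> (real (Suc (2 * k)) / 2 ^ Suc n)
      = (\<phi> (real k / 2 ^ n) + \<phi> (real (Suc k) / 2 ^ n)) / 2"
  shows "cross (Suc n) x \<phi> = cross n x \<phi>"
proof -
  have "(\<Sum>k<2 ^ Suc n. (x (real (Suc k) / 2 ^ Suc n) - x (real k / 2 ^ Suc n)) *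
     (\<phi> (real (Suc k) / 2 ^ Suc n) - \<phi> (real k / 2 ^ Suc n)))
    = (\<Sum>k<2 ^ n. ((x (real (Suc k) / 2 ^ n) - x (real k / 2 ^ n)) *
     (\<phi> (real (Suc k) / 2 ^ n) - \<phi> (real k / 2 ^ n))) / 2)"
    unfolding power_Suc[of 2 n] sum_lessThan_double
  proof (rule sum.cong[OF refl])
    fix k assume k: "k \<in> {..<(2::nat) ^ n}"
    have e: "real (Suc (Suc (2 * k))) / (2 * 2 ^ n) = real (Suc k) / 2 ^ n" "real (2 * k) / (2 * 2 ^ n) = real k / 2 ^ n"
      by (simp_all add: field_simps)
    have mid: "\<phi> (real (Suc (2 * k)) / (2 * 2 ^ n)) = (\<phi> (real k / 2 ^ n) + \<phi> (real (Suc k) / 2 ^ n)) / 2"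
      using assms[of k] k by simp
    show "(x (real (Suc (2 * k)) / (2 * 2 ^ n)) - x (real (2 * k) / (2 * 2 ^ n))) *
         (\<phi> (real (Suc (2 * k)) / (2 * 2 ^ n)) - \<phi> (real (2 * k) / (2 * 2 ^ n))) +
         (x (real (Suc (Suc (2 * k))) / (2 * 2 ^ n)) - x (real (Suc (2 * k)) / (2 * 2 ^ n))) *
         (\<phi> (real (Suc (Suc (2 * k))) / (2 * 2 ^ n)) - \<phi> (real (Suc (2 * k)) / (2 * 2 ^ n))) =
         (x (real (Suc k) / 2 ^ n) - x (real k / 2 ^ n)) *
         (\<phi> (real (Suc k) / 2 ^ n) - \<phi> (real k / 2 ^ n)) / 2"
      unfolding e mid by (simp add: field_simps del: of_nat_Suc)
  qed
  then show ?thesis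
    by (simp add: cross_def sum_divide_distrib[symmetric] del: of_nat_Suc)
qed

text \<open>The indices 0 and \<open>2 ^ m\<close> are allowed as well: on \<open>{0..1}\<close>
  they give half hats, which detect the natural boundary conditions.\<close>

definition hat :: "nat \<Rightarrow> nat \<Rightarrow> real \<Rightarrow> real" where
  "hat m k t = max 0 (1 - \<bar>2 ^ m * t - real k\<bar>)"

lemma hat_bounds: "0 \<le> hat m k t" "hat m k t \<le> 1"
  by (simp_all add: hat_def)

lemma continuous_on_hat [continuous_intros]: "continuous_on S (hat m k)"
  unfolding hat_def by (intro continuous_intros)

text \<open>The kinks of the hat sit at \<open>k - 1\<close>, \<open>k\<close> and
  \<open>k + 1\<close> in units of level \<open>m\<close>, hence never inside a cell of the finer
  level \<open>n\<close>.\<close>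

lemma hat_midpoint:
  assumes "m \<le> n"
  shows "hat m k (real (Suc (2 * j)) / 2 ^ Suc n)
    = (hat m k (real j / 2 ^ n) + hat m k (real (Suc j) / 2 ^ n)) / 2"
proof -
  define d :: nat where "d = 2 ^ (n - m)"
  define y0 y1 where "y0 = real j / real d - real k" and "y1 = real (Suc j) / real d - real k"
  have d: "d > 0" "(2::real) ^ n = 2 ^ m * real d"
    using assms by (simp_all add: d_def flip: power_add)
  have e: "2 ^ m * (real (Suc (2 * j)) / 2 ^ Suc n) - real k = (y0 + y1) / 2"
    "2 ^ m * (real j / 2 ^ n) - real k = y0" "2 ^ m * (real (Suc j) / 2 ^ n) - real k = y1"
    unfolding power_Suc d(2) y0_def y1_def using d(1) by (simp_all add: field_simps)
  have nobreak: "y1 \<le> real i - real k \<or> real i - real k \<le> y0" for i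
  proof -
    have "Suc j \<le> i * d \<or> i * d \<le> j" by linarith
    then have "real (Suc j) \<le> real i * real d \<or> real i * real d \<le> real j"
      by (metis of_nat_le_iff of_nat_mult)
    then show ?thesis
      unfolding y0_def y1_def using d(1) by (auto simp: field_simps)
  qed
  have "y0 \<le> y1" using d(1) by (simp add: y0_def y1_def field_simps)
  have "y1 \<le> - 1 \<or> - 1 \<le> y0"
  proof (cases "k = 0")
    case True
    then show ?thesis by (simp add: y0_def) (smt (verit) divide_nonneg_nonneg of_nat_0_le_iff)
  next
    case False
    then show ?thesis using nobreak[of "k - 1"] by (simp add: of_nat_diff)
  qed
  moreover have "y1 \<le> 0 \<or> 0 \<le> y0" using nobreak[of k] by simp
  moreover have "y1 \<le> 1 \<or> 1 \<le> y0" using nobreak[of "Suc k"] by simp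
  ultimately show ?thesis
    unfolding hat_def e using \<open>y0 \<le> y1\<close> by (auto simp: max_def abs_if field_simps)
qed

lemma cross_hat_level:
  assumes "m \<le> n"
  shows "cross n x (hat m k) = cross m x (hat m k)"
  using assms
proof (induction n rule: dec_induct)
  case (step n)
  then show ?case using cross_Suc[of n "hat m k" x] hat_midpoint[of m n k] by simp
qed simp

lemma hat_node: "hat m k (real j / 2 ^ m) = (if j = k then 1 else 0)"
proof -
  have "j \<noteq> k \<Longrightarrow> 1 \<le> \<bar>real j - real k\<bar>" by linarith
  then show ?thesis by (auto simp: hat_def)
qed

text \<open>The hat varies only on the cells adjacent to its node, one of which is missing at either
  end of \<open>{0..1}\<close>.\<close>

lemma cross_hat:
  assumes "k \<le> 2 ^ m"
  shows "cross m x (hat m k) = 2 ^ m *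
    ((if k = 0 then 0 else x (real k / 2 ^ m) - x (real (k - 1) / 2 ^ m)) -
     (if k = 2 ^ m then 0 else x (real (Suc k) / 2 ^ m) - x (real k / 2 ^ m)))"
proof -
  let ?d = "\<lambda>j. x (real (Suc j) / 2 ^ m) - x (real j / 2 ^ m)"
  have "cross m x (hat m k) = 2 ^ m * (\<Sum>j<2 ^ m. (if j = k - 1 \<and> k \<noteq> 0 then ?d j else 0) - (if j = k then ?d j else 0))"
    unfolding cross_def hat_node by (intro arg_cong2[where f = "(*)"] refl sum.cong) auto
  also have "\<dots> = 2 ^ m * ((\<Sum>j<2 ^ m. if j = k - 1 \<and> k \<noteq> 0 then ?d j else 0) - (\<Sum>j<2 ^ m. if j = k then ?d j else 0))"
    by (simp only: sum_subtractf)
  also have "(\<Sum>j<2 ^ m. if j = k then ?d j else 0) = (if k = 2 ^ m then 0 else ?d k)"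
    using assms by (auto simp: sum.delta)
  also have "(\<Sum>j<2 ^ m. if j = k - 1 \<and> k \<noteq> 0 then ?d j else 0) = (if k = 0 then 0 else ?d (k - 1))"
    using assms by (cases "k = 0") (auto simp: sum.delta)
  finally show ?thesis by auto
qed

section \<open>Derivatives of the potential\<close>

definition partialU :: "real \<Rightarrow> real \<Rightarrow> real \<Rightarrow> real" where
  "partialU a b c = - (4 * a / sqrt (a\<^sup>2 + b\<^sup>2) ^ 3 + 4 * a / sqrt (a\<^sup>2 + c\<^sup>2) ^ 3 + 1 / (2 * a\<^sup>2))"

definition dU :: "3 \<Rightarrow> real ^ 3 \<Rightarrow> real" where
  "dU i x = (if i = 1 then partialU (x$1) (x$2) (x$3)
     else if i = 2 then partialU (x$2) (x$1) (x$3) else partialU (x$3) (x$1) (x$2))"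

lemma dU_simps:
  "dU 1 x = partialU (x$1) (x$2) (x$3)" "dU 2 x = partialU (x$2) (x$1) (x$3)"
  "dU 3 x = partialU (x$3) (x$1) (x$2)"
  by (simp_all add: dU_def)

lemma continuous_on_partialU [continuous_intros]:
  assumes "continuous_on S a" "continuous_on S b" "continuous_on S c" "\<And>x. x \<in> S \<Longrightarrow> 0 < a x"
  shows "continuous_on S (\<lambda>x. partialU (a x) (b x) (c x))"
  unfolding partialU_def
  by (intro continuous_intros assms ballI) (use assms(4) in \<open>force simp: sum_power2_eq_zero_iff\<close>)+

lemma continuous_on_dU:
  assumes "continuous_on S g" "\<And>x. x \<in> S \<Longrightarrow> 0 < g x $ i"
  shows "continuous_on S (\<lambda>x. dU i (g x))"
proof -
  consider "i = 1" | "i = 2" | "i = 3" using exhaust_3[of i] by auto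
  then show ?thesis
    by cases (use assms in \<open>auto simp: dU_simps intro!: continuous_intros\<close>)
qed

lemma inverse_line_derivative:
  fixes e :: real
  assumes "v \<noteq> 0 \<Longrightarrow> 0 < x + e * v"
  shows "((\<lambda>e. 1 / (2 * (x + e * v))) has_real_derivative v * (- (1 / (2 * (x + e * v)\<^sup>2)))) (at e)"
proof (cases "v = 0")
  case False
  define y where "y = x + e * v"
  have y: "y \<noteq> 0" using assms False by (simp add: y_def)
  have "((\<lambda>e. 1 / (2 * (x + e * v))) has_real_derivative - (2 * v) / ((2 * y) * (2 * y))) (at e)"
    using y unfolding y_def by (auto intro!: derivative_eq_intros)
  moreover have "- (2 * v) / ((2 * y) * (2 * y)) = v * (- (1 / (2 * y\<^sup>2)))"
    using y by (simp add: power2_eq_square)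
  ultimately show ?thesis by (simp add: y_def)
qed simp

lemma pair_derivative:
  assumes x: "(x has_real_derivative dx) (at t within S)" and y: "(y has_real_derivative dy) (at t within S)"
    and pos: "0 < (x t)\<^sup>2 + (y t)\<^sup>2"
  shows "((\<lambda>t. 4 / sqrt ((x t)\<^sup>2 + (y t)\<^sup>2)) has_real_derivative
     (dx * (- (4 * x t / sqrt ((x t)\<^sup>2 + (y t)\<^sup>2) ^ 3))
      + dy * (- (4 * y t / sqrt ((y t)\<^sup>2 + (x t)\<^sup>2) ^ 3)))) (at t within S)"
proof -
  define R where "R = (x t)\<^sup>2 + (y t)\<^sup>2"
  have s: "R > 0" "sqrt R > 0" using pos by (simp_all add: R_def)
  have "((\<lambda>t. (x t)\<^sup>2 + (y t)\<^sup>2) has_real_derivative 2 * x t * dx + 2 * y t * dy) (at t within S)"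
    by (rule derivative_eq_intros x y refl | simp)+
  moreover have "((\<lambda>r. 4 / sqrt r) has_real_derivative - (4 * (inverse (sqrt R) / 2)) / (sqrt R * sqrt R)) (at R)"
    using s by (auto intro!: derivative_eq_intros)
  ultimately have "((\<lambda>t. 4 / sqrt ((x t)\<^sup>2 + (y t)\<^sup>2)) has_real_derivative
      - (4 * (inverse (sqrt R) / 2)) / (sqrt R * sqrt R) * (2 * x t * dx + 2 * y t * dy)) (at t within S)"
    unfolding R_def by (intro DERIV_chain2)
  moreover have e: "- (4 * (inverse (sqrt R) / 2)) / (sqrt R * sqrt R) * (2 * a * v + 2 * b * w)
    = v * (- (4 * a / sqrt R ^ 3)) + w * (- (4 * b / sqrt R ^ 3))" for a b v w
  proof -
    have "- (4 * (inverse z / 2)) / (z * z) * (2 * a * v + 2 * b * w)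
      = v * (- (4 * a / z ^ 3)) + w * (- (4 * b / z ^ 3))" if "z > 0" for z :: real
      using that by (simp add: field_simps power3_eq_cube)
    then show ?thesis using s(2) .
  qed
  ultimately show ?thesis
    unfolding e by (simp only: R_def add.commute[of "(y t)\<^sup>2"])
qed

lemma pair_line_derivative:
  fixes e :: real
  assumes "v \<noteq> 0 \<Longrightarrow> 0 < x + e * v" "w \<noteq> 0 \<Longrightarrow> 0 < y + e * w"
  shows "((\<lambda>e. 4 / sqrt ((x + e * v)\<^sup>2 + (y + e * w)\<^sup>2)) has_real_derivative
     (v * (- (4 * (x + e * v) / sqrt ((x + e * v)\<^sup>2 + (y + e * w)\<^sup>2) ^ 3))
      + w * (- (4 * (y + e * w) / sqrt ((y + e * w)\<^sup>2 + (x + e * v)\<^sup>2) ^ 3)))) (at e)"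
proof (cases "v = 0 \<and> w = 0")
  case False
  then have "0 < (x + e * v)\<^sup>2 + (y + e * w)\<^sup>2"
    using assms by (auto simp: sum_power2_gt_zero_iff)
  then show ?thesis
    by (intro pair_derivative) (auto intro!: derivative_eq_intros)
qed simp

text \<open>
  A coordinate with \<open>v $ i = 0\<close> may vanish: its own term, then equal to the conventional \<open>1/0\<close>, is constant in \<open>e\<close>.
\<close>
lemma potential_line_derivative:
  assumes "\<And>i. v $ i \<noteq> 0 \<Longrightarrow> 0 < (x + e *\<^sub>R v) $ i"
  shows "((\<lambda>e. potential (x + e *\<^sub>R v)) has_real_derivative (\<Sum>i\<in>UNIV. v $ i * dU i (x + e *\<^sub>R v))) (at e)"
proof -
  have p: "v $ i \<noteq> 0 \<Longrightarrow> 0 < x $ i + e * v $ i" for i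
    using assms[of i] by simp
  let ?y = "x + e *\<^sub>R v"
  have "((\<lambda>e. potential (x + e *\<^sub>R v)) has_real_derivative
    (v$1 * (- (4 * ?y$1 / sqrt ((?y$1)\<^sup>2 + (?y$2)\<^sup>2) ^ 3)) + v$2 * (- (4 * ?y$2 / sqrt ((?y$2)\<^sup>2 + (?y$1)\<^sup>2) ^ 3)))
    + (v$1 * (- (4 * ?y$1 / sqrt ((?y$1)\<^sup>2 + (?y$3)\<^sup>2) ^ 3)) + v$3 * (- (4 * ?y$3 / sqrt ((?y$3)\<^sup>2 + (?y$1)\<^sup>2) ^ 3)))
    + (v$2 * (- (4 * ?y$2 / sqrt ((?y$2)\<^sup>2 + (?y$3)\<^sup>2) ^ 3)) + v$3 * (- (4 * ?y$3 / sqrt ((?y$3)\<^sup>2 + (?y$2)\<^sup>2) ^ 3)))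
    + v$1 * (- (1 / (2 * (?y$1)\<^sup>2))) + v$2 * (- (1 / (2 * (?y$2)\<^sup>2))) + v$3 * (- (1 / (2 * (?y$3)\<^sup>2)))) (at e)"
    unfolding potential_def vector_add_component vector_scaleR_component real_scaleR_def
    by (intro DERIV_add pair_line_derivative inverse_line_derivative p)
  then show ?thesis
    by (rule DERIV_cong) (simp add: sum_3 dU_simps partialU_def algebra_simps)
qed

text \<open>A coordinate that changes is at least \<open>\<eta>\<close> before and after, so
  truncation does not touch its terms. Terms in unchanged coordinates cancel on both sides, even at
  a collision, where \<open>potential\<close> has only a conventional value.\<close>

lemma trunc_potential_diff_eq_potential_diff:
  assumes \<eta>: "0 < \<eta>" "1 / 2 ^ n \<le> \<eta>"
    and xy: "\<And>i. x $ i = y $ i \<or> (\<eta> \<le> x $ i \<and> \<eta> \<le> y $ i)"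
  shows "trunc_potential n y - trunc_potential n x = potential y - potential x"
proof -
  have s: "trunc_inverse n (y$i) / 2 - trunc_inverse n (x$i) / 2 = 1 / (2 * y$i) - 1 / (2 * x$i)" for i
    using xy[of i] \<eta> by (auto simp: trunc_inverse_eq)
  have big: "\<eta> \<le> sqrt (a\<^sup>2 + b\<^sup>2)" "\<eta> \<le> sqrt (b\<^sup>2 + a\<^sup>2)" if "\<eta> \<le> a" for a b
    using that real_sqrt_sum_squares_ge1[of a b] real_sqrt_sum_squares_ge2[of a b] by linarith+
  have p: "4 * trunc_inverse n (sqrt ((y$i)\<^sup>2 + (y$j)\<^sup>2)) - 4 * trunc_inverse n (sqrt ((x$i)\<^sup>2 + (x$j)\<^sup>2))
    = 4 / sqrt ((y$i)\<^sup>2 + (y$j)\<^sup>2) - 4 / sqrt ((x$i)\<^sup>2 + (x$j)\<^sup>2)" for i j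
  proof (cases "x $ i = y $ i \<and> x $ j = y $ j")
    case False
    then have "\<eta> \<le> sqrt ((y$i)\<^sup>2 + (y$j)\<^sup>2)" "\<eta> \<le> sqrt ((x$i)\<^sup>2 + (x$j)\<^sup>2)"
      using xy[of i] xy[of j] big by blast+
    then show ?thesis using \<eta>(2) by (simp add: trunc_inverse_eq)
  qed simp
  show ?thesis
    unfolding trunc_potential_def potential_def
    using s[of 1] s[of 2] s[of 3] p[of 1 2] p[of 1 3] p[of 2 3] by linarith
qed

section \<open>Euler-Lagrange identities against hat functions\<close>

definition hat_left :: "nat \<Rightarrow> nat \<Rightarrow> real" where
  "hat_left m k = max 0 ((real k - 1) / 2 ^ m)"

definition hat_right :: "nat \<Rightarrow> nat \<Rightarrow> real" where
  "hat_right m k = min 1 ((real k + 1) / 2 ^ m)"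

lemma hat_eq_0:
  assumes "t \<in> {0..1}" "t \<notin> {hat_left m k..hat_right m k}"
  shows "hat m k t = 0"
  using assms by (auto simp: hat_left_def hat_right_def hat_def field_simps)

lemma hat_interval:
  assumes "k \<le> 2 ^ m"
  shows "0 \<le> hat_left m k" "hat_left m k < hat_right m k" "hat_right m k \<le> 1"
proof -
  have "real k / 2 ^ m \<le> 1" "0 \<le> real k / 2 ^ m" "0 < 1 / (2 ^ m :: real)"
    using assms by (simp_all add: divide_le_eq)
  then show "0 \<le> hat_left m k" "hat_left m k < hat_right m k" "hat_right m k \<le> 1"
    unfolding hat_left_def hat_right_def diff_divide_distrib add_divide_distrib by linarith+
qed

context minimizer
begin

text \<open>The arc is displaced by \<open>\<epsilon> * hat m k\<close> in the direction
  \<open>v\<close>. For small \<open>\<epsilon>\<close> the change of the action is the same number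
  \<open>D \<epsilon>\<close> at all fine levels; minimality makes it nonnegative, so the derivative
  of \<open>D\<close> vanishes at 0. The conditions on \<open>v\<close> for \<open>k = 0\<close> and
  \<open>k = 2 ^ m\<close> preserve the endpoint conditions.\<close>

theorem euler_lagrange_hat:
  assumes k: "k \<le> 2 ^ m"
    and pos: "\<And>t i. t \<in> {hat_left m k..hat_right m k} \<Longrightarrow> v $ i \<noteq> 0 \<Longrightarrow> 0 < q t $ i"
    and left: "k = 0 \<Longrightarrow> v $ 1 = 0 \<and> v $ 2 = v $ 3"
    and right: "k = 2 ^ m \<Longrightarrow> v $ 1 = v $ 2"
  shows "cross m (\<lambda>t. q t \<bullet> v) (hat m k) / 2 +
    integral {hat_left m k..hat_right m k} (\<lambda>t. hat m k t * (\<Sum>i\<in>UNIV. v $ i * dU i (q t))) = 0"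
proof -
  define c d where "c = hat_left m k" and "d = hat_right m k"
  have cd: "0 \<le> c" "c < d" "d \<le> 1" using hat_interval[OF k] by (auto simp: c_def d_def)
  have sub: "{c..d} \<subseteq> {0..1}" using cd by auto
  note pos = pos[folded c_def d_def]
  have "\<exists>\<eta>>0. \<forall>t\<in>{c..d}. v $ i \<noteq> 0 \<longrightarrow> \<eta> \<le> q t $ i" for i
  proof (cases "v $ i = 0")
    case False
    obtain s where "s \<in> {c..d}" "\<forall>t\<in>{c..d}. q s $ i \<le> q t $ i"
      using continuous_attains_inf[of "{c..d}" "\<lambda>t. q t $ i"] cont_q_nth[OF sub] cd by auto
    then show ?thesis using pos[of s i] False by auto
  qed (auto intro: exI[of _ 1])
  then obtain \<eta>' where \<eta>': "\<And>i. \<eta>' i > 0" "\<And>i t. t \<in> {c..d} \<Longrightarrow> v $ i \<noteq> 0 \<Longrightarrow> \<eta>' i \<le> q t $ i"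
    by metis
  \<comment> \<open>Half of the minimum: the coordinates that move stay above \<open>\<eta>\<close>
    after a displacement of size at most \<open>\<eta>\<close>.\<close>
  define \<eta> where "\<eta> = min (\<eta>' 1) (min (\<eta>' 2) (\<eta>' 3)) / 2"
  have \<eta>: "\<eta> > 0" using \<eta>'(1) by (simp add: \<eta>_def)
  have "2 * \<eta> \<le> \<eta>' i" for i using exhaust_3[of i] by (auto simp: \<eta>_def)
  then have q\<eta>: "2 * \<eta> \<le> q t $ i" if "t \<in> {c..d}" "v $ i \<noteq> 0" for i t
    using \<eta>'(2)[OF that] by (meson order.trans)
  define \<epsilon>0 where "\<epsilon>0 = \<eta> / (norm v + 1)"
  have nv: "norm v + 1 > 0" using norm_ge_zero[of v] by linarith
  have \<epsilon>0: "\<epsilon>0 > 0" using \<eta> nv by (simp add: \<epsilon>0_def)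
  have small: "\<bar>\<epsilon> * hat m k t * v $ i\<bar> \<le> \<eta>" if "\<bar>\<epsilon>\<bar> \<le> \<epsilon>0" for \<epsilon> t i
  proof -
    have "\<bar>\<epsilon> * hat m k t * v $ i\<bar> = \<bar>\<epsilon>\<bar> * hat m k t * \<bar>v $ i\<bar>"
      using hat_bounds[of m k t] by (simp add: abs_mult)
    also have "\<dots> \<le> \<epsilon>0 * 1 * (norm v + 1)"
      using that \<epsilon>0 hat_bounds[of m k t] component_le_norm_cart[of v i] nv by (intro mult_mono) auto
    also have "\<dots> = \<eta>" using nv by (simp add: \<epsilon>0_def)
    finally show ?thesis .
  qed
  define r where "r = (\<lambda>\<epsilon> t. q t + (\<epsilon> * hat m k t) *\<^sub>R v)"
  have r_nth: "r \<epsilon> t $ i = q t $ i + \<epsilon> * hat m k t * v $ i" for \<epsilon> t i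
    by (simp add: r_def)
  have r\<eta>: "\<eta> \<le> r \<epsilon> t $ i" if "\<bar>\<epsilon>\<bar> \<le> \<epsilon>0" "t \<in> {c..d}" "v $ i \<noteq> 0" for \<epsilon> t i
    using q\<eta>[OF that(2,3)] small[OF that(1), of t i] unfolding r_nth by linarith
  have r_out: "r \<epsilon> t = q t" if "t \<in> {0..1}" "t \<notin> {c..d}" for \<epsilon> t
    using hat_eq_0[of t m k] that by (simp add: r_def c_def d_def)
  have cont_r: "continuous_on {0..1} (r \<epsilon>)" for \<epsilon>
    unfolding r_def by (intro continuous_intros cont_q)
  have admissible_r: "admissible (r \<epsilon>)" if \<epsilon>: "\<bar>\<epsilon>\<bar> \<le> \<epsilon>0" for \<epsilon>
    unfolding admissible_def
  proof (intro conjI ballI allI)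
    show "0 \<le> r \<epsilon> t $ i" if t: "t \<in> {0..1}" for t i
    proof (cases "t \<in> {c..d} \<and> v $ i \<noteq> 0")
      case True
      then show ?thesis using r\<eta>[OF \<epsilon>, of t i] \<eta> by simp
    next
      case False
      then have "r \<epsilon> t $ i = q t $ i" using r_out[OF t, of \<epsilon>]
        by (cases "v $ i = 0") (simp add: r_nth, metis)
      then show ?thesis using q_nonneg[OF t] by simp
    qed
    have h0: "hat m k 0 = (if k = 0 then 1 else 0)" using hat_node[of m k 0] by auto
    have h1: "hat m k 1 = (if k = 2 ^ m then 1 else 0)" using hat_node[of m k "2 ^ m"] by auto
    show "r \<epsilon> 0 $ 1 = 0" "r \<epsilon> 0 $ 2 = r \<epsilon> 0 $ 3" "r \<epsilon> 1 $ 1 = r \<epsilon> 1 $ 2"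
      using left right q_bc unfolding r_nth h0 h1 by auto
  qed (rule cont_r)
  define C B where "C = cross m (\<lambda>t. q t \<bullet> v) (hat m k)"
    and "B = (norm v)\<^sup>2 * cross m (hat m k) (hat m k)"
  have dyadic_energy_r: "dyadic_energy n (r \<epsilon>) = dyadic_energy n q + 2 * \<epsilon> * C + \<epsilon>\<^sup>2 * B" if "m \<le> n" for n \<epsilon>
    unfolding r_def dyadic_energy_variation C_def B_def using cross_hat_level[OF that] by simp
  obtain N where N: "1 / 2 ^ N < \<eta>"
    using \<eta> real_arch_pow_inv[of \<eta> "1/2"] by (auto simp: power_divide)
  have trunc_potential_r: "trunc_potential n (r \<epsilon> t) - trunc_potential n (q t) = potential (r \<epsilon> t) - potential (q t)"
    if "N \<le> n" "\<bar>\<epsilon>\<bar> \<le> \<epsilon>0" "t \<in> {c..d}" for n \<epsilon> t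
  proof (rule trunc_potential_diff_eq_potential_diff[OF \<eta>])
    have "1 / 2 ^ n \<le> (1 / 2 ^ N :: real)"
      using that(1) by (intro divide_left_mono power_increasing) auto
    then show "1 / 2 ^ n \<le> \<eta>" using N by simp
    show "q t $ i = r \<epsilon> t $ i \<or> (\<eta> \<le> q t $ i \<and> \<eta> \<le> r \<epsilon> t $ i)" for i
      using q\<eta>[OF that(3), of i] r\<eta>[OF that(2,3), of i] \<eta> by (cases "v $ i = 0") (auto simp: r_nth)
  qed
  define D where "D = (\<lambda>\<epsilon>. (2 * \<epsilon> * C + \<epsilon>\<^sup>2 * B) / 4 +
    integral {c..d} (\<lambda>t. potential (r \<epsilon> t) - potential (q t)))"
  have dyadic_action_r: "dyadic_action n (r \<epsilon>) = dyadic_action n q + D \<epsilon>" if n: "m \<le> n" "N \<le> n" and \<epsilon>: "\<bar>\<epsilon>\<bar> \<le> \<epsilon>0" for n \<epsilon>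
  proof -
    have "integral {0..1} (\<lambda>t. trunc_potential n (r \<epsilon> t)) - integral {0..1} (\<lambda>t. trunc_potential n (q t))
        = integral {0..1} (\<lambda>t. trunc_potential n (r \<epsilon> t) - trunc_potential n (q t))"
      by (intro integral_diff[symmetric] trunc_potential_integrable cont_r cont_q)
    also have "\<dots> = integral {0..1} (\<lambda>t. if t \<in> {c..d} then potential (r \<epsilon> t) - potential (q t) else 0)"
      by (intro Henstock_Kurzweil_Integration.integral_cong)
         (use trunc_potential_r[OF n(2) \<epsilon>] r_out in \<open>auto simp del: atLeastAtMost_iff\<close>)
    also have "\<dots> = integral ({c..d} \<inter> {0..1}) (\<lambda>t. potential (r \<epsilon> t) - potential (q t))"
      by (rule Henstock_Kurzweil_Integration.integral_restrict_Int)
    also have "{c..d} \<inter> {0..1} = {c..d}" using sub by auto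
    finally show ?thesis
      using dyadic_energy_r[OF n(1), of \<epsilon>] unfolding dyadic_action_def D_def by (simp add: field_simps)
  qed
  have D_nonneg: "0 \<le> D \<epsilon>" if \<epsilon>: "\<bar>\<epsilon>\<bar> \<le> \<epsilon>0" for \<epsilon>
  proof (rule ccontr)
    assume "\<not> 0 \<le> D \<epsilon>"
    then show False
      using no_improvement[OF admissible_r[OF \<epsilon>], of "- D \<epsilon>" "max m N"] dyadic_action_r[OF _ _ \<epsilon>] by auto
  qed
  let ?g = "\<lambda>\<epsilon> t. hat m k t * (\<Sum>i\<in>UNIV. v $ i * dU i (r \<epsilon> t))"
  have "((\<lambda>\<epsilon>. integral (cbox c d) (\<lambda>t. potential (r \<epsilon> t) - potential (q t))) has_field_derivative
      integral (cbox c d) (?g 0)) (at 0 within {-\<epsilon>0<..<\<epsilon>0})"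
  proof (rule leibniz_rule_field_derivative)
    fix \<epsilon> t assume \<epsilon>: "\<epsilon> \<in> {-\<epsilon>0<..<\<epsilon>0}" and t: "t \<in> cbox c d"
    have "((\<lambda>\<epsilon>. potential (q t + \<epsilon> *\<^sub>R v)) has_real_derivative (\<Sum>i\<in>UNIV. v $ i * dU i (r \<epsilon> t)))
      (at (\<epsilon> * hat m k t))"
      unfolding r_def
      by (rule potential_line_derivative) (use r\<eta>[of \<epsilon> t] \<epsilon> t \<eta> in \<open>force simp: r_def\<close>)
    moreover have "((\<lambda>\<epsilon>. \<epsilon> * hat m k t) has_real_derivative hat m k t) (at \<epsilon>)"
      by (auto intro!: derivative_eq_intros)
    ultimately have "((\<lambda>\<epsilon>. potential (r \<epsilon> t)) has_real_derivative (\<Sum>i\<in>UNIV. v $ i * dU i (r \<epsilon> t)) * hat m k t) (at \<epsilon>)"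
      unfolding r_def by (rule DERIV_chain2)
    then have "((\<lambda>\<epsilon>. potential (r \<epsilon> t) - potential (q t)) has_real_derivative ?g \<epsilon> t) (at \<epsilon>)"
      by (auto intro!: derivative_eq_intros simp: mult.commute)
    then show "((\<lambda>\<epsilon>. potential (r \<epsilon> t) - potential (q t)) has_real_derivative ?g \<epsilon> t) (at \<epsilon> within {-\<epsilon>0<..<\<epsilon>0})"
      by (rule has_field_derivative_at_within)
  next
    fix \<epsilon> assume \<epsilon>: "\<epsilon> \<in> {-\<epsilon>0<..<\<epsilon>0}"
    \<comment> \<open>The potentials themselves may contain conventional quotients at a vanishing
      coordinate; integrability of their difference is inherited from the truncated one, which
      equals it on \<open>{c..d}\<close>.\<close>
    have "(\<lambda>t. trunc_potential N (r \<epsilon> t) - trunc_potential N (q t)) integrable_on {c..d}"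
      by (intro integrable_diff trunc_potential_integrable continuous_on_subset[OF cont_r sub] continuous_on_subset[OF cont_q sub])
    then show "(\<lambda>t. potential (r \<epsilon> t) - potential (q t)) integrable_on cbox c d"
      unfolding cbox_interval
      by (rule integrable_eq) (use trunc_potential_r[of N \<epsilon>] \<epsilon> in auto)
  next
    \<comment> \<open>For \<open>v $ i = 0\<close> the summand is identically 0, so a singularity of
      \<open>dU i\<close> at a zero of that coordinate does no harm.\<close>
    have "continuous_on ({-\<epsilon>0<..<\<epsilon>0} \<times> {c..d}) (\<lambda>p. v $ i * dU i (r (fst p) (snd p)))" for i
    proof (cases "v $ i = 0")
      case False
      have "continuous_on ({-\<epsilon>0<..<\<epsilon>0} \<times> {c..d}) (\<lambda>p. dU i (r (fst p) (snd p)))"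
      proof (rule continuous_on_dU)
        show "continuous_on ({-\<epsilon>0<..<\<epsilon>0} \<times> {c..d}) (\<lambda>p. r (fst p) (snd p))"
          unfolding r_def
          by (intro continuous_intros continuous_on_compose2[OF cont_q] continuous_on_compose2[OF continuous_on_hat[of UNIV]])
             (use sub in auto)
        show "0 < r (fst p) (snd p) $ i" if "p \<in> {-\<epsilon>0<..<\<epsilon>0} \<times> {c..d}" for p
          using r\<eta>[of "fst p" "snd p" i] that False \<eta> by force
      qed
      then show ?thesis by (intro continuous_intros)
    qed simp
    then have "continuous_on ({-\<epsilon>0<..<\<epsilon>0} \<times> {c..d}) (\<lambda>p. \<Sum>i\<in>UNIV. v $ i * dU i (r (fst p) (snd p)))"
      by (intro continuous_on_sum)
    moreover have "continuous_on ({-\<epsilon>0<..<\<epsilon>0} \<times> {c..d}) (\<lambda>p. hat m k (snd p))"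
      by (rule continuous_on_compose2[OF continuous_on_hat[of UNIV] continuous_on_snd[OF continuous_on_id]]) auto
    ultimately show "continuous_on ({-\<epsilon>0<..<\<epsilon>0} \<times> cbox c d) (\<lambda>(\<epsilon>, t). ?g \<epsilon> t)"
      unfolding cbox_interval split_beta
      by (rule continuous_on_mult[rotated])
  qed (use \<epsilon>0 in auto)
  moreover have "at 0 within {-\<epsilon>0<..<\<epsilon>0} = at 0"
    by (rule at_within_open) (use \<epsilon>0 in auto)
  ultimately have "((\<lambda>\<epsilon>. integral {c..d} (\<lambda>t. potential (r \<epsilon> t) - potential (q t))) has_real_derivative
      integral {c..d} (?g 0)) (at 0)"
    by (simp only: cbox_interval)
  then have "(D has_real_derivative C / 2 + integral {c..d} (?g 0)) (at 0)"
    unfolding D_def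
  proof (intro DERIV_add)
    show "((\<lambda>\<epsilon>. (2 * \<epsilon> * C + \<epsilon>\<^sup>2 * B) / 4) has_real_derivative C / 2) (at 0)"
      by (auto intro!: derivative_eq_intros)
  qed
  moreover have "D 0 = 0" by (simp add: D_def r_def)
  ultimately have "C / 2 + integral {c..d} (?g 0) = 0"
    using DERIV_local_min[of D "C / 2 + integral {c..d} (?g 0)" 0 \<epsilon>0] \<epsilon>0 D_nonneg by auto
  then show ?thesis by (simp add: C_def c_def d_def r_def)
qed

end

section \<open>Equations of motion and natural boundary conditions\<close>

text \<open>Two integrations by parts, with \<open>w\<close> a second antiderivative of
  \<open>f\<close>. The term \<open>u\<close> at the node cancels against the falling half for an
  interior node and survives as the boundary term of a half hat.\<close>

lemma hat_rising_integral:
  assumes k: "1 \<le> k"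
    and w: "\<And>t. t \<in> {(real k - 1) / 2 ^ m..real k / 2 ^ m} \<Longrightarrow>
      (w has_real_derivative u t) (at t within {(real k - 1) / 2 ^ m..real k / 2 ^ m})"
    and u: "\<And>t. t \<in> {(real k - 1) / 2 ^ m..real k / 2 ^ m} \<Longrightarrow>
      (u has_real_derivative f t) (at t within {(real k - 1) / 2 ^ m..real k / 2 ^ m})"
  shows "((\<lambda>t. hat m k t * f t) has_integral
    (u (real k / 2 ^ m) - 2 ^ m * (w (real k / 2 ^ m) - w ((real k - 1) / 2 ^ m))))
    {(real k - 1) / 2 ^ m..real k / 2 ^ m}"
proof -
  let ?c = "(real k - 1) / 2 ^ m" and ?p = "real k / 2 ^ m"
  let ?G = "\<lambda>t. (2 ^ m * t - real k + 1) * u t - 2 ^ m * w t"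
  have I: "((\<lambda>t. (2 ^ m * t - real k + 1) * f t) has_integral (?G ?p - ?G ?c)) {?c..?p}"
  proof (rule fundamental_theorem_of_calculus)
    show "?c \<le> ?p" by (simp add: divide_right_mono)
    fix t assume t: "t \<in> {?c..?p}"
    show "(?G has_vector_derivative (2 ^ m * t - real k + 1) * f t) (at t within {?c..?p})"
      unfolding has_real_derivative_iff_has_vector_derivative[symmetric]
      using w[OF t] u[OF t] by (auto intro!: derivative_eq_intros simp: algebra_simps)
  qed
  have ends: "?G ?p - ?G ?c = u ?p - 2 ^ m * (w ?p - w ?c)"
  proof -
    have e: "2 ^ m * ?p = real k" "2 ^ m * ?c = real k - 1" by simp_all
    show ?thesis unfolding e by (simp add: right_diff_distrib)
  qed
  have eq: "(2 ^ m * t - real k + 1) * f t = hat m k t * f t" if "t \<in> {?c..?p}" for t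
    using that by (auto simp: hat_def field_simps)
  show ?thesis
    by (rule has_integral_eq[OF eq I[unfolded ends]])
qed

lemma hat_falling_integral:
  assumes w: "\<And>t. t \<in> {real k / 2 ^ m..(real k + 1) / 2 ^ m} \<Longrightarrow>
      (w has_real_derivative u t) (at t within {real k / 2 ^ m..(real k + 1) / 2 ^ m})"
    and u: "\<And>t. t \<in> {real k / 2 ^ m..(real k + 1) / 2 ^ m} \<Longrightarrow>
      (u has_real_derivative f t) (at t within {real k / 2 ^ m..(real k + 1) / 2 ^ m})"
  shows "((\<lambda>t. hat m k t * f t) has_integral
    (2 ^ m * (w ((real k + 1) / 2 ^ m) - w (real k / 2 ^ m)) - u (real k / 2 ^ m)))
    {real k / 2 ^ m..(real k + 1) / 2 ^ m}"
proof -
  let ?d = "(real k + 1) / 2 ^ m" and ?p = "real k / 2 ^ m"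
  let ?G = "\<lambda>t. (1 + real k - 2 ^ m * t) * u t + 2 ^ m * w t"
  have I: "((\<lambda>t. (1 + real k - 2 ^ m * t) * f t) has_integral (?G ?d - ?G ?p)) {?p..?d}"
  proof (rule fundamental_theorem_of_calculus)
    show "?p \<le> ?d" by (simp add: divide_right_mono)
    fix t assume t: "t \<in> {?p..?d}"
    show "(?G has_vector_derivative (1 + real k - 2 ^ m * t) * f t) (at t within {?p..?d})"
      unfolding has_real_derivative_iff_has_vector_derivative[symmetric]
      using w[OF t] u[OF t] by (auto intro!: derivative_eq_intros simp: algebra_simps)
  qed
  have ends: "?G ?d - ?G ?p = 2 ^ m * (w ?d - w ?p) - u ?p"
  proof -
    have e: "2 ^ m * ?p = real k" "2 ^ m * ?d = real k + 1" by simp_all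
    show ?thesis unfolding e by (simp add: right_diff_distrib)
  qed
  have eq: "(1 + real k - 2 ^ m * t) * f t = hat m k t * f t" if "t \<in> {?p..?d}" for t
    using that by (auto simp: hat_def field_simps)
  show ?thesis
    by (rule has_integral_eq[OF eq I[unfolded ends]])
qed

text \<open>Vanishing second differences and \<open>g 0 = 0\<close> make \<open>g\<close> linear,
  and a linear sequence that also vanishes at \<open>n\<close> is 0.\<close>

lemma second_difference_zero:
  fixes g :: "nat \<Rightarrow> real"
  assumes "\<And>j. j + 2 \<le> n \<Longrightarrow> g (j + 2) = 2 * g (j + 1) - g j" "g 0 = 0" "g n = 0" "j \<le> n"
  shows "g j = 0"
proof -
  have lin: "g j = real j * g 1" if "j \<le> n" for j
    using that
  proof (induction j rule: less_induct)
    case (less j)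
    consider "j = 0" | "j = 1" | i where "j = i + 2"
      using le_Suc_ex[of 2 j] by (cases "j < 2") (auto simp: add.commute less_2_cases_iff)
    then show ?case
    proof cases
      case 3
      then have "g (i + 1) = real (i + 1) * g 1" "g i = real i * g 1"
        using less.prems less.IH[of "i + 1"] less.IH[of i] by auto
      then show ?thesis using 3 assms(1)[of i] less.prems by (simp add: algebra_simps)
    qed (use assms in auto)
  qed
  from lin[OF order.refl] lin[OF assms(4)] show ?thesis
    using assms(3,4) by (cases "n = 0") auto
qed

text \<open>
  The hat identities say that \<open>x\<close> and a second antiderivative of \<open>f\<close> have the same second differences
  at all dyadic points, so they differ by an affine function.
\<close>
lemma ode_of_hat_identities:
  assumes a: "\<alpha> = real a / 2 ^ M" and b: "\<beta> = real b / 2 ^ M" and ab: "\<alpha> < \<beta>"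
    and x: "continuous_on {\<alpha>..\<beta>} x" and f: "continuous_on {\<alpha>..\<beta>} f"
    and hat: "\<And>m k. M \<le> m \<Longrightarrow> 1 \<le> k \<Longrightarrow> \<alpha> \<le> (real k - 1) / 2 ^ m \<Longrightarrow> (real k + 1) / 2 ^ m \<le> \<beta> \<Longrightarrow>
      2 ^ m * (2 * x (real k / 2 ^ m) - x ((real k - 1) / 2 ^ m) - x ((real k + 1) / 2 ^ m))
      + integral {(real k - 1) / 2 ^ m..(real k + 1) / 2 ^ m} (\<lambda>t. hat m k t * f t) = 0"
  shows "\<exists>u. \<forall>t\<in>{\<alpha>..\<beta>}. (x has_real_derivative u t) (at t within {\<alpha>..\<beta>}) \<and>
    (u has_real_derivative f t) (at t within {\<alpha>..\<beta>})"
proof -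
  define F where "F = (\<lambda>t. integral {\<alpha>..t} f)"
  have F: "(F has_real_derivative f t) (at t within {\<alpha>..\<beta>})" if "t \<in> {\<alpha>..\<beta>}" for t
    unfolding F_def by (rule integral_has_real_derivative[OF f that])
  have contF: "continuous_on {\<alpha>..\<beta>} F"
    using F by (meson DERIV_continuous continuous_on_eq_continuous_within)
  define W where "W = (\<lambda>t. integral {\<alpha>..t} F)"
  have W: "(W has_real_derivative F t) (at t within {\<alpha>..\<beta>})" if "t \<in> {\<alpha>..\<beta>}" for t
    unfolding W_def by (rule integral_has_real_derivative[OF contF that])
  have contW: "continuous_on {\<alpha>..\<beta>} W"
    using W by (meson DERIV_continuous continuous_on_eq_continuous_within)
  define y where "y = (\<lambda>t. x t - W t)"
  define L where "L = (y \<beta> - y \<alpha>) / (\<beta> - \<alpha>)"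
  \<comment> \<open>Subtracting the chord makes both end values 0 and does not affect second
    differences.\<close>
  define z where "z = (\<lambda>t. y t - y \<alpha> - L * (t - \<alpha>))"
  have z_ends: "z \<alpha> = 0" "z \<beta> = 0" using ab by (auto simp: z_def L_def)
  have contz: "continuous_on {\<alpha>..\<beta>} z"
    unfolding z_def y_def by (intro continuous_intros x contW)
  have z2: "z ((real k + 1) / 2 ^ m) = 2 * z (real k / 2 ^ m) - z ((real k - 1) / 2 ^ m)"
    if m: "M \<le> m" "1 \<le> k" "\<alpha> \<le> (real k - 1) / 2 ^ m" "(real k + 1) / 2 ^ m \<le> \<beta>" for m k
  proof -
    let ?c = "(real k - 1) / 2 ^ m" and ?p = "real k / 2 ^ m" and ?d = "(real k + 1) / 2 ^ m"
    have cpd: "?c \<le> ?p" "?p \<le> ?d" by (simp_all add: divide_right_mono)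
    have sub: "{?c..?p} \<subseteq> {\<alpha>..\<beta>}" "{?p..?d} \<subseteq> {\<alpha>..\<beta>}" using m cpd by auto
    have "((\<lambda>t. hat m k t * f t) has_integral
      (F ?p - 2 ^ m * (W ?p - W ?c)) + (2 ^ m * (W ?d - W ?p) - F ?p)) {?c..?d}"
      by (rule has_integral_combine[OF cpd])
         (rule hat_rising_integral hat_falling_integral m DERIV_subset[OF F] DERIV_subset[OF W] sub
           | use sub in blast)+
    then have "integral {?c..?d} (\<lambda>t. hat m k t * f t)
        = - (2 ^ m * (2 * W ?p - W ?c - W ?d))"
      by (subst integral_unique) (auto simp: algebra_simps)
    with hat[OF m] have "2 ^ m * ((2 * x ?p - x ?c - x ?d) - (2 * W ?p - W ?c - W ?d)) = 0"
      by (simp only: right_diff_distrib)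
    then have "(2 * x ?p - x ?c - x ?d) = (2 * W ?p - W ?c - W ?d)" by simp
    then have "y ?d = 2 * y ?p - y ?c" unfolding y_def by argo
    moreover have "L * (?d - \<alpha>) = 2 * (L * (?p - \<alpha>)) - L * (?c - \<alpha>)"
      by (simp add: field_simps)
    ultimately show ?thesis unfolding z_def by argo
  qed
  have z_dyadic: "z (real l / 2 ^ m) = 0" if m: "M \<le> m" and l: "\<alpha> \<le> real l / 2 ^ m" "real l / 2 ^ m \<le> \<beta>" for m l
  proof -
    define A B where "A = a * 2 ^ (m - M)" and "B = b * 2 ^ (m - M)"
    have sc: "(2::real) ^ m = 2 ^ M * 2 ^ (m - M)" using m by (simp flip: power_add)
    have A: "\<alpha> = real A / 2 ^ m" and B: "\<beta> = real B / 2 ^ m"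
      unfolding a b sc A_def B_def by simp_all
    have Al: "A \<le> l" "l \<le> B" using l unfolding A B by (simp_all add: divide_le_cancel)
    define g where "g = (\<lambda>j. z (real (A + j) / 2 ^ m))"
    have "g (l - A) = 0"
    proof (rule second_difference_zero[of "B - A"])
      show "g 0 = 0" "g (B - A) = 0"
        using z_ends Al unfolding A B by (simp_all add: g_def)
      show "g (j + 2) = 2 * g (j + 1) - g j" if j: "j + 2 \<le> B - A" for j
      proof -
        have "real (A + j + 2) \<le> real B" using j by simp
        then have "real (A + j + 2) / 2 ^ m \<le> real B / 2 ^ m" by (rule divide_right_mono) simp
        then show ?thesis
          using z2[of m "A + j + 1"] m unfolding A B g_def by (simp add: divide_right_mono add.commute)
      qed
    qed (use Al in simp)
    then show ?thesis using Al by (simp add: g_def)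
  qed
  have z0: "z t = 0" if t: "t \<in> {\<alpha>..\<beta>}" for t
  proof -
    have t0: "0 \<le> t" using t a by (auto intro: order.trans[rotated])
    \<comment> \<open>Rounding down to the grid cannot leave the interval on the left, because
      \<open>\<alpha>\<close> is itself a grid point from level \<open>M\<close> on.\<close>
    have fl: "real (dyfloor n t) / 2 ^ n \<in> {\<alpha>..\<beta>}" if "M \<le> n" for n
    proof -
      have "(2::real) ^ n = 2 ^ M * 2 ^ (n - M)" using that by (simp flip: power_add)
      then have al: "\<alpha> = real (a * 2 ^ (n - M)) / 2 ^ n" unfolding a by simp
      have "real (a * 2 ^ (n - M)) / 2 ^ n < real (Suc (dyfloor n t)) / 2 ^ n"
        using t dyfloor_bounds(2)[OF t0, of n] unfolding al by auto
      then have "a * 2 ^ (n - M) < Suc (dyfloor n t)"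
        by (simp add: divide_less_cancel del: of_nat_Suc of_nat_mult)
      then have "real (a * 2 ^ (n - M)) \<le> real (dyfloor n t)" by (intro of_nat_mono) simp
      then have "\<alpha> \<le> real (dyfloor n t) / 2 ^ n" unfolding al by (intro divide_right_mono) auto
      then show ?thesis using dyfloor_bounds(1)[OF t0, of n] t by auto
    qed
    have "(\<lambda>n. z (real (dyfloor n t) / 2 ^ n)) \<longlonglongrightarrow> z t"
      by (rule continuous_on_tendsto_compose[OF contz dyfloor_tendsto[OF t0] t])
         (use fl in \<open>auto simp: eventually_sequentially\<close>)
    moreover have "(\<lambda>n. z (real (dyfloor n t) / 2 ^ n)) \<longlonglongrightarrow> 0"
      using fl z_dyadic by (intro tendsto_eventually) (auto simp: eventually_sequentially)
    ultimately show ?thesis by (rule LIMSEQ_unique)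
  qed
  show ?thesis
  proof (intro exI ballI conjI)
    fix t assume t: "t \<in> {\<alpha>..\<beta>}"
    have "((\<lambda>t. W t + y \<alpha> + L * (t - \<alpha>)) has_real_derivative F t + L) (at t within {\<alpha>..\<beta>})"
      using W[OF t] by (auto intro!: derivative_eq_intros)
    then show "(x has_real_derivative F t + L) (at t within {\<alpha>..\<beta>})"
    proof (rule has_field_derivative_transform_within[OF _ zero_less_one t])
      fix s assume "s \<in> {\<alpha>..\<beta>}"
      from z0[OF this] show "W s + y \<alpha> + L * (s - \<alpha>) = x s" by (simp add: z_def y_def)
    qed
    show "((\<lambda>t. F t + L) has_real_derivative f t) (at t within {\<alpha>..\<beta>})"
      using F[OF t] by (auto intro!: derivative_eq_intros)
  qed
qed

section \<open>Velocities of the minimiser and their boundary conditions\<close>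

lemma at_within_Icc_1: "\<alpha> < t \<Longrightarrow> 0 \<le> \<alpha> \<Longrightarrow> at t within {\<alpha>..1} = at t within {0..1::real}"
  by (rule at_within_nhd[of t "{\<alpha><..}"]) auto

lemma sum_axis: "(\<Sum>j\<in>UNIV. axis i (1::real) $ j * g j) = g (i::'n::finite)"
proof -
  have "(\<Sum>j\<in>UNIV. axis i (1::real) $ j * g j) = (\<Sum>j\<in>UNIV. if j = i then g j else 0)"
    by (rule sum.cong) (auto simp: axis_def)
  then show ?thesis by simp
qed

context minimizer
begin

lemma continuous_on_dU_q:
  assumes "S \<subseteq> {0..1}" "i \<noteq> 1 \<or> 0 \<notin> S"
  shows "continuous_on S (\<lambda>t. dU i (q t))"
proof (rule continuous_on_dU[OF continuous_on_subset[OF cont_q assms(1)]])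
  show "0 < q t $ i" if "t \<in> S" for t
    using assms that by (intro q_pos) auto
qed

text \<open>Variation along \<open>axis i 1\<close> supplies the identities of
  \<open>ode_of_hat_identities\<close> with \<open>f = 2 * dU i\<close>. Only interior hats occur,
  so a single coordinate can be varied freely; for the first one the interval must stay away from
  the collision.\<close>

lemma velocity_exists_on:
  assumes \<alpha>: "\<alpha> = real a / 2 ^ M" "\<alpha> < 1" "i \<noteq> 1 \<or> 0 < \<alpha>"
  shows "\<exists>u. \<forall>t\<in>{\<alpha>..1}. ((\<lambda>t. q t $ i) has_real_derivative u t) (at t within {\<alpha>..1}) \<and>
    (u has_real_derivative 2 * dU i (q t)) (at t within {\<alpha>..1})"
proof (rule ode_of_hat_identities[OF \<alpha>(1), of _ "2 ^ M"])
  have a0: "0 \<le> \<alpha>" using \<alpha> by simp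
  show "continuous_on {\<alpha>..1} (\<lambda>t. q t $ i)" using a0 by (intro cont_q_nth) auto
  show "continuous_on {\<alpha>..1} (\<lambda>t. 2 * dU i (q t))"
    using a0 \<alpha>(3) by (intro continuous_intros continuous_on_dU_q) auto
  fix m k
  assume k: "1 \<le> k" "\<alpha> \<le> (real k - 1) / 2 ^ m" "(real k + 1) / 2 ^ m \<le> 1"
  have "real (k + 1) \<le> real (2 ^ m)" using k(3) by (simp add: divide_le_eq)
  then have k2: "k < 2 ^ m" unfolding of_nat_le_iff by simp
  have lr: "hat_left m k = (real k - 1) / 2 ^ m" "hat_right m k = (real k + 1) / 2 ^ m"
    using k a0 by (auto simp: hat_left_def hat_right_def)
  have "cross m (\<lambda>t. q t \<bullet> axis i 1) (hat m k) / 2 +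
    integral {hat_left m k..hat_right m k} (\<lambda>t. hat m k t * (\<Sum>j\<in>UNIV. axis i 1 $ j * dU j (q t))) = 0"
  proof (rule euler_lagrange_hat)
    show "0 < q t $ j" if "t \<in> {hat_left m k..hat_right m k}" "axis i (1::real) $ j \<noteq> 0" for t j
    proof (rule q_pos)
      have "\<alpha> \<le> t" "t \<le> 1" using that(1) k unfolding lr atLeastAtMost_iff by linarith+
      then show "t \<in> {0..1}" "j \<noteq> 1 \<or> t \<noteq> 0"
        using that(2) \<alpha>(3) a0 by (auto simp: axis_def split: if_splits)
    qed
  qed (use k k2 in auto)
  then have "cross m (\<lambda>t. q t $ i) (hat m k) +
    2 * integral {hat_left m k..hat_right m k} (\<lambda>t. hat m k t * dU i (q t)) = 0"
    unfolding sum_axis by (simp add: inner_axis)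
  moreover have "2 * integral {hat_left m k..hat_right m k} (\<lambda>t. hat m k t * dU i (q t))
    = integral {hat_left m k..hat_right m k} (\<lambda>t. hat m k t * (2 * dU i (q t)))"
    unfolding integral_mult_right[symmetric] by (simp add: mult.left_commute)
  ultimately show "2 ^ m * (2 * q (real k / 2 ^ m) $ i - q ((real k - 1) / 2 ^ m) $ i - q ((real k + 1) / 2 ^ m) $ i) +
    integral {(real k - 1) / 2 ^ m..(real k + 1) / 2 ^ m} (\<lambda>t. hat m k t * (2 * dU i (q t))) = 0"
    using cross_hat[of k m "\<lambda>t. q t $ i"] k k2 unfolding lr by (simp add: of_nat_diff algebra_simps)
qed (use \<alpha> in auto)

text \<open>The velocities found on the intervals \<open>{\<alpha>..1}\<close> fit together by
  uniqueness of derivatives, so \<open>u\<close> is chosen beforehand as the derivative within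
  \<open>{0..1}\<close>. For \<open>i = 1\<close> each positive time needs its own
  \<open>\<alpha>\<close> to the left of it.\<close>

lemma velocity_exists:
  obtains u where
    "\<And>t i. t \<in> {0..1} \<Longrightarrow> i \<noteq> 1 \<or> t \<noteq> 0 \<Longrightarrow> ((\<lambda>t. q t $ i) has_real_derivative u i t) (at t within {0..1})"
    "\<And>t i. t \<in> {0..1} \<Longrightarrow> i \<noteq> 1 \<or> t \<noteq> 0 \<Longrightarrow> (u i has_real_derivative 2 * dU i (q t)) (at t within {0..1})"
proof -
  define u where "u = (\<lambda>i t. vector_derivative (\<lambda>t. q t $ i) (at t within {0..1}))"
  have main: "((\<lambda>t. q t $ i) has_real_derivative u i t) (at t within {0..1}) \<and>
      (u i has_real_derivative 2 * dU i (q t)) (at t within {0..1})"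
    if t: "t \<in> {0..1}" "i \<noteq> 1 \<or> t \<noteq> 0" for t i
  proof -
    have "\<exists>a M. real a / 2 ^ M < 1 \<and> (i \<noteq> 1 \<and> a = 0 \<or> 0 < real a / 2 ^ M \<and> real a / 2 ^ M < t)"
    proof (cases "i = 1")
      case True
      then have "0 < t" using t by auto
      then obtain M where "1 / 2 ^ M < t" using real_arch_pow_inv[of t "1/2"] by (auto simp: power_divide)
      then have "real 1 / 2 ^ M < 1" "0 < real 1 / 2 ^ M" "real 1 / 2 ^ M < t"
        using t less_le_trans[of "1 / 2 ^ M" t 1] by (simp_all only: of_nat_1 atLeastAtMost_iff) auto
      then show ?thesis by blast
    qed (auto intro: exI[of _ 0])
    then obtain a M where aM: "real a / 2 ^ M < 1" "i \<noteq> 1 \<and> a = 0 \<or> 0 < real a / 2 ^ M \<and> real a / 2 ^ M < t"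
      by blast
    define \<alpha> where "\<alpha> = real a / 2 ^ M"
    have \<alpha>: "0 \<le> \<alpha>" "\<alpha> < 1" "i \<noteq> 1 \<or> 0 < \<alpha>" "\<alpha> = 0 \<or> \<alpha> < t"
      using aM by (auto simp: \<alpha>_def)
    obtain w where w: "\<And>t. t \<in> {\<alpha>..1} \<Longrightarrow> ((\<lambda>t. q t $ i) has_real_derivative w t) (at t within {\<alpha>..1})"
      "\<And>t. t \<in> {\<alpha>..1} \<Longrightarrow> (w has_real_derivative 2 * dU i (q t)) (at t within {\<alpha>..1})"
      using velocity_exists_on[OF \<alpha>_def \<alpha>(2,3)] by blast
    \<comment> \<open>At \<open>s = \<alpha> > 0\<close> the one-sided derivative within
      \<open>{\<alpha>..1}\<close> need not be a derivative within \<open>{0..1}\<close>, so this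
      point is excluded.\<close>
    have at_eq: "at s within {\<alpha>..1} = at s within {0..1}" if "\<alpha> = 0 \<or> \<alpha> < s" for s
      using at_within_Icc_1[of \<alpha> s] \<alpha> that by auto
    have wu: "w s = u i s" if "s \<in> {\<alpha>..1}" "\<alpha> = 0 \<or> \<alpha> < s" for s
      using w(1)[OF that(1)] vector_derivative_within_closed_interval[of 0 1 s "\<lambda>t. q t $ i" "w s"] that \<alpha>
      unfolding at_eq[OF that(2)] has_real_derivative_iff_has_vector_derivative u_def by simp
    have t\<alpha>: "t \<in> {\<alpha>..1}" using t \<alpha> by auto
    show ?thesis
    proof
      show "((\<lambda>t. q t $ i) has_real_derivative u i t) (at t within {0..1})"
        using w(1)[OF t\<alpha>] wu[OF t\<alpha> \<alpha>(4)] at_eq[OF \<alpha>(4)] by simp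
      have "(w has_real_derivative 2 * dU i (q t)) (at t within {0..1})"
        using w(2)[OF t\<alpha>] at_eq[OF \<alpha>(4)] by simp
      then show "(u i has_real_derivative 2 * dU i (q t)) (at t within {0..1})"
      proof (rule has_field_derivative_transform_within)
        show "0 < (if \<alpha> = 0 then 1 else t - \<alpha>)" using \<alpha> by auto
        show "w s = u i s" if "s \<in> {0..1}" "dist s t < (if \<alpha> = 0 then 1 else t - \<alpha>)" for s
          by (rule wu) (use that \<alpha> in \<open>auto simp: dist_real_def split: if_splits\<close>)
      qed (use t in auto)
    qed
  qed
  show thesis by (rule that[of u]) (use main in blast)+
qed

text \<open>A half hat at an end leaves exactly the boundary term of the integration by parts, and
  \<open>euler_lagrange_hat\<close> forces it to vanish for every direction \<open>v\<close> that
  the endpoint conditions permit. Level 1 suffices.\<close>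

lemma natural_boundary:
  fixes v :: "real ^ 3"
  assumes q': "\<And>t i. t \<in> {0..1} \<Longrightarrow> i \<noteq> 1 \<or> t \<noteq> 0 \<Longrightarrow> ((\<lambda>t. q t $ i) has_real_derivative u i t) (at t within {0..1})"
    and u': "\<And>t i. t \<in> {0..1} \<Longrightarrow> i \<noteq> 1 \<or> t \<noteq> 0 \<Longrightarrow> (u i has_real_derivative 2 * dU i (q t)) (at t within {0..1})"
  shows "v $ 1 = v $ 2 \<Longrightarrow> (\<Sum>i\<in>UNIV. v $ i * u i 1) = 0"
    and "v $ 1 = 0 \<Longrightarrow> v $ 2 = v $ 3 \<Longrightarrow> (\<Sum>i\<in>UNIV. v $ i * u i 0) = 0"
proof -
  let ?w = "\<lambda>t. q t \<bullet> v" and ?u = "\<lambda>t. \<Sum>i\<in>UNIV. v $ i * u i t" and ?f = "\<lambda>t. 2 * (\<Sum>i\<in>UNIV. v $ i * dU i (q t))"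
  have w: "(?w has_real_derivative ?u t) (at t within S)"
    if "t \<in> {0..1}" "v $ 1 = 0 \<or> t \<noteq> 0" "S \<subseteq> {0..1}" for t S
  proof -
    have "((\<lambda>t. \<Sum>i\<in>UNIV. v $ i * q t $ i) has_real_derivative ?u t) (at t within {0..1})"
    proof (rule DERIV_sum)
      show "((\<lambda>t. v $ i * q t $ i) has_real_derivative v $ i * u i t) (at t within {0..1})" for i
      \<comment> \<open>At time 0 the first coordinate has no derivative, but there the assumption
        gives \<open>v $ 1 = 0\<close>.\<close>
      proof (cases "v $ i = 0")
        case False
        then show ?thesis by (intro DERIV_cmult q') (use that in auto)
      qed simp
    qed
    then show ?thesis
      using that(3) unfolding inner_vec_def by (auto simp: mult.commute intro: DERIV_subset)
  qed
  have u: "(?u has_real_derivative ?f t) (at t within S)"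
    if "t \<in> {0..1}" "v $ 1 = 0 \<or> t \<noteq> 0" "S \<subseteq> {0..1}" for t S
  proof -
    have "(?u has_real_derivative (\<Sum>i\<in>UNIV. v $ i * (2 * dU i (q t)))) (at t within {0..1})"
    proof (rule DERIV_sum)
      show "((\<lambda>t. v $ i * u i t) has_real_derivative v $ i * (2 * dU i (q t))) (at t within {0..1})" for i
      proof (cases "v $ i = 0")
        case False
        then show ?thesis by (intro DERIV_cmult u') (use that in auto)
      qed simp
    qed
    then show ?thesis
      using that(3) by (auto simp: sum_distrib_left mult.left_commute intro: DERIV_subset)
  qed
  have half: "2 * integral S (\<lambda>t. hat m k t * (\<Sum>i\<in>UNIV. v $ i * dU i (q t))) = integral S (\<lambda>t. hat m k t * ?f t)" for S m k
    unfolding integral_mult_right[symmetric] by (simp add: mult.left_commute)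
  {
    assume v: "v $ 1 = v $ 2"
    have lr: "hat_left 1 2 = 1/2" "hat_right 1 2 = 1" by (simp_all add: hat_left_def hat_right_def)
    have "cross 1 ?w (hat 1 2) / 2 +
      integral {hat_left 1 2..hat_right 1 2} (\<lambda>t. hat 1 2 t * (\<Sum>i\<in>UNIV. v $ i * dU i (q t))) = 0"
    proof (rule euler_lagrange_hat)
      show "0 < q t $ i" if "t \<in> {hat_left 1 2..hat_right 1 2}" "v $ i \<noteq> 0" for t i
        using that unfolding lr by (intro q_pos) auto
    qed (use v in auto)
    moreover have "((\<lambda>t. hat 1 2 t * ?f t) has_integral (?u 1 - 2 * (?w 1 - ?w (1/2)))) {1/2..1}"
      using hat_rising_integral[of 2 1 ?w ?u ?f] w u by simp
    moreover have "cross 1 ?w (hat 1 2) = 2 * (?w 1 - ?w (1/2))"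
      using cross_hat[of 2 1 ?w] by simp
    ultimately show "?u 1 = 0"
      using half[of "{1/2..1}" 1 2] unfolding lr by (simp add: integral_unique diff_divide_distrib)
  next
    assume v: "v $ 1 = 0" "v $ 2 = v $ 3"
    have lr: "hat_left 1 0 = 0" "hat_right 1 0 = 1/2" by (simp_all add: hat_left_def hat_right_def)
    have "cross 1 ?w (hat 1 0) / 2 +
      integral {hat_left 1 0..hat_right 1 0} (\<lambda>t. hat 1 0 t * (\<Sum>i\<in>UNIV. v $ i * dU i (q t))) = 0"
    proof (rule euler_lagrange_hat)
      show "0 < q t $ i" if "t \<in> {hat_left 1 0..hat_right 1 0}" "v $ i \<noteq> 0" for t i
        using that v unfolding lr by (intro q_pos) auto
    qed (use v in auto)
    moreover have "((\<lambda>t. hat 1 0 t * ?f t) has_integral (2 * (?w (1/2) - ?w 0) - ?u 0)) {0..1/2}"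
      using hat_falling_integral[of 0 1 ?w ?u ?f] w u v by simp
    moreover have "cross 1 ?w (hat 1 0) = - 2 * (?w (1/2) - ?w 0)"
      using cross_hat[of 0 1 ?w] by simp
    ultimately show "?u 0 = 0"
      using half[of "{0..1/2}" 1 0] unfolding lr by (simp add: integral_unique diff_divide_distrib)
  }
qed

end

text \<open>The interface between the variational part and the regularization. The last assumptions
  say that the velocity is orthogonal to the directions left free by the endpoint conditions:
  \<open>(0,1,1)\<close> at time 0, and \<open>(1,1,0)\<close> and \<open>(0,0,1)\<close> at time
  1.\<close>

locale fundamental_arc =
  fixes q :: "real \<Rightarrow> real ^ 3" and u :: "3 \<Rightarrow> real \<Rightarrow> real"
  assumes cont: "continuous_on {0..1} q"
    and pos: "t \<in> {0..1} \<Longrightarrow> i \<noteq> 1 \<or> t \<noteq> 0 \<Longrightarrow> 0 < q t $ i"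
    and q': "t \<in> {0..1} \<Longrightarrow> i \<noteq> 1 \<or> t \<noteq> 0 \<Longrightarrow> ((\<lambda>t. q t $ i) has_real_derivative u i t) (at t within {0..1})"
    and u': "t \<in> {0..1} \<Longrightarrow> i \<noteq> 1 \<or> t \<noteq> 0 \<Longrightarrow> (u i has_real_derivative 2 * dU i (q t)) (at t within {0..1})"
    and q_left: "q 0 $ 1 = 0" "q 0 $ 2 = q 0 $ 3" and q_right: "q 1 $ 1 = q 1 $ 2"
    and u_left: "u 2 0 + u 3 0 = 0" and u_right: "u 1 1 + u 2 1 = 0" "u 3 1 = 0"

theorem fundamental_arc_exists: "\<exists>q u. fundamental_arc q u"
proof -
  obtain q \<mu> where M: "admissible q" "\<And>n. dyadic_action n q \<le> \<mu>"
    "\<And>r c. admissible r \<Longrightarrow> (\<And>n. dyadic_action n r \<le> c) \<Longrightarrow> \<mu> \<le> c"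
    using minimizer_exists by metis
  then interpret minimizer q \<mu> by (rule minimizer.intro) (use M in blast)+
  obtain u where u: "\<And>t i. t \<in> {0..1} \<Longrightarrow> i \<noteq> 1 \<or> t \<noteq> 0 \<Longrightarrow>
      ((\<lambda>t. q t $ i) has_real_derivative u i t) (at t within {0..1})"
    "\<And>t i. t \<in> {0..1} \<Longrightarrow> i \<noteq> 1 \<or> t \<noteq> 0 \<Longrightarrow>
      (u i has_real_derivative 2 * dU i (q t)) (at t within {0..1})"
    using velocity_exists by blast
  have "u 2 0 + u 3 0 = 0"
    using natural_boundary(2)[OF u, of "\<chi> i. if i = 1 then 0 else 1"] by (simp add: sum_3)
  moreover have "u 1 1 + u 2 1 = 0" "u 3 1 = 0"
    using natural_boundary(1)[OF u, of "\<chi> i. if i = 3 then 0 else 1"]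
      natural_boundary(1)[OF u, of "\<chi> i. if i = 3 then 1 else 0"] by (simp_all add: sum_3)
  ultimately have "fundamental_arc q u"
    by (intro fundamental_arc.intro) (use cont_q q_pos u q_bc in blast)+
  then show ?thesis by blast
qed

section \<open>Energy and the collision at the left endpoint\<close>

lemma potential_chain:
  assumes d: "\<And>i. ((\<lambda>t. q t $ i) has_real_derivative d i) (at t within S)" and pos: "\<And>i. 0 < q t $ i"
  shows "((\<lambda>t. potential (q t)) has_real_derivative (\<Sum>i\<in>UNIV. d i * dU i (q t))) (at t within S)"
proof -
  have s: "((\<lambda>t. 1 / (2 * q t $ i)) has_real_derivative d i * (- (1 / (2 * (q t $ i)\<^sup>2)))) (at t within S)" for i
    using pos[of i] by (auto intro!: derivative_eq_intros d simp: power2_eq_square)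
  have p: "0 < (q t $ i)\<^sup>2 + (q t $ j)\<^sup>2" for i j
    using pos[of i] by (simp add: sum_power2_gt_zero_iff)
  have "((\<lambda>t. potential (q t)) has_real_derivative
    (d 1 * (- (4 * q t$1 / sqrt ((q t$1)\<^sup>2 + (q t$2)\<^sup>2) ^ 3)) + d 2 * (- (4 * q t$2 / sqrt ((q t$2)\<^sup>2 + (q t$1)\<^sup>2) ^ 3)))
    + (d 1 * (- (4 * q t$1 / sqrt ((q t$1)\<^sup>2 + (q t$3)\<^sup>2) ^ 3)) + d 3 * (- (4 * q t$3 / sqrt ((q t$3)\<^sup>2 + (q t$1)\<^sup>2) ^ 3)))
    + (d 2 * (- (4 * q t$2 / sqrt ((q t$2)\<^sup>2 + (q t$3)\<^sup>2) ^ 3)) + d 3 * (- (4 * q t$3 / sqrt ((q t$3)\<^sup>2 + (q t$2)\<^sup>2) ^ 3)))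
    + d 1 * (- (1 / (2 * (q t$1)\<^sup>2))) + d 2 * (- (1 / (2 * (q t$2)\<^sup>2))) + d 3 * (- (1 / (2 * (q t$3)\<^sup>2)))) (at t within S)"
    unfolding potential_def by (intro DERIV_add pair_derivative s p d)
  then show ?thesis
    by (rule DERIV_cong) (simp add: sum_3 dU_simps partialU_def algebra_simps)
qed

text \<open>Euler's identity for homogeneity of degree -1, checked term by term.\<close>

lemma potential_homogeneous:
  assumes "\<And>i. 0 < x $ i"
  shows "(\<Sum>i\<in>UNIV. x $ i * dU i x) = - potential x"
proof -
  have p: "x$i * (4 * x$i / sqrt ((x$i)\<^sup>2 + (x$j)\<^sup>2) ^ 3) + x$j * (4 * x$j / sqrt ((x$j)\<^sup>2 + (x$i)\<^sup>2) ^ 3)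
    = 4 / sqrt ((x$i)\<^sup>2 + (x$j)\<^sup>2)" for i j
  proof -
    define r where "r = sqrt ((x$i)\<^sup>2 + (x$j)\<^sup>2)"
    have "0 < (x$i)\<^sup>2 + (x$j)\<^sup>2" using assms[of i] by (simp add: sum_power2_gt_zero_iff)
    then have r: "r > 0" "r * r = (x$i)\<^sup>2 + (x$j)\<^sup>2" by (simp_all add: r_def)
    have "x$i * (4 * x$i / r ^ 3) + x$j * (4 * x$j / r ^ 3) = 4 * (r * r) / r ^ 3"
      unfolding r(2) by (simp add: power2_eq_square add_divide_distrib algebra_simps)
    also have "\<dots> = 4 / r" using r(1) by (simp add: power3_eq_cube)
    finally show ?thesis by (simp only: r_def add.commute[of "(x$j)\<^sup>2"])
  qed
  have s: "x$i * (1 / (2 * (x$i)\<^sup>2)) = 1 / (2 * x$i)" for i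
    using assms[of i] by (simp add: power2_eq_square)
  show ?thesis
    unfolding sum_3 dU_simps partialU_def potential_def
    using p[of 1 2] p[of 1 3] p[of 2 3] s[of 1] s[of 2] s[of 3]
    unfolding distrib_left mult_minus_right by linarith
qed

lemma potential_pos:
  assumes "\<And>i. 0 < x $ i"
  shows "0 < potential x"
  unfolding potential_def
  by (intro add_pos_pos divide_pos_pos real_sqrt_gt_zero mult_pos_pos assms zero_less_power) auto

lemma dU_neg:
  assumes "\<And>i. 0 < x $ i"
  shows "dU i x < 0"
proof -
  have "partialU (x$i) b c < 0" for b c
  proof -
    have "0 < 1 / (2 * (x$i)\<^sup>2)" "0 \<le> 4 * x$i / sqrt ((x$i)\<^sup>2 + b\<^sup>2) ^ 3" "0 \<le> 4 * x$i / sqrt ((x$i)\<^sup>2 + c\<^sup>2) ^ 3"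
      using assms[of i] by (auto intro!: divide_nonneg_nonneg)
    then show ?thesis unfolding partialU_def by linarith
  qed
  then show ?thesis using exhaust_3[of i] by (auto simp: dU_simps)
qed

context fundamental_arc
begin

lemma pos': "0 < t \<Longrightarrow> t \<le> 1 \<Longrightarrow> 0 < q t $ i"
  by (rule pos) auto

lemma cont_nth: "continuous_on {0..1} (\<lambda>t. q t $ i)"
  by (intro continuous_intros cont)

lemma q'_at: "0 < t \<Longrightarrow> t < 1 \<Longrightarrow> ((\<lambda>t. q t $ i) has_real_derivative u i t) (at t)"
  using q'[of t i] by (simp add: at_within_Icc_at)

lemma u'_at: "0 < t \<Longrightarrow> t < 1 \<Longrightarrow> (u i has_real_derivative 2 * dU i (q t)) (at t)"
  using u'[of t i] by (simp add: at_within_Icc_at)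

lemma cont_u: "S \<subseteq> {0..1} \<Longrightarrow> i \<noteq> 1 \<or> 0 \<notin> S \<Longrightarrow> continuous_on S (u i)"
  unfolding continuous_on_eq_continuous_within
  by (intro ballI DERIV_continuous[OF DERIV_subset[OF u']]) auto

lemma energy_conserved:
  obtains E where "\<And>t. 0 < t \<Longrightarrow> t \<le> 1 \<Longrightarrow> ((u 1 t)\<^sup>2 + (u 2 t)\<^sup>2 + (u 3 t)\<^sup>2) / 4 - potential (q t) = E"
proof -
  let ?En = "\<lambda>t. ((u 1 t)\<^sup>2 + (u 2 t)\<^sup>2 + (u 3 t)\<^sup>2) / 4 - potential (q t)"
  have "\<exists>c. \<forall>t\<in>{0<..1}. ?En t = c"
  proof (rule has_field_derivative_zero_constant)
    fix t :: real assume t: "t \<in> {0<..1}"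
    have u: "(u i has_real_derivative 2 * dU i (q t)) (at t within {0<..1})" for i
      by (rule DERIV_subset[OF u']) (use t in auto)
    have "((\<lambda>t. potential (q t)) has_real_derivative (\<Sum>i\<in>UNIV. u i t * dU i (q t))) (at t within {0<..1})"
      by (rule potential_chain[OF DERIV_subset[OF q'] pos]) (use t in auto)
    then show "(?En has_real_derivative 0) (at t within {0<..1})"
      by (auto intro!: derivative_eq_intros u simp: sum_3)
  qed auto
  then show thesis using that by auto
qed

text \<open>Since \<open>q$1\<close> rises from 0 to a positive value, its velocity is positive at
  some time \<open>\<xi>\<close>; the force points to the origin, so the velocity was at least as
  large before.\<close>

lemma u1_pos: obtains \<delta> where "0 < \<delta>" "\<delta> < 1" "\<And>t. 0 < t \<Longrightarrow> t \<le> \<delta> \<Longrightarrow> 0 < u 1 t"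
proof -
  obtain l \<xi> where \<xi>: "0 < \<xi>" "\<xi> < 1" "((\<lambda>t. q t $ 1) has_real_derivative l) (at \<xi>)" "q 1 $ 1 - q 0 $ 1 = (1 - 0) * l"
    using MVT[of 0 1 "\<lambda>t. q t $ 1"] cont_nth q'_at[of _ 1] by (force simp: real_differentiable_def)
  then have "0 < u 1 \<xi>"
    using q_left pos'[of 1 1] DERIV_unique[OF q'_at[of \<xi> 1]] by auto
  have "u 1 \<xi> \<le> u 1 t" if "0 < t" "t \<le> \<xi>" for t
  proof (rule DERIV_nonpos_imp_nonincreasing[OF that(2)])
    fix x assume "t \<le> x" "x \<le> \<xi>"
    then have "0 < x" "x < 1" using that \<xi> by auto
    then show "\<exists>y. (u 1 has_real_derivative y) (at x) \<and> y \<le> 0"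
      using u'_at[of x 1] dU_neg[of "q x" 1] pos'[of x] by (intro exI[of _ "2 * dU 1 (q x)"]) force
  qed
  then show thesis using \<xi> \<open>0 < u 1 \<xi>\<close> that[of \<xi>] by force
qed

text \<open>
  If \<open>E \<ge> 0\<close>, the virial function \<open>F\<close> increases to its value 0 at time 1, so it is bounded away from 0
  near the collision, where its first term is positive and the remaining ones tend to 0.
\<close>
lemma energy_negative:
  assumes E: "\<And>t. 0 < t \<Longrightarrow> t \<le> 1 \<Longrightarrow> ((u 1 t)\<^sup>2 + (u 2 t)\<^sup>2 + (u 3 t)\<^sup>2) / 4 - potential (q t) = E"
  shows "E < 0"
proof (rule ccontr)
  assume "\<not> E < 0"
  define F where "F = (\<lambda>t. q t $ 1 * u 1 t + q t $ 2 * u 2 t + q t $ 3 * u 3 t)"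
  have F': "\<exists>y. (F has_real_derivative y) (at t) \<and> 0 < y" if t: "0 < t" "t < 1" for t
  proof (intro exI conjI)
    show "(F has_real_derivative 4 * E + 2 * potential (q t)) (at t)"
      unfolding F_def
    proof (rule DERIV_cong)
      show "((\<lambda>t. q t $ 1 * u 1 t + q t $ 2 * u 2 t + q t $ 3 * u 3 t) has_real_derivative
        (u 1 t * u 1 t + 2 * dU 1 (q t) * q t $ 1) + (u 2 t * u 2 t + 2 * dU 2 (q t) * q t $ 2)
        + (u 3 t * u 3 t + 2 * dU 3 (q t) * q t $ 3)) (at t)"
        by (intro DERIV_add DERIV_mult q'_at u'_at t)
      have "(\<Sum>i\<in>UNIV. q t $ i * dU i (q t)) = - potential (q t)"
        by (rule potential_homogeneous) (use pos'[of t] t in auto)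
      then show "(u 1 t * u 1 t + 2 * dU 1 (q t) * q t $ 1) + (u 2 t * u 2 t + 2 * dU 2 (q t) * q t $ 2)
        + (u 3 t * u 3 t + 2 * dU 3 (q t) * q t $ 3) = 4 * E + 2 * potential (q t)"
        using E[of t] t by (simp add: sum_3 power2_eq_square field_simps)
    qed
    show "0 < 4 * E + 2 * potential (q t)"
      using \<open>\<not> E < 0\<close> potential_pos[of "q t"] pos'[of t] t by (auto intro: add_nonneg_pos)
  qed
  have contF: "continuous_on {t..1} F" if "0 < t" for t
    unfolding F_def
    by (intro continuous_intros continuous_on_subset[OF cont] cont_u) (use that in auto)
  have inc: "F s < F t" if "0 < s" "s < t" "t \<le> 1" for s t
    by (rule DERIV_pos_imp_increasing_open[OF that(2)])
       (use that F' in \<open>auto intro: continuous_on_subset[OF contF[OF that(1)]]\<close>)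
  have F1: "F 1 = 0"
  proof -
    have "q 1 $ 1 * u 1 1 + q 1 $ 2 * u 2 1 = q 1 $ 1 * (u 1 1 + u 2 1)"
      using q_right by (simp add: distrib_left)
    then show ?thesis using u_right by (simp add: F_def)
  qed
  define G where "G = (\<lambda>t. q t $ 2 * u 2 t + q t $ 3 * u 3 t)"
  have "continuous_on {0..1} G"
    unfolding G_def by (intro continuous_intros cont cont_u) auto
  then have "(G \<longlongrightarrow> G 0) (at 0 within {0..1})" by (simp add: continuous_on_def)
  moreover have "G 0 = 0"
  proof -
    have "q 0 $ 2 * u 2 0 + q 0 $ 3 * u 3 0 = q 0 $ 2 * (u 2 0 + u 3 0)"
      using q_left by (simp add: distrib_left)
    then show ?thesis using u_left by (simp add: G_def)
  qed
  moreover have "F (1/2) < 0" using inc[of "1/2" 1] F1 by simp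
  ultimately have "\<forall>\<^sub>F t in at 0 within {0..1}. F (1/2) < G t"
    by (intro order_tendstoD) auto
  then obtain d where d: "d > 0" "\<And>t. t \<in> {0..1} \<Longrightarrow> t \<noteq> 0 \<Longrightarrow> dist t 0 < d \<Longrightarrow> F (1/2) < G t"
    unfolding eventually_at by blast
  obtain \<delta> where \<delta>: "0 < \<delta>" "\<delta> < 1" "\<And>t. 0 < t \<Longrightarrow> t \<le> \<delta> \<Longrightarrow> 0 < u 1 t"
    using u1_pos by blast
  define t where "t = min (d/2) (min \<delta> (1/3))"
  have t: "0 < t" "t < d" "t \<le> \<delta>" "t < 1/2" using d \<delta> by (auto simp: t_def)
  have "F (1/2) < G t" using d(2)[of t] t by auto
  moreover have "F t < F (1/2)" using inc[of t "1/2"] t by simp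
  moreover have "F t = q t $ 1 * u 1 t + G t" by (simp add: F_def G_def)
  moreover have "0 < q t $ 1 * u 1 t" using \<delta>(3)[of t] pos'[of t 1] t by simp
  ultimately show False by linarith
qed

text \<open>
  The regularized momentum \<open>P\<^sub>1 = Q\<^sub>1 q\<^sub>1'\<close>, with its limit at the collision.
\<close>
definition p1 :: "real \<Rightarrow> real" where
  "p1 t = (if t = 0 then sqrt 2 else sqrt (q t $ 1) * u 1 t)"

text \<open>By conservation of energy \<open>A\<close> is \<open>q$1 * (u 1)^2\<close> for positive
  times. The factor \<open>q$1\<close> turns the singular term \<open>2 / q$1\<close> into the
  constant 2, so \<open>A\<close> is continuous up to the collision with \<open>A 0 = 2\<close>, and
  the sign of \<open>u 1\<close> selects the positive root. The lower bound \<open>c\<close> later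
  makes the regularized time finite.\<close>

lemma p1_collision:
  assumes E: "\<And>t. 0 < t \<Longrightarrow> t \<le> 1 \<Longrightarrow> ((u 1 t)\<^sup>2 + (u 2 t)\<^sup>2 + (u 3 t)\<^sup>2) / 4 - potential (q t) = E"
  shows "continuous_on {0..1} p1"
    and "\<exists>\<delta> c. 0 < \<delta> \<and> \<delta> < 1 \<and> 0 < c \<and> (\<forall>t\<in>{0..\<delta>}. c \<le> p1 t)"
proof -
  obtain \<delta> where \<delta>: "0 < \<delta>" "\<delta> < 1" "\<And>t. 0 < t \<Longrightarrow> t \<le> \<delta> \<Longrightarrow> 0 < u 1 t"
    using u1_pos by blast
  define W where "W = (\<lambda>t. 4 / sqrt ((q t$1)\<^sup>2 + (q t$2)\<^sup>2) + 4 / sqrt ((q t$1)\<^sup>2 + (q t$3)\<^sup>2)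
    + 4 / sqrt ((q t$2)\<^sup>2 + (q t$3)\<^sup>2) + 1 / (2 * q t$2) + 1 / (2 * q t$3))"
  define A where "A = (\<lambda>t. q t $ 1 * (4 * E - (u 2 t)\<^sup>2 - (u 3 t)\<^sup>2 + 4 * W t) + 2)"
  have pos23: "q t $ 2 \<noteq> 0" "q t $ 3 \<noteq> 0" if "t \<in> {0..1}" for t
    using pos[OF that, of 2] pos[OF that, of 3] by auto
  have "continuous_on {0..1} W"
    unfolding W_def
    by (intro continuous_intros cont ballI) (use pos23 in \<open>auto simp: sum_power2_eq_zero_iff\<close>)
  then have contA: "continuous_on {0..1} A"
    unfolding A_def by (intro continuous_intros cont cont_u) auto
  have A: "A t = q t $ 1 * (u 1 t)\<^sup>2" if t: "0 < t" "t \<le> 1" for t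
  proof -
    have "potential (q t) = W t + 1 / (2 * q t $ 1)"
      by (simp add: potential_def W_def)
    then have "(u 1 t)\<^sup>2 = 4 * E - (u 2 t)\<^sup>2 - (u 3 t)\<^sup>2 + 4 * W t + 2 / q t $ 1"
      using E[OF t] by (simp add: field_simps)
    then show ?thesis
      unfolding A_def using pos'[OF t, of 1] by (simp add: distrib_left)
  qed
  have p1A: "p1 t = sqrt (A t)" if "t \<in> {0..\<delta>}" for t
  proof (cases "t = 0")
    case True
    then show ?thesis by (simp add: p1_def A_def q_left)
  next
    case False
    then show ?thesis
      using that A[of t] \<delta>(2) \<delta>(3)[of t] by (auto simp: p1_def real_sqrt_mult less_imp_le)
  qed
  have c1: "continuous_on {0..\<delta>} p1"
    by (rule continuous_on_eq[of _ "\<lambda>t. sqrt (A t)"])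
       (use \<delta> p1A in \<open>auto intro!: continuous_intros continuous_on_subset[OF contA]\<close>)
  moreover have "continuous_on {\<delta>..1} p1"
  proof (rule continuous_on_eq)
    show "continuous_on {\<delta>..1} (\<lambda>t. sqrt (q t $ 1) * u 1 t)"
      by (intro continuous_intros continuous_on_subset[OF cont] cont_u) (use \<delta> in auto)
  qed (use \<delta> in \<open>auto simp: p1_def\<close>)
  ultimately have "continuous_on ({0..\<delta>} \<union> {\<delta>..1}) p1"
    by (intro continuous_on_closed_Un) auto
  moreover have "{0..\<delta>} \<union> {\<delta>..1} = {0..1}" using \<delta> by auto
  ultimately show "continuous_on {0..1} p1" by simp
  obtain s where s: "s \<in> {0..\<delta>}" "\<forall>t\<in>{0..\<delta>}. p1 s \<le> p1 t"
    using continuous_attains_inf[OF _ _ c1] \<delta> by auto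
  have "0 < p1 s"
    using \<delta>(2) \<delta>(3)[of s] pos'[of s 1] s(1) by (cases "s = 0") (auto simp: p1_def)
  then show "\<exists>\<delta> c. 0 < \<delta> \<and> \<delta> < 1 \<and> 0 < c \<and> (\<forall>t\<in>{0..\<delta>}. c \<le> p1 t)"
    using s(2) \<delta> by blast
qed

end

section \<open>Regularized time\<close>

text \<open>Here \<open>h\<close> is the density \<open>ds/dt\<close>, unbounded at the collision.
  The nonnegative comparison function \<open>r\<close> with \<open>h \<le> r'\<close> shows that
  only a finite time \<open>s\<close> elapses from the collision on; \<open>\<tau>\<close> is the
  inverse of this time.\<close>

lemma time_change:
  fixes h r r' :: "real \<Rightarrow> real"
  assumes h: "continuous_on {0<..1} h" and hpos: "\<And>t. 0 < t \<Longrightarrow> t \<le> 1 \<Longrightarrow> 0 < h t"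
    and \<delta>: "0 < \<delta>" "\<delta> < 1"
    and r: "\<And>t. 0 < t \<Longrightarrow> t \<le> \<delta> \<Longrightarrow> (r has_real_derivative r' t) (at t)"
      "\<And>t. 0 < t \<Longrightarrow> t \<le> \<delta> \<Longrightarrow> h t \<le> r' t" "\<And>t. 0 < t \<Longrightarrow> t \<le> \<delta> \<Longrightarrow> 0 \<le> r t"
  obtains T \<tau> where "0 < T" "\<tau> 0 = 0" "\<tau> T = 1" "continuous_on {0..T} \<tau>" "\<tau> ` {0..T} \<subseteq> {0..1}"
    "\<And>s. 0 < s \<Longrightarrow> s < T \<Longrightarrow> 0 < \<tau> s \<and> \<tau> s < 1"
    "\<And>s. 0 < s \<Longrightarrow> s < T \<Longrightarrow> (\<tau> has_real_derivative 1 / h (\<tau> s)) (at s)"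
proof -
  define S where "S = (\<lambda>t. - integral {t..1} h)"
  have S_within: "(S has_real_derivative h t) (at t within {a..1})" if "0 < a" "t \<in> {a..1}" for a t
  proof -
    have "((\<lambda>t. integral {t..1} h) has_vector_derivative - h t) (at t within {a..1})"
      by (rule integral_has_vector_derivative'[OF continuous_on_subset[OF h]]) (use that in auto)
    then have "((\<lambda>t. integral {t..1} h) has_real_derivative - h t) (at t within {a..1})"
      by (simp only: has_real_derivative_iff_has_vector_derivative)
    from DERIV_minus[OF this] show ?thesis by (simp add: S_def)
  qed
  have S_at: "(S has_real_derivative h t) (at t)" if "0 < t" "t < 1" for t
    using S_within[of "t/2" t] that by (simp add: at_within_Icc_at)
  have S_cont: "continuous_on {a..1} S" if "0 < a" for a
    using S_within[OF that] by (meson DERIV_continuous continuous_on_eq_continuous_within)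
  have S_inc: "S s < S t" if "0 < s" "s < t" "t \<le> 1" for s t
  proof (rule DERIV_pos_imp_increasing_open[OF that(2)])
    show "\<exists>y. (S has_real_derivative y) (at x) \<and> 0 < y" if "s < x" "x < t" for x
      using S_at[of x] hpos[of x] that \<open>0 < s\<close> \<open>t \<le> 1\<close> by auto
    show "continuous_on {s..t} S"
      by (rule continuous_on_subset[OF S_cont[OF that(1)]]) (use that in auto)
  qed
  have S_low: "S \<delta> - r \<delta> \<le> S t" if t: "0 < t" "t \<le> 1" for t
  proof (cases "t \<le> \<delta>")
    case True
    have "S \<delta> - r \<delta> \<le> S t - r t"
    proof (rule DERIV_nonpos_imp_nonincreasing[OF True])
      fix x assume x: "t \<le> x" "x \<le> \<delta>"
      then have "((\<lambda>x. S x - r x) has_real_derivative h x - r' x) (at x)"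
        using t \<delta> by (intro DERIV_diff S_at r) auto
      then show "\<exists>y. ((\<lambda>x. S x - r x) has_real_derivative y) (at x) \<and> y \<le> 0"
        using r(2)[of x] x t by force
    qed
    then show ?thesis using r(3)[of t] True t by linarith
  next
    case False
    then show ?thesis using S_inc[of \<delta> t] r(3)[of \<delta>] \<delta> t by linarith
  qed
  \<comment> \<open>As \<open>S\<close> is increasing, this infimum is its limit at 0, and
    \<open>S t - L\<close> is the improper integral of \<open>h\<close> from 0 to
    \<open>t\<close>.\<close>
  define L where "L = Inf (S ` {0<..1})"
  have bdd: "bdd_below (S ` {0<..1})"
    by (rule bdd_belowI[of _ "S \<delta> - r \<delta>"]) (use S_low in auto)
  have L_le: "L \<le> S t" if "0 < t" "t \<le> 1" for t
    unfolding L_def by (rule cInf_lower[OF _ bdd]) (use that in auto)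
  define \<sigma> where "\<sigma> = (\<lambda>t. if t = 0 then 0 else S t - L)"
  have \<sigma>_pos: "0 < \<sigma> t" if "0 < t" "t \<le> 1" for t
    using S_inc[of "t/2" t] L_le[of "t/2"] that by (simp add: \<sigma>_def)
  have \<sigma>_inc: "\<sigma> s < \<sigma> t" if "0 \<le> s" "s < t" "t \<le> 1" for s t
    using S_inc[of s t] \<sigma>_pos[of t] that by (cases "s = 0") (auto simp: \<sigma>_def)
  have \<sigma>_at: "(\<sigma> has_real_derivative h t) (at t)" if "0 < t" "t < 1" for t
  proof (rule has_field_derivative_transform_within[of _ _ _ _ t])
    show "((\<lambda>t. S t - L) has_real_derivative h t) (at t)"
      using S_at[OF that] by (auto intro!: derivative_eq_intros)
    show "S s - L = \<sigma> s" if "dist s t < t" for s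
      using that by (auto simp: \<sigma>_def dist_real_def)
  qed (use that in auto)
  have \<sigma>_cont: "continuous_on {0..1} \<sigma>"
    unfolding continuous_on_def
  proof
    fix t :: real assume t: "t \<in> {0..1}"
    show "(\<sigma> \<longlongrightarrow> \<sigma> t) (at t within {0..1})"
    proof (cases "t = 0")
      case True
      show ?thesis
        unfolding tendsto_iff eventually_at
      proof (intro allI impI)
        fix e :: real assume "e > 0"
        then have "\<exists>x\<in>S ` {0<..1}. x < L + e"
          unfolding L_def using cInf_less_iff[OF _ bdd, of "Inf (S ` {0<..1}) + e"] by auto
        then obtain t0 where t0: "0 < t0" "t0 \<le> 1" "S t0 < L + e" by auto
        show "\<exists>d>0. \<forall>x\<in>{0..1}. x \<noteq> t \<and> dist x t < d \<longrightarrow> dist (\<sigma> x) (\<sigma> t) < e"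
        proof (intro exI[of _ t0] conjI ballI impI)
          fix x :: real assume x: "x \<in> {0..1}" "x \<noteq> t \<and> dist x t < t0"
          then have "\<sigma> x < \<sigma> t0" "0 < \<sigma> x" using True t0 by (auto intro!: \<sigma>_inc \<sigma>_pos simp: dist_real_def)
          then show "dist (\<sigma> x) (\<sigma> t) < e"
            using t0 True by (auto simp: dist_real_def \<sigma>_def split: if_splits)
        qed (use t0 in auto)
      qed
    next
      case False
      then have t0: "0 < t" using t by auto
      have "continuous_on {t/2..1} \<sigma>"
        by (rule continuous_on_eq[of _ "\<lambda>t. S t - L"])
           (use t0 in \<open>auto intro!: continuous_intros S_cont simp: \<sigma>_def\<close>)
      then have "(\<sigma> \<longlongrightarrow> \<sigma> t) (at t within {t/2..1})"
        using t t0 by (simp add: continuous_on_def)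
      then show ?thesis using at_within_Icc_1[of "t/2" t] t0 by simp
    qed
  qed
  define T where "T = \<sigma> 1"
  have T: "0 < T" unfolding T_def by (rule \<sigma>_pos) auto
  have \<sigma>_inj: "inj_on \<sigma> {0..1}"
  proof (rule inj_onI)
    fix x y assume "x \<in> {0..1}" "y \<in> {0..1}" "\<sigma> x = \<sigma> y"
    then show "x = y" using \<sigma>_inc[of x y] \<sigma>_inc[of y x] by (cases x y rule: linorder_cases) auto
  qed
  have \<sigma>0: "\<sigma> 0 = 0" by (simp add: \<sigma>_def)
  have \<sigma>_img: "\<sigma> ` {0..1} = {0..T}"
  proof
    show "\<sigma> ` {0..1} \<subseteq> {0..T}"
    proof
      fix y assume "y \<in> \<sigma> ` {0..1}"
      then obtain x where x: "0 \<le> x" "x \<le> 1" "y = \<sigma> x" by auto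
      have "0 \<le> \<sigma> x" using \<sigma>_pos[of x] \<sigma>0 x by (cases "x = 0") auto
      moreover have "\<sigma> x \<le> T" using \<sigma>_inc[of x 1] x by (cases "x = 1") (auto simp: T_def)
      ultimately show "y \<in> {0..T}" using x by simp
    qed
    show "{0..T} \<subseteq> \<sigma> ` {0..1}"
    proof
      fix y assume "y \<in> {0..T}"
      then show "y \<in> \<sigma> ` {0..1}"
        using IVT'[of \<sigma> 0 y 1] \<sigma>_cont \<sigma>0 by (auto simp: T_def)
    qed
  qed
  define \<tau> where "\<tau> = inv_into {0..1} \<sigma>"
  have \<tau>\<sigma>: "\<tau> (\<sigma> t) = t" if "t \<in> {0..1}" for t
    unfolding \<tau>_def by (rule inv_into_f_f[OF \<sigma>_inj that])
  have \<sigma>\<tau>: "\<sigma> (\<tau> s) = s" if "s \<in> {0..T}" for s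
    unfolding \<tau>_def by (rule f_inv_into_f) (use that \<sigma>_img in auto)
  have \<tau>_in: "\<tau> s \<in> {0..1}" if "s \<in> {0..T}" for s
    unfolding \<tau>_def by (rule inv_into_into) (use that \<sigma>_img in auto)
  have \<tau>_cont: "continuous_on {0..T} \<tau>"
    using continuous_on_inv[OF \<sigma>_cont, of \<tau>] \<tau>\<sigma> unfolding \<sigma>_img by auto
  have \<tau>_inner: "0 < \<tau> s \<and> \<tau> s < 1" if s: "0 < s" "s < T" for s
  proof -
    have "\<tau> s \<noteq> 0" "\<tau> s \<noteq> 1" using \<sigma>\<tau>[of s] s \<sigma>0 by (auto simp: T_def)
    then show ?thesis using \<tau>_in[of s] s by auto
  qed
  show thesis
  proof (rule that[OF T, of \<tau>])
    show "\<tau> 0 = 0" using \<tau>\<sigma>[of 0] \<sigma>0 by simp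
    show "\<tau> T = 1" using \<tau>\<sigma>[of 1] by (simp add: T_def)
    show "\<tau> ` {0..T} \<subseteq> {0..1}" using \<tau>_in by auto
    show "(\<tau> has_real_derivative 1 / h (\<tau> s)) (at s)" if s: "0 < s" "s < T" for s
    proof -
      have "(\<tau> has_real_derivative inverse (h (\<tau> s))) (at s)"
      proof (rule DERIV_inverse_function[OF \<sigma>_at _ s])
        show "0 < \<tau> s" "\<tau> s < 1" "h (\<tau> s) \<noteq> 0" using \<tau>_inner[OF s] hpos[of "\<tau> s"] by auto
        show "\<sigma> (\<tau> y) = y" if "0 < y" "y < T" for y using \<sigma>\<tau> that by auto
        show "isCont \<tau> s"
          using continuous_on_interior[OF \<tau>_cont] s by simp
      qed
      then show ?thesis by (simp add: inverse_eq_divide)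
    qed
  qed (use \<tau>_cont \<tau>_inner in auto)
qed

section \<open>Partial derivatives of the regularized Hamiltonian\<close>

lemma has_vector_derivative_vecI:
  fixes f :: "real \<Rightarrow> real ^ 'n"
  assumes "\<And>i. ((\<lambda>t. f t $ i) has_real_derivative f' $ i) (at a within S)"
  shows "(f has_vector_derivative f') (at a within S)"
  unfolding has_vector_derivative_def has_derivative_componentwise_within[of f]
proof
  fix b :: "real ^ 'n" assume "b \<in> Basis"
  then obtain i where b: "b = axis i 1" by (auto simp: Basis_vec_def)
  show "((\<lambda>x. f x \<bullet> b) has_derivative (\<lambda>x. (x *\<^sub>R f') \<bullet> b)) (at a within S)"
    using assms[of i] unfolding has_field_derivative_def b
    by (simp add: inner_axis mult_commute_abs)
qed

text \<open>The derivative of \<open>Gam\<close> in the coordinate \<open>a\<close>, where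
  \<open>y\<close> and \<open>z\<close> are the momenta of \<open>b\<close> and \<open>c\<close>.
  The derivative of \<open>a^2 / sqrt (a^4 + b^4)\<close> is contracted to
  \<open>2 * a * b^4 / sqrt (a^4 + b^4) ^ 3\<close>, whence the sixth powers.\<close>

definition partialGam :: "real \<Rightarrow> real \<Rightarrow> real \<Rightarrow> real \<Rightarrow> real \<Rightarrow> real \<Rightarrow> real" where
  "partialGam E a b c y z = a * (y\<^sup>2 * c\<^sup>2 + b\<^sup>2 * z\<^sup>2) / 2
     - 8 * a * b ^ 6 * c\<^sup>2 / sqrt (a ^ 4 + b ^ 4) ^ 3 - 8 * a * c ^ 6 * b\<^sup>2 / sqrt (a ^ 4 + c ^ 4) ^ 3
     - 8 * a * b\<^sup>2 * c\<^sup>2 / sqrt (b ^ 4 + c ^ 4) - a * (b\<^sup>2 + c\<^sup>2) - 2 * E * a * b\<^sup>2 * c\<^sup>2"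

definition dGam_dQ :: "real \<Rightarrow> real ^ 3 \<Rightarrow> real ^ 3 \<Rightarrow> real ^ 3" where
  "dGam_dQ E Q P = (\<chi> i. if i = 1 then partialGam E (Q$1) (Q$2) (Q$3) (P$2) (P$3)
     else if i = 2 then partialGam E (Q$2) (Q$1) (Q$3) (P$1) (P$3)
     else partialGam E (Q$3) (Q$1) (Q$2) (P$1) (P$2))"

definition dGam_dP :: "real ^ 3 \<Rightarrow> real ^ 3 \<Rightarrow> real ^ 3" where
  "dGam_dP Q P = (\<chi> i. if i = 1 then P$1 * (Q$2)\<^sup>2 * (Q$3)\<^sup>2 / 2
     else if i = 2 then P$2 * (Q$1)\<^sup>2 * (Q$3)\<^sup>2 / 2
     else P$3 * (Q$1)\<^sup>2 * (Q$2)\<^sup>2 / 2)"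

lemma dGam_nth:
  "dGam_dQ E Q P $ 1 = partialGam E (Q$1) (Q$2) (Q$3) (P$2) (P$3)"
  "dGam_dQ E Q P $ 2 = partialGam E (Q$2) (Q$1) (Q$3) (P$1) (P$3)"
  "dGam_dQ E Q P $ 3 = partialGam E (Q$3) (Q$1) (Q$2) (P$1) (P$2)"
  "dGam_dP Q P $ 1 = P$1 * (Q$2)\<^sup>2 * (Q$3)\<^sup>2 / 2"
  "dGam_dP Q P $ 2 = P$2 * (Q$1)\<^sup>2 * (Q$3)\<^sup>2 / 2"
  "dGam_dP Q P $ 3 = P$3 * (Q$1)\<^sup>2 * (Q$2)\<^sup>2 / 2"
  by (simp_all add: dGam_dQ_def dGam_dP_def)

definition Gam3 :: "real \<Rightarrow> real \<Rightarrow> real \<Rightarrow> real \<Rightarrow> real \<Rightarrow> real \<Rightarrow> real \<Rightarrow> real" where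
  "Gam3 E a b c x y z = (x\<^sup>2 * b\<^sup>2 * c\<^sup>2 + a\<^sup>2 * y\<^sup>2 * c\<^sup>2 + a\<^sup>2 * b\<^sup>2 * z\<^sup>2) / 4
     - 4 * a\<^sup>2 * b\<^sup>2 * c\<^sup>2 * (1 / sqrt (a ^ 4 + b ^ 4) + 1 / sqrt (a ^ 4 + c ^ 4) + 1 / sqrt (b ^ 4 + c ^ 4))
     - (b\<^sup>2 * c\<^sup>2 + a\<^sup>2 * c\<^sup>2 + a\<^sup>2 * b\<^sup>2) / 2 - E * a\<^sup>2 * b\<^sup>2 * c\<^sup>2"

lemma Gam_eq_Gam3: "Gam E Q P = Gam3 E (Q$1) (Q$2) (Q$3) (P$1) (P$2) (P$3)"
  by (simp add: Gam_def Gam3_def algebra_simps)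

lemma Gam3_swap: "Gam3 E b a c y x z = Gam3 E a b c x y z" "Gam3 E c a b z x y = Gam3 E a b c x y z"
  by (simp_all add: Gam3_def add.commute mult.commute mult.left_commute algebra_simps)

text \<open>Since \<open>\<Gamma> = dt/ds (H - E)\<close>, on the level set \<open>\<Gamma> = 0\<close> its gradient is \<open>dt/ds\<close> times that of \<open>H\<close>.\<close>
lemma partialGam_on_level_set:
  assumes a: "0 < a" and bc: "0 < b" "0 < c" and G: "Gam3 E a b c (a * u) y z = 0"
  shows "- partialGam E a b c y z = a * u\<^sup>2 * b\<^sup>2 * c\<^sup>2 / 2 + 2 * a ^ 3 * b\<^sup>2 * c\<^sup>2 * partialU (a\<^sup>2) (b\<^sup>2) (c\<^sup>2)"
proof -
  have pair: "1 / sqrt (a ^ 4 + d ^ 4) - d ^ 4 / sqrt (a ^ 4 + d ^ 4) ^ 3 = a ^ 4 / sqrt (a ^ 4 + d ^ 4) ^ 3"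
    if "0 < d" for d
  proof -
    define R where "R = sqrt (a ^ 4 + d ^ 4)"
    have "0 < a ^ 4 + d ^ 4" using a by (intro add_pos_nonneg) auto
    then have R: "R > 0" "R * R = a ^ 4 + d ^ 4" by (simp_all add: R_def)
    have "1 / R = (R * R) / R ^ 3" using R(1) by (simp add: power3_eq_cube)
    also have "\<dots> = a ^ 4 / R ^ 3 + d ^ 4 / R ^ 3" unfolding R(2) by (rule add_divide_distrib)
    finally show ?thesis by (simp add: R_def)
  qed
  define R1 R2 R3 where "R1 = 1 / sqrt (a ^ 4 + b ^ 4)" and "R2 = 1 / sqrt (a ^ 4 + c ^ 4)"
    and "R3 = 1 / sqrt (b ^ 4 + c ^ 4)"
  define S1 S2 where "S1 = 1 / sqrt (a ^ 4 + b ^ 4) ^ 3" and "S2 = 1 / sqrt (a ^ 4 + c ^ 4) ^ 3"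
  have R: "R1 = b ^ 4 * S1 + a ^ 4 * S1" "R2 = c ^ 4 * S2 + a ^ 4 * S2"
    using pair[of b] pair[of c] bc by (simp_all add: R1_def R2_def S1_def S2_def algebra_simps)
  have part: "partialGam E a b c y z = a * (y\<^sup>2 * c\<^sup>2 + b\<^sup>2 * z\<^sup>2) / 2
     - 8 * a * b ^ 6 * c\<^sup>2 * S1 - 8 * a * c ^ 6 * b\<^sup>2 * S2
     - 8 * a * b\<^sup>2 * c\<^sup>2 * R3 - a * (b\<^sup>2 + c\<^sup>2) - 2 * E * a * b\<^sup>2 * c\<^sup>2"
    by (simp add: partialGam_def S1_def S2_def R3_def)
  have U: "partialU (a\<^sup>2) (b\<^sup>2) (c\<^sup>2) = - (4 * a\<^sup>2 * S1 + 4 * a\<^sup>2 * S2 + 1 / (2 * a ^ 4))"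
    by (simp add: partialU_def S1_def S2_def)
  have G': "((a * u)\<^sup>2 * b\<^sup>2 * c\<^sup>2 + a\<^sup>2 * y\<^sup>2 * c\<^sup>2 + a\<^sup>2 * b\<^sup>2 * z\<^sup>2) / 4
     - 4 * a\<^sup>2 * b\<^sup>2 * c\<^sup>2 * ((b ^ 4 * S1 + a ^ 4 * S1) + (c ^ 4 * S2 + a ^ 4 * S2) + R3)
     - (b\<^sup>2 * c\<^sup>2 + a\<^sup>2 * c\<^sup>2 + a\<^sup>2 * b\<^sup>2) / 2 - E * a\<^sup>2 * b\<^sup>2 * c\<^sup>2 = 0"
    using G unfolding Gam3_def R1_def[symmetric] R2_def[symmetric] R3_def[symmetric] R .
  have inv: "2 * a ^ 3 * b\<^sup>2 * c\<^sup>2 * (1 / (2 * a ^ 4)) * a = b\<^sup>2 * c\<^sup>2"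
    using a by (simp add: power_eq_if[of a] numeral_eq_Suc)
  \<comment> \<open>After multiplication by \<open>a\<close>, adding twice the level-set relation to
    the left side eliminates \<open>E\<close>, \<open>y\<close>, \<open>z\<close> and
    \<open>R3\<close>.\<close>
  have "a * (- partialGam E a b c y z) = a * (a * u\<^sup>2 * b\<^sup>2 * c\<^sup>2 / 2 + 2 * a ^ 3 * b\<^sup>2 * c\<^sup>2 * partialU (a\<^sup>2) (b\<^sup>2) (c\<^sup>2))"
  proof -
    have "a * (a * u\<^sup>2 * b\<^sup>2 * c\<^sup>2 / 2 + 2 * a ^ 3 * b\<^sup>2 * c\<^sup>2 * partialU (a\<^sup>2) (b\<^sup>2) (c\<^sup>2))
      = a\<^sup>2 * u\<^sup>2 * b\<^sup>2 * c\<^sup>2 / 2 - 8 * a ^ 6 * b\<^sup>2 * c\<^sup>2 * (S1 + S2) - 2 * a ^ 3 * b\<^sup>2 * c\<^sup>2 * (1 / (2 * a ^ 4)) * a"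
      unfolding U by (simp add: algebra_simps power_numeral_reduce)
    also have "\<dots> = a\<^sup>2 * u\<^sup>2 * b\<^sup>2 * c\<^sup>2 / 2 - 8 * a ^ 6 * b\<^sup>2 * c\<^sup>2 * (S1 + S2) - b\<^sup>2 * c\<^sup>2"
      unfolding inv ..
    also have "\<dots> = a * (- partialGam E a b c y z)"
    proof -
      have "a * (- partialGam E a b c y z) + 2 * (((a * u)\<^sup>2 * b\<^sup>2 * c\<^sup>2 + a\<^sup>2 * y\<^sup>2 * c\<^sup>2 + a\<^sup>2 * b\<^sup>2 * z\<^sup>2) / 4
       - 4 * a\<^sup>2 * b\<^sup>2 * c\<^sup>2 * ((b ^ 4 * S1 + a ^ 4 * S1) + (c ^ 4 * S2 + a ^ 4 * S2) + R3)
       - (b\<^sup>2 * c\<^sup>2 + a\<^sup>2 * c\<^sup>2 + a\<^sup>2 * b\<^sup>2) / 2 - E * a\<^sup>2 * b\<^sup>2 * c\<^sup>2)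
       = a\<^sup>2 * u\<^sup>2 * b\<^sup>2 * c\<^sup>2 / 2 - 8 * a ^ 6 * b\<^sup>2 * c\<^sup>2 * (S1 + S2) - b\<^sup>2 * c\<^sup>2"
        unfolding part by (simp add: field_simps power_numeral_reduce)
      then show ?thesis unfolding G' by simp
    qed
    finally show ?thesis ..
  qed
  then show ?thesis
    unfolding mult_left_cancel[OF less_imp_neq[OF a, symmetric]] .
qed

text \<open>By the fundamental theorem \<open>X\<close> is an integral of the continuous
  \<open>G\<close>, and hence has one-sided derivatives at the ends too. This carries the equations
  of motion to the collision.\<close>

lemma vector_derivative_at_endpoints:
  fixes X G :: "real \<Rightarrow> 'a::euclidean_space"
  assumes X: "continuous_on {0..T} X" and G: "continuous_on {0..T} G"
    and inner: "\<And>s. 0 < s \<Longrightarrow> s < T \<Longrightarrow> (X has_vector_derivative G s) (at s)"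
    and s: "s \<in> {0..T}"
  shows "(X has_vector_derivative G s) (at s within {0..T})"
proof -
  have X_eq: "X 0 + integral {0..r} G = X r" if "r \<in> {0..T}" for r
  proof -
    have "(G has_integral (X r - X 0)) {0..r}"
      by (rule fundamental_theorem_of_calculus_interior)
         (use that inner continuous_on_subset[OF X] in auto)
    then show ?thesis by (simp add: integral_unique)
  qed
  have "((\<lambda>r. X 0 + integral {0..r} G) has_vector_derivative G s) (at s within {0..T})"
    using integral_has_vector_derivative[OF G s] by (auto intro!: derivative_eq_intros)
  then show ?thesis
    by (rule has_vector_derivative_transform[OF s, rotated]) (use X_eq in auto)
qed

lemma continuous_on_partialGam [continuous_intros]:
  assumes "continuous_on S a" "continuous_on S b" "continuous_on S c" "continuous_on S y" "continuous_on S z"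
    and "\<And>s. s \<in> S \<Longrightarrow> a s \<noteq> 0 \<or> b s \<noteq> 0" "\<And>s. s \<in> S \<Longrightarrow> a s \<noteq> 0 \<or> c s \<noteq> 0" "\<And>s. s \<in> S \<Longrightarrow> b s \<noteq> 0 \<or> c s \<noteq> 0"
  shows "continuous_on S (\<lambda>s. partialGam E (a s) (b s) (c s) (y s) (z s))"
proof -
  have nz: "u ^ 4 + v ^ 4 \<noteq> 0" if "u \<noteq> 0 \<or> v \<noteq> 0" for u v :: real
  proof -
    have "0 \<le> u ^ 4" "0 \<le> v ^ 4" by auto
    then show ?thesis using that by (auto simp: add_nonneg_eq_0_iff)
  qed
  show ?thesis
    unfolding partialGam_def
    by (intro continuous_intros assms(1-5) ballI) (use assms(6-8) nz in auto)
qed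

section \<open>The arc in regularized coordinates\<close>

context fundamental_arc
begin

text \<open>Near the collision \<open>sqrt (q$1) * u 1 \<ge> c\<close>, and
  \<open>q$2 * q$3 \<ge> b\<close> throughout. Therefore the derivative of
  \<open>2 / (c * b) * sqrt (q$1)\<close> is at least \<open>1 / (b * q$1)\<close>, which dominates
  \<open>1 / (q$1 * q$2 * q$3)\<close>.\<close>

lemma time_exists:
  assumes E: "\<And>t. 0 < t \<Longrightarrow> t \<le> 1 \<Longrightarrow> ((u 1 t)\<^sup>2 + (u 2 t)\<^sup>2 + (u 3 t)\<^sup>2) / 4 - potential (q t) = E"
  obtains T \<tau> where "0 < T" "\<tau> 0 = 0" "\<tau> T = 1" "continuous_on {0..T} \<tau>" "\<tau> ` {0..T} \<subseteq> {0..1}"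
    "\<And>s. 0 < s \<Longrightarrow> s < T \<Longrightarrow> 0 < \<tau> s \<and> \<tau> s < 1"
    "\<And>s. 0 < s \<Longrightarrow> s < T \<Longrightarrow> (\<tau> has_real_derivative q (\<tau> s) $ 1 * q (\<tau> s) $ 2 * q (\<tau> s) $ 3) (at s)"
proof -
  obtain \<delta> c where \<delta>: "0 < \<delta>" "\<delta> < 1" "0 < c" "\<And>t. t \<in> {0..\<delta>} \<Longrightarrow> c \<le> p1 t"
    using p1_collision(2)[OF E] by blast
  have c23: "continuous_on {0..1} (\<lambda>t. q t $ 2 * q t $ 3)"
    by (intro continuous_intros cont)
  obtain s where s: "s \<in> {0..1}" "\<And>t. t \<in> {0..1} \<Longrightarrow> q s $ 2 * q s $ 3 \<le> q t $ 2 * q t $ 3"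
    using continuous_attains_inf[OF _ _ c23] by auto
  define b where "b = q s $ 2 * q s $ 3"
  have b: "0 < b" using pos[OF s(1)] by (simp add: b_def)
  define h where "h = (\<lambda>t. 1 / (q t $ 1 * q t $ 2 * q t $ 3))"
  have h_pos: "0 < h t" if "0 < t" "t \<le> 1" for t
    using pos'[OF that] by (simp add: h_def)
  have h_cont: "continuous_on {0<..1} h"
    unfolding h_def
  proof (intro continuous_intros continuous_on_subset[OF cont] ballI)
    show "q t $ 1 * q t $ 2 * q t $ 3 \<noteq> 0" if "t \<in> {0<..1}" for t
      using pos'[of t 1] pos'[of t 2] pos'[of t 3] that by auto
  qed auto
  let ?r = "\<lambda>t. 2 / (c * b) * sqrt (q t $ 1)" and ?r' = "\<lambda>t. 2 / (c * b) * (u 1 t * (inverse (sqrt (q t $ 1)) / 2))"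
  have r: "(?r has_real_derivative ?r' t) (at t)" if "0 < t" "t \<le> \<delta>" for t
  proof (intro DERIV_cmult)
    have "(sqrt has_real_derivative inverse (sqrt (q t $ 1)) / 2) (at (q t $ 1))"
      using pos'[of t 1] that \<delta> by (intro DERIV_real_sqrt) auto
    from DERIV_chain2[OF this q'_at[of t 1]] that \<delta>
    show "((\<lambda>t. sqrt (q t $ 1)) has_real_derivative u 1 t * (inverse (sqrt (q t $ 1)) / 2)) (at t)"
      by (simp add: mult.commute)
  qed
  have le: "h t \<le> ?r' t" if t: "0 < t" "t \<le> \<delta>" for t
  proof -
    define x where "x = sqrt (q t $ 1)"
    have x: "0 < x" "x * x = q t $ 1" using pos'[of t 1] t \<delta> by (auto simp: x_def)
    have qt: "b \<le> q t $ 2 * q t $ 3" using s(2)[of t] t \<delta> by (auto simp: b_def)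
    have "c \<le> x * u 1 t" using \<delta>(4)[of t] t by (simp add: p1_def x_def)
    then have "c / (c * b * (x * x)) \<le> x * u 1 t / (c * b * (x * x))"
      using x(1) b \<delta>(3) by (intro divide_right_mono) auto
    then have "1 / (b * (x * x)) \<le> 2 / (c * b) * (u 1 t * (inverse x / 2))"
      using x(1) b \<delta>(3) by (simp add: field_simps)
    moreover have "h t \<le> 1 / (b * (x * x))"
      unfolding h_def x(2)
    proof (rule divide_left_mono)
      have "b * q t $ 1 \<le> (q t $ 2 * q t $ 3) * q t $ 1"
        using qt pos'[of t 1] t \<delta> by (intro mult_right_mono) auto
      then show "b * q t $ 1 \<le> q t $ 1 * q t $ 2 * q t $ 3" by (simp add: mult_ac)
    qed (use b pos'[of t] t \<delta> in auto)
    ultimately show ?thesis by (simp add: x_def)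
  qed
  have r0: "0 \<le> ?r t" if "0 < t" "t \<le> \<delta>" for t
    using pos'[of t 1] that \<delta> b by auto
  show thesis
  proof (rule time_change[OF h_cont h_pos \<delta>(1,2) r le r0])
    fix T \<tau>
    assume \<tau>: "0 < T" "\<tau> 0 = 0" "\<tau> T = 1" "continuous_on {0..T} \<tau>" "\<tau> ` {0..T} \<subseteq> {0..1}"
      "\<And>s. 0 < s \<Longrightarrow> s < T \<Longrightarrow> 0 < \<tau> s \<and> \<tau> s < 1"
      "\<And>s. 0 < s \<Longrightarrow> s < T \<Longrightarrow> (\<tau> has_real_derivative 1 / h (\<tau> s)) (at s)"
    show thesis
      by (rule that[OF \<tau>(1-6)]) (use \<tau>(7) in \<open>simp_all add: h_def\<close>)
  qed
qed

text \<open>With \<open>Q$i = sqrt (q$i)\<close> and \<open>p = q' / 2\<close>, the substitution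
  gives \<open>P$i = 2 * Q$i * p$i = Q$i * u i\<close>. The equations are computed at interior
  times, where no coordinate vanishes, and extended to the ends by continuity of both sides.\<close>

lemma regularized_arc:
  obtains E T Q P where "E < 0" "0 < T"
    "\<And>s. s \<in> {0..T} \<Longrightarrow> (Q has_vector_derivative dGam_dP (Q s) (P s)) (at s within {0..T})"
    "\<And>s. s \<in> {0..T} \<Longrightarrow> (P has_vector_derivative - dGam_dQ E (Q s) (P s)) (at s within {0..T})"
    "\<And>s. s \<in> {0..T} \<Longrightarrow> Q s \<in> regularized_domain" "\<And>s. s \<in> {0..T} \<Longrightarrow> Gam E (Q s) (P s) = 0"
    "0 < Q T $ 1" "Q 0 $ 1 = 0" "Q 0 $ 2 = Q 0 $ 3" "P 0 $ 2 = - P 0 $ 3"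
    "Q T $ 1 = Q T $ 2" "P T $ 1 = - P T $ 2" "P T $ 3 = 0"
proof -
  obtain E where E: "\<And>t. 0 < t \<Longrightarrow> t \<le> 1 \<Longrightarrow> ((u 1 t)\<^sup>2 + (u 2 t)\<^sup>2 + (u 3 t)\<^sup>2) / 4 - potential (q t) = E"
    using energy_conserved by blast
  have E0: "E < 0" by (rule energy_negative[OF E])
  obtain T \<tau> where T: "0 < T" and \<tau>0: "\<tau> 0 = 0" and \<tau>T: "\<tau> T = 1" and \<tau>c: "continuous_on {0..T} \<tau>"
    and \<tau>img: "\<tau> ` {0..T} \<subseteq> {0..1}"
    and \<tau>in: "\<And>s. 0 < s \<Longrightarrow> s < T \<Longrightarrow> 0 < \<tau> s \<and> \<tau> s < 1"
    and \<tau>': "\<And>s. 0 < s \<Longrightarrow> s < T \<Longrightarrow> (\<tau> has_real_derivative q (\<tau> s) $ 1 * q (\<tau> s) $ 2 * q (\<tau> s) $ 3) (at s)"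
    using time_exists[OF E] by blast
  define \<pi> where "\<pi> = (\<lambda>i t. if i = 1 then p1 t else sqrt (q t $ i) * u i t)"
  define Q :: "real \<Rightarrow> real ^ 3" where "Q = (\<lambda>s. \<chi> i. sqrt (q (\<tau> s) $ i))"
  define P :: "real \<Rightarrow> real ^ 3" where "P = (\<lambda>s. \<chi> i. \<pi> i (\<tau> s))"
  have Qn: "Q s $ i = sqrt (q (\<tau> s) $ i)" and Pn: "P s $ i = \<pi> i (\<tau> s)" for s i
    by (simp_all add: Q_def P_def)
  have \<pi>_pos: "\<pi> i t = sqrt (q t $ i) * u i t" if "0 < t" for i t
    using that by (simp add: \<pi>_def p1_def)
  have Q_pos: "0 < Q s $ i" if "s \<in> {0..T}" "i \<noteq> 1 \<or> \<tau> s \<noteq> 0" for s i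
  proof -
    have "\<tau> s \<in> {0..1}" using \<tau>img that(1) by blast
    then show ?thesis unfolding Qn using pos[of "\<tau> s" i] that(2) by simp
  qed
  have Q_cont: "continuous_on {0..T} (\<lambda>s. Q s $ i)" for i
    unfolding Qn
    by (intro continuous_intros continuous_on_compose2[OF cont_nth \<tau>c \<tau>img])
  have P_cont: "continuous_on {0..T} (\<lambda>s. P s $ i)" for i
    unfolding Pn
  proof (rule continuous_on_compose2[OF _ \<tau>c \<tau>img])
    show "continuous_on {0..1} (\<pi> i)"
      unfolding \<pi>_def using p1_collision(1)[OF E]
      by (cases "i = 1") (auto intro!: continuous_intros cont cont_u)
  qed
  have Gam0: "Gam E (Q s) (P s) = 0" if s: "s \<in> {0..T}" for s
  proof (cases "\<tau> s = 0")
    case True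
    \<comment> \<open>At \<open>Q$1 = 0\<close> the Hamiltonian reduces to
      \<open>(P$1^2 / 4 - 1/2) * Q$2^2 * Q$3^2\<close>, which the limit \<open>sqrt 2\<close> of
      \<open>P$1\<close> annihilates.\<close>
    have "Gam3 E 0 b c (sqrt 2) y z = 0" for b c y z
      by (simp add: Gam3_def)
    then show ?thesis
      unfolding Gam_eq_Gam3 using True q_left by (simp add: Qn Pn \<pi>_def p1_def)
  next
    case False
    then have t: "0 < \<tau> s" "\<tau> s \<le> 1" using \<tau>img s by force+
    have v: "(\<chi> i. (Q s $ i)\<^sup>2) = q (\<tau> s)"
      using pos'[OF t] by (simp add: vec_eq_iff Qn less_imp_le)
    have w: "(\<chi> i. P s $ i / (2 * Q s $ i)) = (\<chi> i. u i (\<tau> s) / 2)"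
      using pos'[OF t] by (simp add: vec_eq_iff Qn Pn \<pi>_pos[OF t(1)] less_imp_neq[symmetric])
    have k: "kinetic (\<chi> i. u i (\<tau> s) / 2) = ((u 1 (\<tau> s))\<^sup>2 + (u 2 (\<tau> s))\<^sup>2 + (u 3 (\<tau> s))\<^sup>2) / 4"
      by (simp add: kinetic_def power_divide add_divide_distrib)
    have nz: "Q s $ i \<noteq> 0" for i using Q_pos[OF s, of i] False by simp
    show ?thesis
      unfolding Gam_eq_octahedral_H[OF nz] v w octahedral_H_def k using E[OF t] by simp
  qed
  have dom: "Q s \<in> regularized_domain" if s: "s \<in> {0..T}" for s
  proof -
    have nz: "Q s $ i \<noteq> 0" if "i \<noteq> 1" for i using Q_pos[OF s, of i] that by simp
    have "Q s $ i \<noteq> 0 \<or> Q s $ j \<noteq> 0" if "i \<noteq> j" for i j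
      using nz[of i] nz[of j] that by (cases "i = 1") auto
    then show ?thesis by (simp add: regularized_domain_def)
  qed
  have Q': "((\<lambda>s. Q s $ i) has_real_derivative dGam_dP (Q s) (P s) $ i) (at s)"
    and P': "((\<lambda>s. P s $ i) has_real_derivative (- dGam_dQ E (Q s) (P s)) $ i) (at s)"
    if s: "0 < s" "s < T" for s i
  proof -
    define t where "t = \<tau> s"
    have t: "0 < t" "t < 1" "t \<le> 1" using \<tau>in[OF s] by (auto simp: t_def)
    define a where "a = (\<lambda>i. sqrt (q t $ i))"
    have a: "0 < a i" "a i * a i = q t $ i" "(a i)\<^sup>2 = q t $ i" for i
      using pos'[OF t(1,3), of i] by (auto simp: a_def)
    have aQ: "Q s $ i = a i" "P s $ i = a i * u i t" for i
      using \<pi>_pos[OF t(1)] by (auto simp: a_def t_def Qn Pn)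
    have sq: "((\<lambda>t. sqrt (q t $ i)) has_real_derivative inverse (a i) / 2 * u i t) (at t)"
      unfolding a_def using pos'[OF t(1,3)] by (intro DERIV_chain2[OF DERIV_real_sqrt q'_at] t)
    let ?g = "q t $ 1 * q t $ 2 * q t $ 3"
    have \<tau>s: "(\<tau> has_real_derivative ?g) (at s)" using \<tau>'[OF s] by (simp add: t_def)
    have dQ: "((\<lambda>s. Q s $ i) has_real_derivative inverse (a i) / 2 * u i t * ?g) (at s)"
      unfolding Qn by (rule DERIV_chain2[OF sq[unfolded t_def] \<tau>s[unfolded t_def], folded t_def])
    have dU: "(u i has_real_derivative 2 * dU i (q t)) (at t)" by (rule u'_at[OF t(1,2)])
    have "((\<lambda>s. sqrt (q (\<tau> s) $ i) * u i (\<tau> s)) has_real_derivative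
        (inverse (a i) / 2 * u i t * u i t + 2 * dU i (q t) * a i) * ?g) (at s)"
      using DERIV_chain2[OF DERIV_mult[OF sq dU, unfolded t_def] \<tau>s[unfolded t_def]]
      by (simp add: a_def t_def)
    then have dP: "((\<lambda>s. P s $ i) has_real_derivative
        (inverse (a i) / 2 * u i t * u i t + 2 * dU i (q t) * a i) * ?g) (at s)"
      by (rule has_field_derivative_transform_within_open[of _ _ _ "{0<..<T}"])
         (use s \<tau>in \<pi>_pos in \<open>auto simp: Pn\<close>)
    have G0: "Gam3 E (a 1) (a 2) (a 3) (a 1 * u 1 t) (a 2 * u 2 t) (a 3 * u 3 t) = 0"
      "Gam3 E (a 2) (a 1) (a 3) (a 2 * u 2 t) (a 1 * u 1 t) (a 3 * u 3 t) = 0"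
      "Gam3 E (a 3) (a 1) (a 2) (a 3 * u 3 t) (a 1 * u 1 t) (a 2 * u 2 t) = 0"
    proof -
      show G: "Gam3 E (a 1) (a 2) (a 3) (a 1 * u 1 t) (a 2 * u 2 t) (a 3 * u 3 t) = 0"
        using Gam0[of s] s unfolding Gam_eq_Gam3 aQ by simp
      show "Gam3 E (a 2) (a 1) (a 3) (a 2 * u 2 t) (a 1 * u 1 t) (a 3 * u 3 t) = 0"
        by (subst Gam3_swap(1)) (rule G)
      show "Gam3 E (a 3) (a 1) (a 2) (a 3 * u 3 t) (a 1 * u 1 t) (a 2 * u 2 t) = 0"
        by (subst Gam3_swap(2)) (rule G)
    qed
    have alg: "inverse x / 2 * v * (x * x * (y * y) * (z * z)) = x * v * y\<^sup>2 * z\<^sup>2 / 2"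
      "inverse x / 2 * v * v * (x * x * (y * y) * (z * z)) = x * v\<^sup>2 * y\<^sup>2 * z\<^sup>2 / 2"
      if "0 < x" for x y z v :: real
      using that by (simp_all add: field_simps power2_eq_square)
    have g: "?g = a 1 * a 1 * (a 2 * a 2) * (a 3 * a 3)" "?g = a 2 * a 2 * (a 1 * a 1) * (a 3 * a 3)"
      "?g = a 3 * a 3 * (a 1 * a 1) * (a 2 * a 2)"
      by (simp_all only: a(2) mult_ac)
    consider "i = 1" | "i = 2" | "i = 3" using exhaust_3[of i] by auto
    note i_cases = this
    show "((\<lambda>s. Q s $ i) has_real_derivative dGam_dP (Q s) (P s) $ i) (at s)"
      using i_cases
    proof cases
      case 1
      show ?thesis
        unfolding 1 by (rule DERIV_cong[OF dQ[unfolded 1 g(1)]]) (simp only: dGam_nth aQ alg a(1))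
    next
      case 2
      show ?thesis
        unfolding 2 by (rule DERIV_cong[OF dQ[unfolded 2 g(2)]]) (simp only: dGam_nth aQ alg a(1))
    next
      case 3
      show ?thesis
        unfolding 3 by (rule DERIV_cong[OF dQ[unfolded 3 g(3)]]) (simp only: dGam_nth aQ alg a(1))
    qed
    \<comment> \<open>On the left is the time derivative of \<open>x * v\<close> under Newton's
      equations, multiplied by \<open>dt/ds\<close>; the level-set identity turns it into the
      Hamiltonian force.\<close>
    have key: "(inverse x / 2 * v * v + 2 * partialU (x\<^sup>2) (y\<^sup>2) (z\<^sup>2) * x) * (x * x * (y * y) * (z * z))
      = - partialGam E x y z Y Z"
      if "0 < x" "0 < y" "0 < z" "Gam3 E x y z (x * v) Y Z = 0" for x y z v Y Z
      unfolding partialGam_on_level_set[OF that] distrib_right alg[OF that(1)]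
      by (simp add: power2_eq_square power3_eq_cube mult_ac)
    show "((\<lambda>s. P s $ i) has_real_derivative (- dGam_dQ E (Q s) (P s)) $ i) (at s)"
      using i_cases
    proof cases
      case 1
      show ?thesis
        unfolding 1
        by (rule DERIV_cong[OF dP[unfolded 1 g(1)]])
           (simp only: vector_uminus_component dGam_nth aQ dU_simps a(3)[symmetric] key[OF a(1) a(1) a(1) G0(1)])
    next
      case 2
      show ?thesis
        unfolding 2
        by (rule DERIV_cong[OF dP[unfolded 2 g(2)]])
           (simp only: vector_uminus_component dGam_nth aQ dU_simps a(3)[symmetric] key[OF a(1) a(1) a(1) G0(2)])
    next
      case 3
      show ?thesis
        unfolding 3
        by (rule DERIV_cong[OF dP[unfolded 3 g(3)]])
           (simp only: vector_uminus_component dGam_nth aQ dU_simps a(3)[symmetric] key[OF a(1) a(1) a(1) G0(3)])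
    qed
  qed
  have contv: "continuous_on {0..T} X" if "\<And>i. continuous_on {0..T} (\<lambda>s. X s $ i)" for X :: "real \<Rightarrow> real ^ 3"
    using continuous_on_vec_lambda[of "{0..T}" "\<lambda>i s. X s $ i"] that by simp
  have QC: "continuous_on {0..T} Q" and PC: "continuous_on {0..T} P"
    by (intro contv Q_cont P_cont)+
  have nz: "Q s $ i \<noteq> 0 \<or> Q s $ j \<noteq> 0" if "s \<in> {0..T}" "i \<noteq> j" for s i j
    using dom[OF that(1)] that(2) unfolding regularized_domain_def by blast
  have VP: "continuous_on {0..T} (\<lambda>s. dGam_dP (Q s) (P s))"
  proof (rule contv)
    fix i :: 3
    consider "i = 1" | "i = 2" | "i = 3" using exhaust_3[of i] by auto
    then show "continuous_on {0..T} (\<lambda>s. dGam_dP (Q s) (P s) $ i)"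
      by cases (simp_all only: dGam_nth, (intro continuous_on_mult continuous_on_divide continuous_on_power
        continuous_on_const Q_cont P_cont; simp)+)
  qed
  have VQ: "continuous_on {0..T} (\<lambda>s. - dGam_dQ E (Q s) (P s))"
  proof (intro continuous_on_minus contv)
    fix i :: 3
    consider "i = 1" | "i = 2" | "i = 3" using exhaust_3[of i] by auto
    then show "continuous_on {0..T} (\<lambda>s. dGam_dQ E (Q s) (P s) $ i)"
      by cases (simp_all only: dGam_nth, (intro continuous_on_partialGam Q_cont P_cont nz; simp)+)
  qed
  show thesis
  proof (rule that[of E T Q P])
    show "(Q has_vector_derivative dGam_dP (Q s) (P s)) (at s within {0..T})" if "s \<in> {0..T}" for s
      by (rule vector_derivative_at_endpoints[OF QC VP _ that]) (intro has_vector_derivative_vecI Q')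
    show "(P has_vector_derivative - dGam_dQ E (Q s) (P s)) (at s within {0..T})" if "s \<in> {0..T}" for s
      by (rule vector_derivative_at_endpoints[OF PC VQ _ that]) (intro has_vector_derivative_vecI P')
    show "0 < Q T $ 1" using Q_pos[of T 1] T \<tau>T by auto
    show "Q 0 $ 1 = 0" "Q 0 $ 2 = Q 0 $ 3" "Q T $ 1 = Q T $ 2"
      using q_left q_right by (simp_all add: Qn \<tau>0 \<tau>T)
    have "P 0 $ 2 + P 0 $ 3 = sqrt (q 0 $ 2) * (u 2 0 + u 3 0)"
      by (simp add: Pn \<tau>0 \<pi>_def q_left distrib_left)
    then show "P 0 $ 2 = - P 0 $ 3" using u_left by simp
    have "P T $ 1 + P T $ 2 = sqrt (q 1 $ 2) * (u 1 1 + u 2 1)"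
      by (simp add: Pn \<tau>T \<pi>_pos q_right distrib_left)
    then show "P T $ 1 = - P T $ 2" using u_right by simp
    show "P T $ 3 = 0" using u_right by (simp add: Pn \<tau>T \<pi>_pos)
  qed (use E0 T dom Gam0 in auto)
qed

end

section \<open>Extension by symmetry\<close>

lemma vec_nth_has_derivative: "((\<lambda>p. p $ i) has_derivative (\<lambda>h. h $ i)) F"
  by (rule bounded_linear_imp_has_derivative[OF bounded_linear_vec_nth])

lemma GDERIV_Gam_P: "GDERIV (\<lambda>p. Gam E Q p) P :> dGam_dP Q P"
  unfolding gderiv_def Gam_eq_Gam3 Gam3_def
  by (auto intro!: derivative_eq_intros vec_nth_has_derivative
      simp: inner_vec_def sum_3 dGam_nth fun_eq_iff power2_eq_square field_simps)

lemma inverse_sqrt_pair_derivative: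
  assumes x: "(x has_derivative x') (at q)" and y: "(y has_derivative y') (at q)"
    and pos: "0 < (x q) ^ 4 + (y q) ^ 4"
  shows "((\<lambda>q. 1 / sqrt ((x q) ^ 4 + (y q) ^ 4)) has_derivative
    (\<lambda>h. - (2 * (x q) ^ 3 * x' h + 2 * (y q) ^ 3 * y' h) * (1 / sqrt ((x q) ^ 4 + (y q) ^ 4) ^ 3))) (at q)"
proof -
  define R where "R = (x q) ^ 4 + (y q) ^ 4"
  have R: "0 < R" "0 < sqrt R" using pos by (simp_all add: R_def)
  have "((\<lambda>r. 1 / sqrt r) has_real_derivative - (inverse (sqrt R) / 2) / (sqrt R * sqrt R)) (at R)"
    using R by (auto intro!: derivative_eq_intros)
  moreover have e: "- (inverse w / 2) / (w * w) = - (1 / 2) * (1 / w ^ 3)" if "0 < w" for w :: real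
    using that by (simp add: field_simps power3_eq_cube)
  ultimately have d: "((\<lambda>r. 1 / sqrt r) has_real_derivative - (1 / 2) * (1 / sqrt R ^ 3)) (at R)"
    unfolding e[OF R(2)] by simp
  have "((\<lambda>q. (x q) ^ 4 + (y q) ^ 4) has_derivative (\<lambda>h. 4 * (x q) ^ 3 * x' h + 4 * (y q) ^ 3 * y' h)) (at q)"
    by (auto intro!: derivative_eq_intros x y)
  from DERIV_compose_FDERIV[OF d[unfolded R_def] this]
  moreover have "(4 * (x q) ^ 3 * x' h + 4 * (y q) ^ 3 * y' h) * (- (1 / 2) * c)
      = - (2 * (x q) ^ 3 * x' h + 2 * (y q) ^ 3 * y' h) * c" for h c
    by (simp add: algebra_simps)
  ultimately show ?thesis by (simp only:)
qed

lemma regularized_domain_iff: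
  "Q \<in> regularized_domain \<longleftrightarrow> (Q$1 \<noteq> 0 \<or> Q$2 \<noteq> 0) \<and> (Q$1 \<noteq> 0 \<or> Q$3 \<noteq> 0) \<and> (Q$2 \<noteq> 0 \<or> Q$3 \<noteq> 0)"
  unfolding regularized_domain_def mem_Collect_eq forall_3 by auto

text \<open>The polynomial part and the pair terms are differentiated separately. Writing each
  \<open>1 / sqrt R\<close> as \<open>R * (1 / sqrt R ^ 3)\<close> turns the comparison with
  \<open>dGam_dQ\<close> into a polynomial identity in which the inverse cubes \<open>A\<close>,
  \<open>B\<close>, \<open>C\<close> are atoms.\<close>

lemma GDERIV_Gam_Q:
  assumes "Q \<in> regularized_domain"
  shows "GDERIV (\<lambda>q. Gam E q P) Q :> dGam_dQ E Q P"
proof -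
  have pos: "0 < u ^ 4 + v ^ 4" if "u \<noteq> 0 \<or> v \<noteq> 0" for u v :: real
  proof -
    have "0 \<le> u ^ 4" "0 \<le> v ^ 4" "u \<noteq> 0 \<Longrightarrow> 0 < u ^ 4" "v \<noteq> 0 \<Longrightarrow> 0 < v ^ 4" by auto
    then show ?thesis using that by linarith
  qed
  have nz: "0 < (Q$1)^4 + (Q$2)^4" "0 < (Q$1)^4 + (Q$3)^4" "0 < (Q$2)^4 + (Q$3)^4"
    using assms pos unfolding regularized_domain_iff by auto
  define S where "S = (\<lambda>i j. 1 / sqrt ((Q$i)^4 + (Q$j)^4) ^ 3)"
  have r: "((\<lambda>q. 1 / sqrt ((q$i)^4 + (q$j)^4)) has_derivative
      (\<lambda>h. - (2 * (Q$i)^3 * h$i + 2 * (Q$j)^3 * h$j) * S i j)) (at Q)"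
    if "0 < (Q$i)^4 + (Q$j)^4" for i j
    unfolding S_def by (rule inverse_sqrt_pair_derivative[OF vec_nth_has_derivative vec_nth_has_derivative that])
  have R: "1 / sqrt ((Q$i)^4 + (Q$j)^4) = ((Q$i)^4 + (Q$j)^4) * S i j" if "0 < (Q$i)^4 + (Q$j)^4" for i j
  proof -
    define R where "R = sqrt ((Q$i)^4 + (Q$j)^4)"
    have "R > 0" "R * R = (Q$i)^4 + (Q$j)^4" using that by (simp_all add: R_def)
    then show ?thesis
      unfolding S_def R_def[symmetric] by (simp flip: \<open>R * R = (Q$i)^4 + (Q$j)^4\<close> add: power3_eq_cube)
  qed
  define A B C where "A = S 1 2" and "B = S 1 3" and "C = S 2 3"
  have D: "dGam_dQ E Q P $ 1 = Q$1 * ((P$2)\<^sup>2 * (Q$3)\<^sup>2 + (Q$2)\<^sup>2 * (P$3)\<^sup>2) / 2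
     - 8 * Q$1 * (Q$2)^6 * (Q$3)\<^sup>2 * A - 8 * Q$1 * (Q$3)^6 * (Q$2)\<^sup>2 * B
     - 8 * Q$1 * (Q$2)\<^sup>2 * (Q$3)\<^sup>2 * (((Q$2)^4 + (Q$3)^4) * C) - Q$1 * ((Q$2)\<^sup>2 + (Q$3)\<^sup>2)
     - 2 * E * Q$1 * (Q$2)\<^sup>2 * (Q$3)\<^sup>2"
    "dGam_dQ E Q P $ 2 = Q$2 * ((P$1)\<^sup>2 * (Q$3)\<^sup>2 + (Q$1)\<^sup>2 * (P$3)\<^sup>2) / 2
     - 8 * Q$2 * (Q$1)^6 * (Q$3)\<^sup>2 * A - 8 * Q$2 * (Q$3)^6 * (Q$1)\<^sup>2 * C
     - 8 * Q$2 * (Q$1)\<^sup>2 * (Q$3)\<^sup>2 * (((Q$1)^4 + (Q$3)^4) * B) - Q$2 * ((Q$1)\<^sup>2 + (Q$3)\<^sup>2)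
     - 2 * E * Q$2 * (Q$1)\<^sup>2 * (Q$3)\<^sup>2"
    "dGam_dQ E Q P $ 3 = Q$3 * ((P$1)\<^sup>2 * (Q$2)\<^sup>2 + (Q$1)\<^sup>2 * (P$2)\<^sup>2) / 2
     - 8 * Q$3 * (Q$1)^6 * (Q$2)\<^sup>2 * B - 8 * Q$3 * (Q$2)^6 * (Q$1)\<^sup>2 * C
     - 8 * Q$3 * (Q$1)\<^sup>2 * (Q$2)\<^sup>2 * (((Q$1)^4 + (Q$2)^4) * A) - Q$3 * ((Q$1)\<^sup>2 + (Q$2)\<^sup>2)
     - 2 * E * Q$3 * (Q$1)\<^sup>2 * (Q$2)\<^sup>2"
    unfolding dGam_nth partialGam_def A_def B_def C_def R[OF nz(1), symmetric] R[OF nz(2), symmetric] R[OF nz(3), symmetric]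
    by (simp_all add: S_def add.commute)
  have poly: "((\<lambda>q. ((P$1)\<^sup>2 * (q$2)\<^sup>2 * (q$3)\<^sup>2 + (q$1)\<^sup>2 * (P$2)\<^sup>2 * (q$3)\<^sup>2 + (q$1)\<^sup>2 * (q$2)\<^sup>2 * (P$3)\<^sup>2) / 4
     - ((q$2)\<^sup>2 * (q$3)\<^sup>2 + (q$1)\<^sup>2 * (q$3)\<^sup>2 + (q$1)\<^sup>2 * (q$2)\<^sup>2) / 2 - E * (q$1)\<^sup>2 * (q$2)\<^sup>2 * (q$3)\<^sup>2) has_derivative
     (\<lambda>h. h$1 * (Q$1 * ((P$2)\<^sup>2 * (Q$3)\<^sup>2 + (Q$2)\<^sup>2 * (P$3)\<^sup>2) / 2 - Q$1 * ((Q$2)\<^sup>2 + (Q$3)\<^sup>2) - 2 * E * Q$1 * (Q$2)\<^sup>2 * (Q$3)\<^sup>2)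
       + h$2 * (Q$2 * ((P$1)\<^sup>2 * (Q$3)\<^sup>2 + (Q$1)\<^sup>2 * (P$3)\<^sup>2) / 2 - Q$2 * ((Q$1)\<^sup>2 + (Q$3)\<^sup>2) - 2 * E * Q$2 * (Q$1)\<^sup>2 * (Q$3)\<^sup>2)
       + h$3 * (Q$3 * ((P$1)\<^sup>2 * (Q$2)\<^sup>2 + (Q$1)\<^sup>2 * (P$2)\<^sup>2) / 2 - Q$3 * ((Q$1)\<^sup>2 + (Q$2)\<^sup>2) - 2 * E * Q$3 * (Q$1)\<^sup>2 * (Q$2)\<^sup>2))) (at Q)"
    by (auto intro!: derivative_eq_intros vec_nth_has_derivative simp: fun_eq_iff power2_eq_square field_simps)
  have sing: "((\<lambda>q. 4 * (q$1)\<^sup>2 * (q$2)\<^sup>2 * (q$3)\<^sup>2 * (1 / sqrt ((q$1)^4 + (q$2)^4) + 1 / sqrt ((q$1)^4 + (q$3)^4) + 1 / sqrt ((q$2)^4 + (q$3)^4)))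
    has_derivative (\<lambda>h. 4 * (Q$1)\<^sup>2 * (Q$2)\<^sup>2 * (Q$3)\<^sup>2 *
        (- (2 * (Q$1)^3 * h$1 + 2 * (Q$2)^3 * h$2) * A - (2 * (Q$1)^3 * h$1 + 2 * (Q$3)^3 * h$3) * B
         - (2 * (Q$2)^3 * h$2 + 2 * (Q$3)^3 * h$3) * C)
      + (8 * (Q$1 * h$1 * (Q$2)\<^sup>2 * (Q$3)\<^sup>2 + (Q$1)\<^sup>2 * Q$2 * h$2 * (Q$3)\<^sup>2 + (Q$1)\<^sup>2 * (Q$2)\<^sup>2 * Q$3 * h$3)) *
        (((Q$1)^4 + (Q$2)^4) * A + ((Q$1)^4 + (Q$3)^4) * B + ((Q$2)^4 + (Q$3)^4) * C))) (at Q)"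
  proof (rule has_derivative_eq_rhs[OF has_derivative_mult[OF _ has_derivative_add[OF has_derivative_add[OF r[OF nz(1)] r[OF nz(2)]] r[OF nz(3)]]]])
    show "((\<lambda>q. 4 * (q$1)\<^sup>2 * (q$2)\<^sup>2 * (q$3)\<^sup>2) has_derivative
      (\<lambda>h. 8 * (Q$1 * h$1 * (Q$2)\<^sup>2 * (Q$3)\<^sup>2 + (Q$1)\<^sup>2 * Q$2 * h$2 * (Q$3)\<^sup>2 + (Q$1)\<^sup>2 * (Q$2)\<^sup>2 * Q$3 * h$3))) (at Q)"
      by (auto intro!: derivative_eq_intros vec_nth_has_derivative simp: fun_eq_iff power2_eq_square field_simps)
  qed (simp only: R[OF nz(1)] R[OF nz(2)] R[OF nz(3)] A_def[symmetric] B_def[symmetric] C_def[symmetric] diff_conv_add_uminus mult_minus_left)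
  show ?thesis
    unfolding gderiv_def Gam_eq_Gam3 Gam3_def
    by (rule has_derivative_eq_rhs[OF has_derivative_transform[OF _ _ has_derivative_diff[OF poly sing]]])
       (auto simp: fun_eq_iff inner_vec_def sum_3 D field_simps power_numeral_reduce)
qed

section \<open>Gluing solutions along a symmetry of finite order\<close>

lemma has_vector_derivative_Un:
  "(f has_vector_derivative f') (at x within S) \<Longrightarrow> (f has_vector_derivative f') (at x within T) \<Longrightarrow>
    (f has_vector_derivative f') (at x within S \<union> T)"
  unfolding has_vector_derivative_def has_derivative_within by (simp add: Lim_within_Un)

text \<open>Off a closed set the filter is trivial and every vector is a derivative. Derivatives on
  unions of cells can thus be combined without asking which cells contain the point.\<close>

lemma has_vector_derivative_outside:
  assumes "closed S" "x \<notin> S"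
  shows "(f has_vector_derivative f') (at x within S)"
proof -
  have "at x within S = bot"
    using assms by (simp add: at_within_eq_bot_iff closed_limpt)
  then show ?thesis
    by (simp add: has_vector_derivative_def has_derivative_def bounded_linear_scaleR_left)
qed

text \<open>The \<open>k\<close>-th cell of length \<open>2 * T\<close> carries the image of
  \<open>Y\<close> under the \<open>k\<close>-th power of \<open>M\<close>, a solution because
  \<open>M\<close> commutes with \<open>V\<close>. Adjacent cells agree at their common end by
  \<open>glue\<close>, and their one-sided derivatives agree because both are given by
  \<open>V\<close>.\<close>

lemma periodic_extension:
  fixes Y :: "real \<Rightarrow> 'a::real_normed_vector" and M V :: "'a \<Rightarrow> 'a"
  assumes T: "0 < T" and M: "bounded_linear M" and VM: "\<And>x. V (M x) = M (V x)"
    and Y: "\<And>s. s \<in> {-T..T} \<Longrightarrow> (Y has_vector_derivative V (Y s)) (at s within {-T..T})"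
    and glue: "M (Y (-T)) = Y T" and order: "0 < n" "(M ^^ n) = id"
  obtains Z where "\<And>s. (Z has_vector_derivative V (Z s)) (at s)" "\<And>s. Z (s + 2 * T * real n) = Z s"
    "\<And>s. s \<in> {-T..T} \<Longrightarrow> Z s = Y s" "\<And>s. \<exists>j. \<exists>r\<in>{-T..T}. Z s = (M ^^ j) (Y r)"
proof -
  define \<kappa> where "\<kappa> = (\<lambda>s. \<lfloor>(s + T) / (2 * T)\<rfloor>)"
  \<comment> \<open>Cells with negative index call for inverse powers of \<open>M\<close>; reducing
    exponents modulo \<open>n\<close> replaces them by natural powers.\<close>
  define J where "J = (\<lambda>k::int. nat (k mod int n))"
  define Z where "Z = (\<lambda>s. (M ^^ J (\<kappa> s)) (Y (s - 2 * T * of_int (\<kappa> s))))"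
  define C where "C = (\<lambda>k::int. {2 * T * of_int k - T..2 * T * of_int k + T})"
  have \<kappa>_iff: "\<kappa> s = k \<longleftrightarrow> 2 * T * of_int k - T \<le> s \<and> s < 2 * T * of_int k + T" for s k
    unfolding \<kappa>_def floor_eq_iff using T by (simp add: field_simps)
  have \<kappa>_bounds: "2 * T * of_int (\<kappa> s) - T \<le> s" "s < 2 * T * of_int (\<kappa> s) + T" for s
    using \<kappa>_iff[of s "\<kappa> s"] by auto
  have J_Suc: "(M ^^ J (k + 1)) x = (M ^^ J k) (M x)" for k x
  proof (cases "k mod int n = int n - 1")
    case True
    then have "J (k + 1) = 0" "Suc (J k) = n"
      using order(1) by (auto simp: J_def mod_add_left_eq[of k "int n" 1, symmetric])
    then show ?thesis
      using order(2) by (metis comp_apply funpow_0 funpow_Suc_right id_apply)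
  next
    case False
    have "0 \<le> k mod int n" "k mod int n < int n" using order(1) by simp_all
    then have "(k + 1) mod int n = k mod int n + 1"
      using False by (subst mod_add_left_eq[symmetric]) (simp add: mod_pos_pos_trivial)
    then have "J (k + 1) = Suc (J k)" using \<open>0 \<le> k mod int n\<close> by (simp add: J_def nat_add_distrib)
    then show ?thesis by (simp add: funpow_swap1)
  qed
  have Z_cell: "Z s = (M ^^ J k) (Y (s - 2 * T * of_int k))" if "s \<in> C k" for s k
  proof (cases "s < 2 * T * of_int k + T")
    case True
    then have "\<kappa> s = k" using that \<kappa>_iff by (simp add: C_def)
    then show ?thesis by (simp add: Z_def)
  next
    case False
    then have s: "s = 2 * T * of_int k + T" using that by (simp add: C_def)
    then have "\<kappa> s = k + 1" using \<kappa>_iff[of s "k + 1"] T by (simp add: algebra_simps)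
    moreover have "s - 2 * T * of_int (k + 1) = - T" "s - 2 * T * of_int k = T" using s by (simp_all add: algebra_simps)
    ultimately show ?thesis unfolding Z_def by (simp add: J_Suc glue)
  qed
  have VMj: "V ((M ^^ j) x) = (M ^^ j) (V x)" for j x
    by (induction j) (simp_all add: VM)
  have blj: "bounded_linear (M ^^ j)" for j
    by (induction j) (simp_all add: bounded_linear_compose[OF M, unfolded o_def] o_def id_def bounded_linear_ident)
  have der_cell: "(Z has_vector_derivative V (Z s)) (at s within C k)" for s k
  proof (cases "s \<in> C k")
    case True
    let ?c = "2 * T * of_int k"
    have img: "(\<lambda>s. s - ?c) ` C k = {-T..T}"
    proof -
      have "C k = (\<lambda>s. s + ?c) ` {-T..T}" by (simp add: C_def algebra_simps)
      then show ?thesis by (simp add: image_image)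
    qed
    have "(Y has_vector_derivative V (Y (s - ?c))) (at (s - ?c) within (\<lambda>s. s - ?c) ` C k)"
      unfolding img by (rule Y) (use True in \<open>auto simp: C_def\<close>)
    moreover have "((\<lambda>s. s - ?c) has_vector_derivative 1) (at s within C k)"
      by (auto intro!: derivative_eq_intros)
    ultimately have "((\<lambda>s. Y (s - ?c)) has_vector_derivative V (Y (s - ?c))) (at s within C k)"
      using vector_diff_chain_within[of "\<lambda>s. s - ?c" 1 s "C k" Y "V (Y (s - ?c))"] by (simp add: o_def)
    from bounded_linear.has_vector_derivative[OF blj[of "J k"] this]
    have "((\<lambda>s. (M ^^ J k) (Y (s - ?c))) has_vector_derivative V (Z s)) (at s within C k)"
      unfolding Z_cell[OF True] VMj .
    then show ?thesis
      by (rule has_vector_derivative_transform[OF True, rotated]) (simp add: Z_cell)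
  qed (auto intro!: has_vector_derivative_outside simp: C_def)
  show thesis
  proof (rule that[of Z])
    fix s
    define k where "k = \<kappa> s"
    \<comment> \<open>The point may be the left end of its cell, so the preceding cell is added to
      obtain a neighbourhood.\<close>
    have "C (k - 1) \<union> C k = {2 * T * of_int (k - 1) - T..2 * T * of_int k + T}"
      using T by (auto simp: C_def algebra_simps)
    moreover have "2 * T * of_int (k - 1) - T < s" "s < 2 * T * of_int k + T"
      using \<kappa>_bounds[of s] T by (auto simp: k_def algebra_simps)
    moreover have "(Z has_vector_derivative V (Z s)) (at s within C (k - 1) \<union> C k)"
      by (intro has_vector_derivative_Un der_cell)
    ultimately show "(Z has_vector_derivative V (Z s)) (at s)"
      by (simp add: at_within_Icc_at)
    have "\<kappa> (s + 2 * T * real n) = \<kappa> s + int n"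
      unfolding \<kappa>_iff using \<kappa>_bounds[of s] by (simp add: algebra_simps)
    then show "Z (s + 2 * T * real n) = Z s"
      by (simp add: Z_def J_def algebra_simps)
    show "\<exists>j. \<exists>r\<in>{-T..T}. Z s = (M ^^ j) (Y r)"
      using \<kappa>_bounds[of s] unfolding Z_def
      by (intro exI[of _ "J (\<kappa> s)"] bexI[of _ "s - 2 * T * of_int (\<kappa> s)"]) auto
    show "Z s = Y s" if "s \<in> {-T..T}"
      using Z_cell[of s 0] that by (simp add: C_def J_def)
  qed
qed

section \<open>Symmetries of the Hamiltonian and the periodic orbit\<close>

definition vec3 :: "real \<Rightarrow> real \<Rightarrow> real \<Rightarrow> real ^ 3" where
  "vec3 a b c = (\<chi> i. if i = 1 then a else if i = 2 then b else c)"

lemma vec3_nth [simp]: "vec3 a b c $ 1 = a" "vec3 a b c $ 2 = b" "vec3 a b c $ 3 = c"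
  by (simp_all add: vec3_def)

lemma vec3_eq_iff: "x = (y :: real ^ 3) \<longleftrightarrow> x$1 = y$1 \<and> x$2 = y$2 \<and> x$3 = y$3"
  by (simp add: vec_eq_iff forall_3)

definition hamiltonian_field :: "real \<Rightarrow> (real ^ 3) \<times> (real ^ 3) \<Rightarrow> (real ^ 3) \<times> (real ^ 3)" where
  "hamiltonian_field E = (\<lambda>(Q, P). (dGam_dP Q P, - dGam_dQ E Q P))"

text \<open>
  Two symmetries of \<open>\<Gamma>\<close>: \<open>reversal\<close> reverses time and fixes the left end of the arc; \<open>rotation\<close> is its
  composition with the time-reversing symmetry fixing the right end.
\<close>
definition reversal :: "(real ^ 3) \<times> (real ^ 3) \<Rightarrow> (real ^ 3) \<times> (real ^ 3)" where
  "reversal = (\<lambda>(Q, P). (vec3 (- Q$1) (Q$3) (Q$2), vec3 (P$1) (- P$3) (- P$2)))"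

definition rotation :: "(real ^ 3) \<times> (real ^ 3) \<Rightarrow> (real ^ 3) \<times> (real ^ 3)" where
  "rotation = (\<lambda>(Q, P). (vec3 (Q$3) (- Q$1) (Q$2), vec3 (P$3) (- P$1) (P$2)))"

lemma bounded_linear_reversal: "bounded_linear reversal"
  unfolding linear_conv_bounded_linear[symmetric]
  by (rule linearI) (auto simp: reversal_def vec3_eq_iff)

lemma bounded_linear_rotation: "bounded_linear rotation"
  unfolding linear_conv_bounded_linear[symmetric]
  by (rule linearI) (auto simp: rotation_def vec3_eq_iff)

lemma partialGam_symmetries:
  "partialGam E (- a) b c y z = - partialGam E a b c y z"
  "partialGam E a (- b) c y z = partialGam E a b c y z"
  "partialGam E a b (- c) y z = partialGam E a b c y z"
  "partialGam E a b c (- y) z = partialGam E a b c y z"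
  "partialGam E a b c y (- z) = partialGam E a b c y z"
  by (simp_all add: partialGam_def)

lemma partialGam_swap: "partialGam E a c b z y = partialGam E a b c y z"
  by (simp add: partialGam_def add.commute mult.commute mult.left_commute algebra_simps)

text \<open>The minus sign is the reversal of time. Since \<open>Q$1\<close> changes sign and
  \<open>P$1\<close> does not, the orbit crosses \<open>Q$1 = 0\<close> instead of turning back; in
  \<open>q$1 = Q$1^2\<close> this crossing is the bounce.\<close>

lemma hamiltonian_field_reversal: "hamiltonian_field E (reversal X) = - reversal (hamiltonian_field E X)"
proof (cases X)
  case (Pair Q P)
  show ?thesis
    unfolding Pair
    by (simp add: hamiltonian_field_def reversal_def vec3_eq_iff dGam_nth partialGam_symmetries
        partialGam_swap[of E "Q$1" "Q$3"] partialGam_swap[of E "Q$2" "Q$3"] partialGam_swap[of E "Q$3" "Q$2"])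
qed

lemma hamiltonian_field_rotation: "hamiltonian_field E (rotation X) = rotation (hamiltonian_field E X)"
proof (cases X)
  case (Pair Q P)
  show ?thesis
    unfolding Pair
    by (simp add: hamiltonian_field_def rotation_def vec3_eq_iff dGam_nth partialGam_symmetries
        partialGam_swap[of E "Q$1" "Q$3"] partialGam_swap[of E "Q$2" "Q$3"] partialGam_swap[of E "Q$3" "Q$2"])
qed

text \<open>The cube of \<open>rotation\<close> negates both \<open>Q\<close> and \<open>P\<close>.
  This leaves \<open>q\<close> and \<open>p\<close> unchanged but is not the identity in regularized
  coordinates, hence 6 instead of 3.\<close>

lemma rotation_order: "rotation ^^ 6 = id"
proof
  fix X :: "(real ^ 3) \<times> (real ^ 3)"
  obtain Q P where X: "X = (Q, P)" by (cases X)
  show "(rotation ^^ 6) X = id X"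
    by (simp add: X rotation_def numeral_eq_Suc vec3_eq_iff)
qed

definition level_set :: "real \<Rightarrow> ((real ^ 3) \<times> (real ^ 3)) set" where
  "level_set E = {(Q, P). Q \<in> regularized_domain \<and> Gam E Q P = 0}"

lemma level_set_symmetries:
  assumes "X \<in> level_set E"
  shows "reversal X \<in> level_set E" "rotation X \<in> level_set E"
proof -
  have "Gam3 E (- a) c b x (- z) (- y) = Gam3 E a b c x y z" "Gam3 E c (- a) b z (- x) y = Gam3 E a b c x y z" for a b c x y z
    using Gam3_swap(2)[of E c a b z x y]
    by (simp_all add: Gam3_def add.commute mult.commute mult.left_commute algebra_simps)
  then show "reversal X \<in> level_set E" "rotation X \<in> level_set E"
    using assms by (auto simp: level_set_def reversal_def rotation_def regularized_domain_iff Gam_eq_Gam3)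
qed

theorem theorem8:
  "\<exists>(E::real) (Q :: real \<Rightarrow> real ^ 3) (P :: real \<Rightarrow> real ^ 3).
     E < 0 \<and> regularized_solution E Q P \<and> periodic_orbit (\<lambda>s. (Q s, P s))"
proof -
  obtain q u where "fundamental_arc q u"
    using fundamental_arc_exists by blast
  then interpret fundamental_arc q u .
  show ?thesis
  proof (rule regularized_arc)
    fix E T Q P
    assume E: "E < 0" and T: "0 < T"
      and Q': "\<And>s. s \<in> {0..T} \<Longrightarrow> (Q has_vector_derivative dGam_dP (Q s) (P s)) (at s within {0..T})"
      and P': "\<And>s. s \<in> {0..T} \<Longrightarrow> (P has_vector_derivative - dGam_dQ E (Q s) (P s)) (at s within {0..T})"
      and dom: "\<And>s. s \<in> {0..T} \<Longrightarrow> Q s \<in> regularized_domain" "\<And>s. s \<in> {0..T} \<Longrightarrow> Gam E (Q s) (P s) = 0"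
      and bc: "0 < Q T $ 1" "Q 0 $ 1 = 0" "Q 0 $ 2 = Q 0 $ 3" "P 0 $ 2 = - P 0 $ 3"
        "Q T $ 1 = Q T $ 2" "P T $ 1 = - P T $ 2" "P T $ 3 = 0"
    define X where "X = (\<lambda>s. (Q s, P s))"
    have X': "(X has_vector_derivative hamiltonian_field E (X s)) (at s within {0..T})" if "s \<in> {0..T}" for s
      unfolding X_def hamiltonian_field_def using Q'[OF that] P'[OF that] by (simp add: has_vector_derivative_Pair)
    \<comment> \<open>The composition sends \<open>Q\<close> to \<open>(Q$2, Q$1, Q$3)\<close> and
      \<open>P\<close> to \<open>(- P$2, - P$1, - P$3)\<close>, so its fixed points are described by
      the conditions at \<open>T\<close>, just as those at 0 describe the fixed points of
      \<open>reversal\<close>.\<close>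
    have X0: "reversal (X 0) = X 0" and XT: "rotation (reversal (X T)) = X T"
      using bc by (auto simp: X_def reversal_def rotation_def vec3_eq_iff)
    define Y where "Y = (\<lambda>s. if 0 \<le> s then X s else reversal (X (- s)))"
    have Y_neg: "Y s = reversal (X (- s))" if "s \<le> 0" for s
      using that X0 by (cases "s = 0") (auto simp: Y_def)
    have Y': "(Y has_vector_derivative hamiltonian_field E (Y s)) (at s within {-T..T})" if s: "s \<in> {-T..T}" for s
    proof -
      have "(Y has_vector_derivative hamiltonian_field E (Y s)) (at s within {0..T})"
      proof (cases "s \<in> {0..T}")
        case True
        then have "(X has_vector_derivative hamiltonian_field E (Y s)) (at s within {0..T})"
          using X'[OF True] by (simp add: Y_def)
        then show ?thesis
          by (rule has_vector_derivative_transform[OF True, rotated]) (simp add: Y_def)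
      qed (auto intro!: has_vector_derivative_outside)
      moreover have "(Y has_vector_derivative hamiltonian_field E (Y s)) (at s within {-T..0})"
      proof (cases "s \<in> {-T..0}")
        case True
        have "(X has_vector_derivative hamiltonian_field E (X (- s))) (at (- s) within uminus ` {-T..0})"
          using X'[of "- s"] True by (simp add: image_uminus_atLeastAtMost)
        moreover have "(uminus has_vector_derivative - 1) (at s within {-T..0})"
          by (auto intro!: derivative_eq_intros)
        ultimately have "((\<lambda>s. X (- s)) has_vector_derivative - hamiltonian_field E (X (- s))) (at s within {-T..0})"
          using vector_diff_chain_within[of uminus "-1" s "{-T..0}" X "hamiltonian_field E (X (- s))"] by (simp add: o_def)
        from bounded_linear.has_vector_derivative[OF bounded_linear_reversal this]
        have "((\<lambda>s. reversal (X (- s))) has_vector_derivative hamiltonian_field E (Y s)) (at s within {-T..0})"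
          using True by (simp add: Y_neg hamiltonian_field_reversal linear_neg[OF bounded_linear.linear[OF bounded_linear_reversal]])
        then show ?thesis
          by (rule has_vector_derivative_transform[OF True, rotated]) (simp add: Y_neg)
      qed (auto intro!: has_vector_derivative_outside)
      ultimately have "(Y has_vector_derivative hamiltonian_field E (Y s)) (at s within {0..T} \<union> {-T..0})"
        by (rule has_vector_derivative_Un)
      moreover have "{0..T} \<union> {-T..0} = {-T..T}" using T by auto
      ultimately show ?thesis by simp
    qed
    have YT: "rotation (Y (- T)) = Y T"
      using XT T by (simp add: Y_neg) (simp add: Y_def)
    have Y_level: "Y s \<in> level_set E" if "s \<in> {-T..T}" for s
    proof -
      have "X r \<in> level_set E" if "r \<in> {0..T}" for r
        using dom[OF that] by (simp add: level_set_def X_def)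
      then show ?thesis using that level_set_symmetries(1) by (auto simp: Y_def)
    qed
    obtain Z where Z': "\<And>s. (Z has_vector_derivative hamiltonian_field E (Z s)) (at s)"
      and per: "\<And>s. Z (s + 2 * T * real 6) = Z s" and ZY: "\<And>s. s \<in> {-T..T} \<Longrightarrow> Z s = Y s"
      and Z_orbit: "\<And>s. \<exists>j. \<exists>r\<in>{-T..T}. Z s = (rotation ^^ j) (Y r)"
      using periodic_extension[OF T bounded_linear_rotation hamiltonian_field_rotation Y' YT _ rotation_order] by (metis zero_less_numeral)
    have Z_level: "Z s \<in> level_set E" for s
    proof -
      obtain j r where r: "r \<in> {-T..T}" "Z s = (rotation ^^ j) (Y r)" using Z_orbit by blast
      have "(rotation ^^ i) (Y r) \<in> level_set E" for i
        by (induction i) (simp_all add: Y_level[OF r(1)] level_set_symmetries(2))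
      then show ?thesis by (simp only: r(2))
    qed
    show ?thesis
    proof (rule exI[of _ E], rule exI[of _ "\<lambda>s. fst (Z s)"], rule exI[of _ "\<lambda>s. snd (Z s)"], intro conjI E)
      show "regularized_solution E (\<lambda>s. fst (Z s)) (\<lambda>s. snd (Z s))"
        unfolding regularized_solution_def
      proof (intro allI conjI exI)
        fix s
        show dom: "fst (Z s) \<in> regularized_domain" "Gam E (fst (Z s)) (snd (Z s)) = 0"
          using Z_level[of s] by (auto simp: level_set_def)
        show "((\<lambda>s. fst (Z s)) has_vector_derivative dGam_dP (fst (Z s)) (snd (Z s))) (at s)"
          using bounded_linear.has_vector_derivative[OF bounded_linear_fst Z'[of s]]
          by (simp add: hamiltonian_field_def split_beta)
        show "((\<lambda>s. snd (Z s)) has_vector_derivative - dGam_dQ E (fst (Z s)) (snd (Z s))) (at s)"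
          using bounded_linear.has_vector_derivative[OF bounded_linear_snd Z'[of s]]
          by (simp add: hamiltonian_field_def split_beta)
        show "GDERIV (\<lambda>p. Gam E (fst (Z s)) p) (snd (Z s)) :> dGam_dP (fst (Z s)) (snd (Z s))"
          by (rule GDERIV_Gam_P)
        show "GDERIV (\<lambda>q. Gam E q (snd (Z s))) (fst (Z s)) :> - (- dGam_dQ E (fst (Z s)) (snd (Z s)))"
          unfolding minus_minus by (rule GDERIV_Gam_Q[OF dom(1)])
      qed
      \<comment> \<open>The orbit is not constant: \<open>Q$1\<close> vanishes at the collision and
        is positive at \<open>T\<close>.\<close>
      have "Z T = X T" "Z 0 = X 0" using T ZY[of T] ZY[of 0] by (auto simp: Y_def)
      then have "Z T \<noteq> Z 0" using bc(1,2) by (auto simp: X_def)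
      moreover have "\<exists>T>0. \<forall>s. Z (s + T) = Z s"
        using per T by (intro exI[of _ "2 * T * real 6"]) auto
      ultimately show "periodic_orbit (\<lambda>s. (fst (Z s), snd (Z s)))"
        unfolding periodic_orbit_def by auto
    qed
  qed
qed

end
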